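(* Consider the aggregation tree with nodes $\tau=\{\varnothing,(1),(1,1),(1,2),(2)\}$, discrete leaf distribution functions $F_{1,1},F_{1,2},F_2$, and bivariate copulas $C_1$ (for the children $(1,1),(1,2)$ of node $(1)$) and $C_\varnothing$ (for the children $(1),(2)$ of the root), where $C_1$ and $C_\varnothing$ are absolutely continuous with densities $c_1,c_\varnothing$ satisfying, for $I\in\{1,\varnothing\}$, \[ \lim_{\delta\to 0}\ \sup_{t\in\mathbb{R}}\int_{U_\delta(B_I(t))} c_I(u_1,u_2)\,du_1\,du_2=0 . \] Let $\boldsymbol{X}_\varnothing=(X_{1,1},X_{1,2},X_2)$ be the tree dependent random vector of this model, with distribution function $F_\tau$. For $n\in\mathbb{N}$ let $\boldsymbol{X}_\varnothing^{(k:n)}=(X_{1,1}^{(k:n)},X_{1,2}^{(k:n)},X_2^{(k:n)})$, $k=1,\ldots,n$, be the vectors output at the root by the modified reordering algorithm (MRA) with parameter $n$, and set $X_1^{(k:n)}=X_{1,1}^{(k:n)}+X_{1,2}^{(k:n)}$. Then for every $n$ the vectors $\boldsymbol{X}_\varnothing^{(1:n)},\ldots,\boldsymbol{X}_\varnothing^{(n:n)}$ are i.i.d.; each satisfies the conditional independence \[ (X_{1,1}^{(k:n)},X_{1,2}^{(k:n)},X_1^{(k:n)})\perp (X_2^{(k:n)},X_1^{(k:n)}+X_2^{(k:n)})\ \big|\ X_1^{(k:n)}; \] $\boldsymbol{X}_\varnothing^{(1:n)}$ converges in distribution to $\boldsymbol{X}_\varnothing$ as $n\to\infty$; and if $F_\tau^n$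 denotes the empirical distribution function of $\boldsymbol{X}_\varnothing^{(1:n)},\ldots,\boldsymbol{X}_\varnothing^{(n:n)}$, then \[ \lim_{n\to\infty}\sup_{\boldsymbol{x}\in\mathbb{R}^3}\left|F_\tau^n(\boldsymbol{x})-F_\tau(\boldsymbol{x})\right|=0\quad P\text{-a.s.} \]
   Context: Distributions of the model: $G_1(x_1,x_2)=C_1(F_{1,1}(x_1),F_{1,2}(x_2))$, $F_1$ the distribution function of $x_1+x_2$ under $G_1$, and $G_\varnothing(y_1,y_2)=C_\varnothing(F_1(y_1),F_2(y_2))$. For $I\in\{1,\varnothing\}$ with children distribution functions $F_{I,1},F_{I,2}$ (i.e. $F_{1,1},F_{1,2}$ for $I=1$ and $F_1,F_2$ for $I=\varnothing$): $B_I(t)=\{(F_{I,1}(x_1),F_{I,2}(x_2)):x_1+x_2=t\}$ and $U_\delta(B_I(t))$ is the set of points of $[0,1]^2$ at Euclidean distance $<\delta$ from $B_I(t)$. Tree dependent vector: a random vector $(X_{1,1},X_{1,2},X_2)$ with $X_{1,1}\sim F_{1,1}$, $X_{1,2}\sim F_{1,2}$, $X_2\sim F_2$, $P[X_{1,1}\le x_1,X_{1,2}\le x_2]=G_1(x_1,x_2)$, and with $X_1:=X_{1,1}+X_{1,2}$, $P[X_1\le y_1,X_2\le y_2]=G_\varnothing(y_1,y_2)$, and such that $(X_{1,1},X_{1,2},X_1)\perp(X_2,X_1+X_2)\mid X_1$; its distribution is unique. MRA with parameter $n$: a call at a node returns a random batch of $n$ items; different calls use independent randomness. At a leaf $J$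 the batch is $n$ i.i.d. draws from $F_J$. At a branching node $I$ with children $(I,1),(I,2)$: for each $\ell=1,\ldots,n$, independently over $\ell$, obtain for each child an independent batch $({}^{\ell}X_{I,i}^k,{}^{\ell}\boldsymbol{X}_{I,i}^k)_{k=1}^n$ by an independent call at the child (for a leaf child, $\boldsymbol{X}=X$; for a branching child, ${}^{\ell}\boldsymbol{X}_{I,i}^k$ is the vector of leaf values and ${}^{\ell}X_{I,i}^k$ their sum), and $n$ i.i.d. samples ${}^{\ell}\boldsymbol{U}_I^k=({}^{\ell}U_I^{k,1},{}^{\ell}U_I^{k,2})\sim C_I$. Let ${}^{\ell}p_{I,i}(k)$ be the rank of ${}^{\ell}U_I^{k,i}$ among ${}^{\ell}U_I^{1,i},\ldots,{}^{\ell}U_I^{n,i}$, ${}^{\ell}q_{I,i}$ the permutation with ${}^{\ell}q_{I,i}(k)$ the rank of ${}^{\ell}X_{I,i}^k$ among ${}^{\ell}X_{I,i}^1,\ldots,{}^{\ell}X_{I,i}^n$ (ties broken so that it is a permutation), and $\sigma^{\ell}={}^{\ell}q_{I,2}^{-1}\circ{}^{\ell}p_{I,2}\circ{}^{\ell}p_{I,1}^{-1}\circ{}^{\ell}q_{I,1}$. The output batch at $I$ is, for $k=1,\ldots,n$: the vector of leaf values $\boldsymbol{X}_I^k=({}^{k}\boldsymbol{X}_{I,1}^{k},{}^{k}\boldsymbol{X}_{I,2}^{\sigma^k(k)})$ (concatenation) and $X_I^k={}^{k}X_{I,1}^{k}+{}^{k}X_{I,2}^{\sigma^k(k)}$. The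 vectors $\boldsymbol{X}_\varnothing^{(k:n)}$ are the vectors $\boldsymbol{X}_\varnothing^k$ of the batch returned at the root. *)

theory Defs
  imports "HOL-Probability.Probability"
begin

definition copula_measure :: "(real \<times> real \<Rightarrow> real) \<Rightarrow> (real \<times> real) measure" where
  "copula_measure c = density lborel (\<lambda>u. ennreal (c u))"

definition is_copula_density :: "(real \<times> real \<Rightarrow> real) \<Rightarrow> bool" where
  "is_copula_density c \<longleftrightarrow>
     c \<in> borel_measurable borel \<and> (\<forall>u. 0 \<le> c u) \<and>
     prob_space (copula_measure c) \<and>
     distr (copula_measure c) borel fst = uniform_measure lborel {0..1::real} \<and>
     distr (copula_measure c) borel snd = uniform_measure lborel {0..1::real}"

definition copula_cdf :: "(real \<times> real \<Rightarrow> real) \<Rightarrow> real \<Rightarrow> real \<Rightarrow> real" where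
  "copula_cdf c u1 u2 = measure (copula_measure c) ({..u1} \<times> {..u2})"

definition pmf_cdf :: "real pmf \<Rightarrow> real \<Rightarrow> real" where
  "pmf_cdf p x = measure_pmf.prob p {..x}"

definition Bset :: "(real \<Rightarrow> real) \<Rightarrow> (real \<Rightarrow> real) \<Rightarrow> real \<Rightarrow> (real \<times> real) set" where
  "Bset Fa Fb t = {(Fa x1, Fb x2) | x1 x2. x1 + x2 = t}"

definition Unbhd :: "real \<Rightarrow> (real \<times> real) set \<Rightarrow> (real \<times> real) set" where
  "Unbhd \<delta> B = {u \<in> {0..1} \<times> {0..1}. \<exists>b\<in>B. dist u b < \<delta>}"

definition density_condition ::
  "(real \<times> real \<Rightarrow> real) \<Rightarrow> (real \<Rightarrow> real) \<Rightarrow> (real \<Rightarrow> real) \<Rightarrow> bool" where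
  "density_condition c Fa Fb \<longleftrightarrow>
     ((\<lambda>\<delta>. \<Squnion>t::real. \<integral>\<^sup>+ u. indicator (Unbhd \<delta> (Bset Fa Fb t)) u * ennreal (c u) \<partial>lborel)
        \<longlongrightarrow> 0) (at_right 0)"

definition cond_indep ::
  "'a measure \<Rightarrow> ('a \<Rightarrow> 'b::topological_space) \<Rightarrow> ('a \<Rightarrow> 'c::topological_space)
     \<Rightarrow> ('a \<Rightarrow> 'd::topological_space) \<Rightarrow> bool" where
  "cond_indep M X Y Z \<longleftrightarrow>
     (let F = vimage_algebra (space M) Z borel in
      \<forall>A \<in> sets borel. \<forall>B \<in> sets borel.
        AE \<omega> in M. real_cond_exp M F (\<lambda>\<omega>. indicator A (X \<omega>) * indicator B (Y \<omega>)) \<omega>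
               = real_cond_exp M F (\<lambda>\<omega>. indicator A (X \<omega>)) \<omega>
                 * real_cond_exp M F (\<lambda>\<omega>. indicator B (Y \<omega>)) \<omega>)"

definition tree_dependent ::
  "((real \<times> real) \<times> real) measure \<Rightarrow> real pmf \<Rightarrow> real pmf \<Rightarrow> real pmf
     \<Rightarrow> (real \<times> real \<Rightarrow> real) \<Rightarrow> (real \<times> real \<Rightarrow> real) \<Rightarrow> bool" where
  "tree_dependent \<mu> p11 p12 p2 c1 c0 \<longleftrightarrow>
     prob_space \<mu> \<and> sets \<mu> = sets borel \<and>
     (\<forall>x. measure \<mu> {\<omega> \<in> space \<mu>. fst (fst \<omega>) \<le> x} = pmf_cdf p11 x) \<and>
     (\<forall>x. measure \<mu> {\<omega> \<in> space \<mu>. snd (fst \<omega>) \<le> x} = pmf_cdf p12 x) \<and>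
     (\<forall>x. measure \<mu> {\<omega> \<in> space \<mu>. snd \<omega> \<le> x} = pmf_cdf p2 x) \<and>
     (\<forall>x1 x2. measure \<mu> {\<omega> \<in> space \<mu>. fst (fst \<omega>) \<le> x1 \<and> snd (fst \<omega>) \<le> x2}
                = copula_cdf c1 (pmf_cdf p11 x1) (pmf_cdf p12 x2)) \<and>
     (\<forall>y1 y2. measure \<mu> {\<omega> \<in> space \<mu>. fst (fst \<omega>) + snd (fst \<omega>) \<le> y1 \<and> snd \<omega> \<le> y2}
                = copula_cdf c0
                    (measure \<mu> {\<omega> \<in> space \<mu>. fst (fst \<omega>) + snd (fst \<omega>) \<le> y1})
                    (pmf_cdf p2 y2)) \<and>
     cond_indep \<mu> (\<lambda>\<omega>. (fst (fst \<omega>), snd (fst \<omega>), fst (fst \<omega>) + snd (fst \<omega>)))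
                 (\<lambda>\<omega>. (snd \<omega>, fst (fst \<omega>) + snd (fst \<omega>) + snd \<omega>))
                 (\<lambda>\<omega>. fst (fst \<omega>) + snd (fst \<omega>))"

text \<open>Rank (0-based) of entry k among w 0, ..., w (n-1). Ties are broken by the
  auxiliary values v (and, if still tied, by index); in the algorithm v consists of
  independent uniform variables, so ties are broken uniformly at random.\<close>
definition rank :: "nat \<Rightarrow> (nat \<Rightarrow> real) \<Rightarrow> (nat \<Rightarrow> real) \<Rightarrow> nat \<Rightarrow> nat" where
  "rank n w v k = card {j. j < n \<and>
      (w j < w k \<or> (w j = w k \<and> (v j < v k \<or> (v j = v k \<and> j < k))))}"

definition perm_inv :: "nat \<Rightarrow> (nat \<Rightarrow> nat) \<Rightarrow> nat \<Rightarrow> nat" where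
  "perm_inv n f r = (THE j. j < n \<and> f j = r)"

definition mra_sigma :: "nat \<Rightarrow> (nat \<Rightarrow> nat) \<Rightarrow> (nat \<Rightarrow> nat) \<Rightarrow> (nat \<Rightarrow> nat)
    \<Rightarrow> (nat \<Rightarrow> nat) \<Rightarrow> nat \<Rightarrow> nat" where
  "mra_sigma n q1 p1 p2 q2 k = perm_inv n q2 (p2 (perm_inv n p1 (q1 k)))"

text \<open>The k-th output item computed from one sub-experiment: child batches a and b,
  copula samples u, tie-breaking variables v1, v2 for the two child batches.
  s1, s2 map a leaf vector of a child to its sum.\<close>
definition mra_item :: "nat \<Rightarrow> ('a \<Rightarrow> real) \<Rightarrow> ('b \<Rightarrow> real) \<Rightarrow> nat
    \<Rightarrow> (nat \<Rightarrow> 'a) \<times> (nat \<Rightarrow> 'b) \<times> (nat \<Rightarrow> real \<times> real) \<times> (nat \<Rightarrow> real) \<times> (nat \<Rightarrow> real)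
    \<Rightarrow> 'a \<times> 'b" where
  "mra_item n s1 s2 k = (\<lambda>(a, b, u, v1, v2).
     (let q1 = rank n (\<lambda>j. s1 (a j)) v1;
          q2 = rank n (\<lambda>j. s2 (b j)) v2;
          p1 = rank n (\<lambda>j. fst (u j)) (\<lambda>_. 0);
          p2 = rank n (\<lambda>j. snd (u j)) (\<lambda>_. 0)
      in (a k, b (mra_sigma n q1 p1 p2 q2 k))))"

definition unif01 :: "real measure" where
  "unif01 = uniform_measure lborel {0..1}"

text \<open>Law of the batch returned by a call at a branching node whose children return
  batches with laws A and B (calls at the children are independent), with copula density c.
  For each k < n an independent sub-experiment is run and its k-th item is kept.\<close>
definition mra_node :: "nat \<Rightarrow> ('a::topological_space \<Rightarrow> real) \<Rightarrow> ('b::topological_space \<Rightarrow> real)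
    \<Rightarrow> (nat \<Rightarrow> 'a) measure \<Rightarrow> (nat \<Rightarrow> 'b) measure \<Rightarrow> (real \<times> real \<Rightarrow> real)
    \<Rightarrow> (nat \<Rightarrow> 'a \<times> 'b) measure" where
  "mra_node n s1 s2 A B c =
     (\<Pi>\<^sub>M k \<in> {..<n}.
        distr (A \<Otimes>\<^sub>M B \<Otimes>\<^sub>M (\<Pi>\<^sub>M j \<in> {..<n}. copula_measure c)
                 \<Otimes>\<^sub>M (\<Pi>\<^sub>M j \<in> {..<n}. unif01) \<Otimes>\<^sub>M (\<Pi>\<^sub>M j \<in> {..<n}. unif01))
              borel (mra_item n s1 s2 k))"

definition mra_leaf :: "nat \<Rightarrow> real pmf \<Rightarrow> (nat \<Rightarrow> real) measure" where
  "mra_leaf n p = (\<Pi>\<^sub>M k \<in> {..<n}. distr (measure_pmf p) borel (\<lambda>x. x))"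

definition mra_root :: "nat \<Rightarrow> real pmf \<Rightarrow> real pmf \<Rightarrow> real pmf
    \<Rightarrow> (real \<times> real \<Rightarrow> real) \<Rightarrow> (real \<times> real \<Rightarrow> real) \<Rightarrow> (nat \<Rightarrow> (real \<times> real) \<times> real) measure" where
  "mra_root n p11 p12 p2 c1 c0 =
     mra_node n (\<lambda>(x11, x12). x11 + x12) (\<lambda>x. x)
       (mra_node n (\<lambda>x. x) (\<lambda>x. x) (mra_leaf n p11) (mra_leaf n p12) c1)
       (mra_leaf n p2) c0"

definition le3 :: "(real \<times> real) \<times> real \<Rightarrow> (real \<times> real) \<times> real \<Rightarrow> bool" where
  "le3 y x \<longleftrightarrow> fst (fst y) \<le> fst (fst x) \<and> snd (fst y) \<le> snd (fst x) \<and> snd y \<le> snd x"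

definition cdf3 :: "((real \<times> real) \<times> real) measure \<Rightarrow> (real \<times> real) \<times> real \<Rightarrow> real" where
  "cdf3 M x = measure M {y \<in> space M. le3 y x}"

definition emp_cdf3 :: "nat \<Rightarrow> (nat \<Rightarrow> (real \<times> real) \<times> real) \<Rightarrow> (real \<times> real) \<times> real \<Rightarrow> real" where
  "emp_cdf3 n xs x = real (card {k. k < n \<and> le3 (xs k) x}) / real n"

definition conv_in_distr :: "(nat \<Rightarrow> 'a::topological_space measure) \<Rightarrow> 'a measure \<Rightarrow> bool" where
  "conv_in_distr Ms M \<longleftrightarrow>
     (\<forall>f :: 'a \<Rightarrow> real. continuous_on UNIV f \<and> bounded (range f) \<longrightarrow>
        (\<lambda>n. \<integral>x. f x \<partial>Ms n) \<longlonglongrightarrow> (\<integral>x. f x \<partial>M))"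

end

theory Submission
  imports Defs "HOL-Real_Asymp.Real_Asymp"
begin

text \<open>
  Since the leaves are discrete, all laws involved are purely atomic, and everything reduces to
  the convergence of the masses of single points.  At a branching node, an item lies in a
  lower-left rectangle iff its two ranks are small; reordering turns the number of such items
  into the number of copula samples with small ranks, which differs from the number of samples in
  a fixed quadrant by at most the deviations of four empirical frequencies from their means.  By
  Hoeffding's inequality the rectangle probabilities converge to the values of the copula, hence
  so do the point masses at the first node and those of the pair (sum at the first node, second
  leaf) at the root.  The permutation depends on a first child's vectors only through their sums, so
  resampling one of them with the same sum leaves the second component unchanged: this gives the
  conditional independence at the root, which determines the masses of triples from those of
  pairs.  Random tie breaking makes all items of a batch identically distributed.  Convergence of
  point masses is convergence in total variation, and Hoeffding's inequality with Borel-Cantelli,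
  applied to single atoms, yields the almost sure uniform convergence.
\<close>

section \<open>Ranks and the reordering permutation\<close>

text \<open>Three features shape the argument. A node keeps only the \<open>k\<close>-th item of its
  \<open>k\<close>-th sub-experiment, yet the counting identity concerns the whole permutation of
  one sub-experiment; since all items of a sub-experiment have the same law, that law is recovered
  as an expected relative frequency. The law of an item at node (1) varies with \<open>n\<close>, so
  the root needs an estimate that is uniform in the child laws: the rectangle error is bounded in
  terms of \<open>n\<close> alone, and the Lipschitz property of the copula absorbs the drift of its
  arguments. The quantity passed upwards is a sum, whose half-lines pull back to half-planes instead
  of rectangles; point masses, obtained from closed and open half-lines by inclusion-exclusion,
  control all Borel sets at once, boundary atoms included. Conditional independence is used in
  division-free form, as a product identity for masses on a level set of the conditioning sum. The
  same identity then serves the exact law of the algorithm and the limit, also on levels whose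
  limiting mass is zero.\<close>

definition key_less :: "(nat \<Rightarrow> real) \<Rightarrow> (nat \<Rightarrow> real) \<Rightarrow> nat \<Rightarrow> nat \<Rightarrow> bool" where
  "key_less w v j k \<longleftrightarrow> w j < w k \<or> (w j = w k \<and> (v j < v k \<or> (v j = v k \<and> j < k)))"

lemma rank_key_less: "rank n w v k = card {j. j < n \<and> key_less w v j k}"
  by (simp add: rank_def key_less_def)

lemma key_less_irrefl: "\<not> key_less w v k k"
  by (auto simp: key_less_def)

lemma key_less_trans: "key_less w v i j \<Longrightarrow> key_less w v j k \<Longrightarrow> key_less w v i k"
  unfolding key_less_def by auto

lemma key_less_total: "j \<noteq> k \<Longrightarrow> key_less w v j k \<or> key_less w v k j"
  unfolding key_less_def by linarith

lemma rank_mono: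
  assumes "key_less w v j k" "j < n"
  shows "rank n w v j < rank n w v k"
  unfolding rank_key_less
proof (rule psubset_card_mono)
  show "{i. i < n \<and> key_less w v i j} \<subset> {i. i < n \<and> key_less w v i k}"
    using assms key_less_trans[of w v _ j k] key_less_irrefl[of w v j] by auto
qed simp

lemma rank_less: "k < n \<Longrightarrow> rank n w v k < n"
  unfolding rank_key_less
  using psubset_card_mono[of "{..<n}" "{j. j < n \<and> key_less w v j k}"] key_less_irrefl[of w v k]
  by auto

text \<open>The index as last key makes any two entries comparable, so ranks are distinct even under
  complete ties, and an injection of a finite set into itself is onto.\<close>

lemma rank_bij: "bij_betw (rank n w v) {..<n} {..<n}"
proof -
  have "inj_on (rank n w v) {..<n}"
  proof (rule inj_onI, rule ccontr)
    fix j k assume "j \<in> {..<n}" "k \<in> {..<n}" "rank n w v j = rank n w v k" "j \<noteq> k"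
    then show False
      using key_less_total[of j k w v] rank_mono[of w v j k n] rank_mono[of w v k j n] by auto
  qed
  moreover have "rank n w v ` {..<n} \<subseteq> {..<n}"
    using rank_less by auto
  ultimately show ?thesis
    by (simp add: bij_betw_def endo_inj_surj)
qed

text \<open>One notion covers \<open>{..x}\<close> and \<open>{..<x}\<close>; both occur, since a
  point mass is a difference of rectangles with closed and open sides.\<close>

definition down_closed :: "real set \<Rightarrow> bool" where
  "down_closed D \<longleftrightarrow> (\<forall>x\<in>D. \<forall>y\<le>x. y \<in> D)"

lemma down_closed_atMost [simp]: "down_closed {..x}"
  and down_closed_lessThan [simp]: "down_closed {..<x}"
  by (auto simp: down_closed_def)

text \<open>In the key order the entries with value in \<open>D\<close> form an initial segment,
  because the value is the leading key. An index belongs to an initial segment iff its rank is below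
  the length of the segment. This turns conditions on values into conditions on ranks.\<close>

lemma rank_less_card_iff:
  assumes D: "down_closed D" and k: "k < n"
  shows "rank n w v k < card {i. i < n \<and> w i \<in> D} \<longleftrightarrow> w k \<in> D"
proof (cases "w k \<in> D")
  case True
  have "w j \<in> D" if "key_less w v j k" for j
  proof -
    have "w j \<le> w k" using that unfolding key_less_def by linarith
    then show ?thesis using True D unfolding down_closed_def by blast
  qed
  then have "{j. j < n \<and> key_less w v j k} \<subseteq> {i. i < n \<and> w i \<in> D}" by auto
  moreover have "k \<in> {i. i < n \<and> w i \<in> D}" "k \<notin> {j. j < n \<and> key_less w v j k}"
    using True k key_less_irrefl[of w v k] by auto
  ultimately have "{j. j < n \<and> key_less w v j k} \<subset> {i. i < n \<and> w i \<in> D}" by blast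
  then have "rank n w v k < card {i. i < n \<and> w i \<in> D}"
    unfolding rank_key_less by (intro psubset_card_mono) simp_all
  then show ?thesis using True by simp
next
  case False
  have "key_less w v i k" if "w i \<in> D" for i
  proof -
    have "\<not> w k \<le> w i" using that False D unfolding down_closed_def by blast
    then show ?thesis unfolding key_less_def by simp
  qed
  then have "{i. i < n \<and> w i \<in> D} \<subseteq> {j. j < n \<and> key_less w v j k}" by auto
  then have "card {i. i < n \<and> w i \<in> D} \<le> rank n w v k"
    unfolding rank_key_less by (intro card_mono) simp_all
  then show ?thesis using False by simp
qed

lemma perm_inv_eq:
  assumes "bij_betw f {..<n} {..<n}" "j < n"
  shows "perm_inv n f (f j) = j"
  unfolding perm_inv_def
  using assms by (intro the_equality) (auto simp: bij_betw_def inj_on_def)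

lemma perm_inv:
  assumes "bij_betw f {..<n} {..<n}" "r < n"
  shows "perm_inv n f r < n" "f (perm_inv n f r) = r"
proof -
  have "r \<in> f ` {..<n}"
    using assms by (simp add: bij_betw_def)
  then obtain j where "j < n" "f j = r" by auto
  then have "perm_inv n f r = j" using perm_inv_eq[OF assms(1), of j] by simp
  then show "perm_inv n f r < n" "f (perm_inv n f r) = r"
    using \<open>j < n\<close> \<open>f j = r\<close> by simp_all
qed

lemma bij_betw_less: "bij_betw f {..<n} {..<n::nat} \<Longrightarrow> j < n \<Longrightarrow> f j < n"
  by (auto simp: bij_betw_def)

lemma mra_sigma_less:
  assumes "bij_betw q1 {..<n} {..<n}" "bij_betw p1 {..<n} {..<n}"
    "bij_betw p2 {..<n} {..<n}" "bij_betw q2 {..<n} {..<n}" "k < n"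
  shows "mra_sigma n q1 p1 p2 q2 k < n"
  unfolding mra_sigma_def
  using perm_inv(1)[OF assms(4) bij_betw_less[OF assms(3) perm_inv(1)[OF assms(2)
    bij_betw_less[OF assms(1,5)]]]] .

text \<open>Substitute j = p1^{-1}(q1 k). Then p1 j = q1 k and, by the form of the permutation, p2 j
  = q2 (sigma k): the rank pairs of the reordered items are exactly the rank pairs of the copula
  samples.\<close>

lemma card_mra_sigma:
  assumes q1: "bij_betw q1 {..<n} {..<n}" and p1: "bij_betw p1 {..<n} {..<n}"
    and p2: "bij_betw p2 {..<n} {..<n}" and q2: "bij_betw q2 {..<n} {..<n}"
  shows "card {k. k < n \<and> q1 k < m1 \<and> q2 (mra_sigma n q1 p1 p2 q2 k) < m2}
       = card {j. j < n \<and> p1 j < m1 \<and> p2 j < m2}"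
proof (rule bij_betw_same_card)
  have *: "perm_inv n p1 (q1 k) < n" "p1 (perm_inv n p1 (q1 k)) = q1 k"
    "q2 (mra_sigma n q1 p1 p2 q2 k) = p2 (perm_inv n p1 (q1 k))"
    "perm_inv n q1 (q1 k) = k" if "k < n" for k
    using that by (simp_all add: mra_sigma_def perm_inv perm_inv_eq q1 p1 p2 q2 bij_betw_less)
  have **: "perm_inv n q1 (p1 j) < n" "q1 (perm_inv n q1 (p1 j)) = p1 j"
    "perm_inv n p1 (p1 j) = j" if "j < n" for j
    using that by (simp_all add: perm_inv perm_inv_eq q1 p1 bij_betw_less)
  show "bij_betw (\<lambda>k. perm_inv n p1 (q1 k))
     {k. k < n \<and> q1 k < m1 \<and> q2 (mra_sigma n q1 p1 p2 q2 k) < m2}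
     {j. j < n \<and> p1 j < m1 \<and> p2 j < m2}"
    by (rule bij_betw_byWitness[where f' = "\<lambda>j. perm_inv n q1 (p1 j)"]) (auto simp: * **)
qed

lemma sum_abs_of_bool_less:
  fixes m m' n :: nat
  shows "(\<Sum>r<n. \<bar>of_bool (r < m) - of_bool (r < m')\<bar>) \<le> \<bar>real m - real m'\<bar>"
proof (induction m m' rule: linorder_wlog)
  case (le a b)
  have "(\<Sum>r<n. \<bar>of_bool (r < a) - of_bool (r < b)\<bar> :: real) = (\<Sum>r<n. of_bool (r \<in> {a..<b}))"
    using le by (intro sum.cong) auto
  also have "\<dots> = real (card ({..<n} \<inter> {a..<b}))"
    by (subst sum_of_bool_eq) (auto simp: Int_def)
  also have "\<dots> \<le> real (card {a..<b})"
    by (intro of_nat_mono card_mono) auto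
  finally show ?case using le by (simp add: of_nat_diff)
next
  case (sym a b)
  then show ?case by (simp add: abs_minus_commute)
qed

lemma card_eq_sum_of_bool: "real (card {j. j < n \<and> P j}) = (\<Sum>j<(n::nat). of_bool (P j))"
  by (subst sum_of_bool_eq) (auto simp: lessThan_def Int_def)

text \<open>Every rank is attained once, so moving a threshold from m to m' changes membership for
  at most |m - m'| indices.\<close>

lemma card_rank_rectangle_diff:
  assumes p1: "bij_betw p1 {..<n} {..<n}" and p2: "bij_betw p2 {..<n} {..<n}"
  shows "\<bar>real (card {j. j < n \<and> p1 j < m1 \<and> p2 j < m2})
          - real (card {j. j < n \<and> p1 j < m1' \<and> p2 j < m2'})\<bar>
       \<le> \<bar>real m1 - real m1'\<bar> + \<bar>real m2 - real m2'\<bar>"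
proof -
  have S: "(\<Sum>j<n. \<bar>of_bool (p j < m) - of_bool (p j < m')\<bar>) \<le> \<bar>real m - real m'\<bar>"
    if "bij_betw p {..<n} {..<n}" for p m m'
    using sum.reindex_bij_betw[OF that, of "\<lambda>r. \<bar>of_bool (r < m) - of_bool (r < m')\<bar> :: real"]
      sum_abs_of_bool_less[of m m' n] by simp
  have "\<bar>(\<Sum>j<n. of_bool (p1 j < m1 \<and> p2 j < m2)) - (\<Sum>j<n. of_bool (p1 j < m1' \<and> p2 j < m2') :: real)\<bar>
      \<le> (\<Sum>j<n. \<bar>of_bool (p1 j < m1 \<and> p2 j < m2) - of_bool (p1 j < m1' \<and> p2 j < m2')\<bar>)"
    unfolding sum_subtractf[symmetric] by (rule sum_abs)
  also have "\<dots> \<le> (\<Sum>j<n. \<bar>of_bool (p1 j < m1) - of_bool (p1 j < m1')\<bar>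
                        + \<bar>of_bool (p2 j < m2) - of_bool (p2 j < m2')\<bar>)"
  proof (intro sum_mono)
    fix j
    show "\<bar>of_bool (p1 j < m1 \<and> p2 j < m2) - of_bool (p1 j < m1' \<and> p2 j < m2')\<bar>
        \<le> (\<bar>of_bool (p1 j < m1) - of_bool (p1 j < m1')\<bar>
          + \<bar>of_bool (p2 j < m2) - of_bool (p2 j < m2')\<bar> :: real)"
      by (cases "p1 j < m1"; cases "p2 j < m2"; cases "p1 j < m1'"; cases "p2 j < m2'") simp_all
  qed
  also have "\<dots> \<le> \<bar>real m1 - real m1'\<bar> + \<bar>real m2 - real m2'\<bar>"
    unfolding sum.distrib by (intro add_mono S p1 p2)
  finally show ?thesis
    unfolding card_eq_sum_of_bool .
qed

text \<open>The deterministic core. By \<open>card_mra_sigma\<close> the items in D1 x D2 are as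
  many as the samples whose ranks lie below the counts of D1 and D2; the samples in T1 x T2 are
  those whose ranks lie below the counts of T1 and T2. The two numbers differ only through these
  thresholds.\<close>

lemma mra_rectangle_count:
  fixes n :: nat and w1 w2 u1 u2 v1 v2 z1 z2 :: "nat \<Rightarrow> real"
  assumes D: "down_closed D1" "down_closed D2" "down_closed T1" "down_closed T2"
  defines "q1 \<equiv> rank n w1 v1" and "q2 \<equiv> rank n w2 v2"
    and "p1 \<equiv> rank n u1 z1" and "p2 \<equiv> rank n u2 z2"
  shows "\<bar>real (card {k. k < n \<and> w1 k \<in> D1 \<and> w2 (mra_sigma n q1 p1 p2 q2 k) \<in> D2})
         - real (card {j. j < n \<and> u1 j \<in> T1 \<and> u2 j \<in> T2})\<bar>
       \<le> \<bar>real (card {i. i < n \<and> w1 i \<in> D1}) - real (card {i. i < n \<and> u1 i \<in> T1})\<bar>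
        + \<bar>real (card {i. i < n \<and> w2 i \<in> D2}) - real (card {i. i < n \<and> u2 i \<in> T2})\<bar>"
proof -
  have bij: "bij_betw q1 {..<n} {..<n}" "bij_betw q2 {..<n} {..<n}"
    "bij_betw p1 {..<n} {..<n}" "bij_betw p2 {..<n} {..<n}"
    unfolding q1_def q2_def p1_def p2_def by (intro rank_bij)+
  have 1: "{k. k < n \<and> w1 k \<in> D1 \<and> w2 (mra_sigma n q1 p1 p2 q2 k) \<in> D2}
      = {k. k < n \<and> q1 k < card {i. i < n \<and> w1 i \<in> D1}
           \<and> q2 (mra_sigma n q1 p1 p2 q2 k) < card {i. i < n \<and> w2 i \<in> D2}}"
    using rank_less_card_iff[OF D(1)] rank_less_card_iff[OF D(2)] mra_sigma_less[OF bij(1,3,4,2)]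
    unfolding q1_def q2_def by auto
  have 2: "{j. j < n \<and> u1 j \<in> T1 \<and> u2 j \<in> T2}
      = {j. j < n \<and> p1 j < card {i. i < n \<and> u1 i \<in> T1} \<and> p2 j < card {i. i < n \<and> u2 i \<in> T2}}"
    using rank_less_card_iff[OF D(3)] rank_less_card_iff[OF D(4)]
    unfolding p1_def p2_def by auto
  show ?thesis
    unfolding 1 2 card_mra_sigma[OF bij(1,3,4,2)] by (rule card_rank_rectangle_diff[OF bij(3,4)])
qed

text \<open>The index order is not preserved by \<open>\<tau>\<close>, so the index must never
  decide a comparison; injectivity of the tie breakers \<open>v\<close> guarantees this.\<close>

lemma rank_reindex:
  assumes \<tau>: "bij_betw \<tau> {..<n} {..<n}" and k: "k < n" and v: "inj_on v {..<n}"
    and w': "\<And>j. j < n \<Longrightarrow> w' j = w (\<tau> j)" and v': "\<And>j. j < n \<Longrightarrow> v' j = v (\<tau> j)"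
  shows "rank n w' v' k = rank n w v (\<tau> k)"
proof -
  have inj: "v (\<tau> j) = v (\<tau> k) \<longleftrightarrow> j = k" "v (\<tau> j) = v (\<tau> k) \<longleftrightarrow> \<tau> j = \<tau> k"
    if "j < n" for j
    using inj_on_eq_iff[OF v, of "\<tau> j" "\<tau> k"] inj_on_eq_iff[of \<tau> "{..<n}" j k] that k
      bij_betw_less[OF \<tau>] bij_betw_imp_inj_on[OF \<tau>] by simp_all
  have "bij_betw \<tau> {j. j < n \<and> key_less w' v' j k} {j. j < n \<and> key_less w v j (\<tau> k)}"
    unfolding bij_betw_def
  proof
    show "inj_on \<tau> {j. j < n \<and> key_less w' v' j k}"
      using \<tau> by (auto simp: bij_betw_def inj_on_def)
    have "{j. j < n \<and> key_less w v j (\<tau> k)} = \<tau> ` {j. j < n \<and> key_less w v (\<tau> j) (\<tau> k)}"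
    proof (intro equalityI subsetI)
      fix i assume "i \<in> {j. j < n \<and> key_less w v j (\<tau> k)}"
      moreover from this have "i \<in> \<tau> ` {..<n}"
        using \<tau> by (simp add: bij_betw_def)
      ultimately show "i \<in> \<tau> ` {j. j < n \<and> key_less w v (\<tau> j) (\<tau> k)}" by auto
    qed (use bij_betw_less[OF \<tau>] in auto)
    also have "{j. j < n \<and> key_less w v (\<tau> j) (\<tau> k)} = {j. j < n \<and> key_less w' v' j k}"
      using inj k by (auto simp: key_less_def w' v')
    finally show "\<tau> ` {j. j < n \<and> key_less w' v' j k} = {j. j < n \<and> key_less w v j (\<tau> k)}" ..
  qed
  then show ?thesis
    unfolding rank_key_less by (rule bij_betw_same_card)
qed

section \<open>Conditional independence given a discrete variable\<close>

text \<open>The preimage of a point under \<open>f\<close> has the form Z^{-1}(A), hence is a union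
  of level sets of Z.\<close>

lemma measurable_vimage_algebra_level:
  fixes f :: "'a \<Rightarrow> real"
  assumes f: "f \<in> borel_measurable (vimage_algebra \<Omega> Z borel)"
    and x: "x \<in> \<Omega>" "y \<in> \<Omega>" "Z x = Z y"
  shows "f x = f y"
proof -
  have "f -` {f x} \<inter> \<Omega> \<in> sets (vimage_algebra \<Omega> Z borel)"
    using measurable_sets[OF f, of "{f x}"] by simp
  then obtain A where "f -` {f x} \<inter> \<Omega> = Z -` A \<inter> \<Omega>"
    using sets_vimage_algebra2[of Z \<Omega> borel] by auto
  moreover from this have "x \<in> Z -` A \<inter> \<Omega>"
    using x by blast
  ultimately have "y \<in> f -` {f x} \<inter> \<Omega>"
    using x by simp
  then show ?thesis by simp
qed

text \<open>The level set {Z = Z x} belongs to the conditioning sigma-algebra, points being closed,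
  and the conditional expectation is constant on it. The claim holds at every x rather than almost
  every x because the value is multiplied by the mass of the level, which may vanish.\<close>

lemma real_cond_exp_atom:
  fixes Z :: "'a \<Rightarrow> 'd::t1_space" and f :: "'a \<Rightarrow> real"
  assumes M: "prob_space M" and Z[measurable]: "Z \<in> borel_measurable M"
    and f: "integrable M f" and x: "x \<in> space M"
  defines "F \<equiv> vimage_algebra (space M) Z borel"
  shows "(\<integral>y. indicator {y \<in> space M. Z y = Z x} y * f y \<partial>M)
       = real_cond_exp M F f x * measure M {y \<in> space M. Z y = Z x}"
proof -
  interpret prob_space M by fact
  have sub: "subalgebra M F"
    unfolding subalgebra_def F_def using sets_image_in_sets[OF _ Z] by simp
  interpret F: finite_measure_subalgebra M F
    by unfold_locales (rule sub)
  let ?C = "{y \<in> space M. Z y = Z x}"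
  have "Z -` {Z x} \<inter> space M \<in> sets F"
    unfolding F_def by (intro in_vimage_algebra) auto
  also have "Z -` {Z x} \<inter> space M = ?C" by auto
  finally have C: "?C \<in> sets F" .
  then have CM[measurable]: "?C \<in> sets M" using sub by (auto simp: subalgebra_def)
  have "(\<integral>y. indicator ?C y * f y \<partial>M) = (\<integral>y. indicator ?C y * real_cond_exp M F f y \<partial>M)"
    using F.real_cond_exp_intA[OF f C] by (simp add: set_lebesgue_integral_def)
  also have "\<dots> = (\<integral>y. real_cond_exp M F f x * indicator ?C y \<partial>M)"
  proof (intro Bochner_Integration.integral_cong refl)
    fix y assume "y \<in> space M"
    then show "indicator ?C y * real_cond_exp M F f y = real_cond_exp M F f x * indicator ?C y"
      using measurable_vimage_algebra_level[of "real_cond_exp M F f" "space M" Z y x] x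
        borel_measurable_cond_exp
      by (auto simp: F_def indicator_def)
  qed
  also have "\<dots> = real_cond_exp M F f x * measure M ?C"
    using CM by simp
  finally show ?thesis .
qed

lemma integral_atom_indicator:
  fixes Z :: "'a \<Rightarrow> 'd"
  shows "(\<integral>y. indicator {y \<in> space M. Z y = z} y * (indicator A (X y) * indicator B (Y y) :: real) \<partial>M)
    = measure M {y \<in> space M. X y \<in> A \<and> Y y \<in> B \<and> Z y = z}"
proof -
  have "(\<integral>y. indicator {y \<in> space M. Z y = z} y * (indicator A (X y) * indicator B (Y y) :: real) \<partial>M)
     = (\<integral>y. indicator {y \<in> space M. X y \<in> A \<and> Y y \<in> B \<and> Z y = z} y \<partial>M)"
    by (intro Bochner_Integration.integral_cong refl) (auto simp: indicator_def)
  also have "\<dots> = measure M ({y \<in> space M. X y \<in> A \<and> Y y \<in> B \<and> Z y = z} \<inter> space M)"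
    by simp
  also have "{y \<in> space M. X y \<in> A \<and> Y y \<in> B \<and> Z y = z} \<inter> space M
      = {y \<in> space M. X y \<in> A \<and> Y y \<in> B \<and> Z y = z}" by auto
  finally show ?thesis .
qed

lemma cond_indep_atom_aux:
  fixes X :: "'a \<Rightarrow> 'b::topological_space" and Y :: "'a \<Rightarrow> 'c::topological_space"
    and Z :: "'a \<Rightarrow> 'd::t1_space"
  assumes M: "prob_space M"
    and [measurable]: "X \<in> borel_measurable M" "Y \<in> borel_measurable M" "Z \<in> borel_measurable M"
    and AB[measurable]: "A \<in> sets borel" "B \<in> sets borel" and x: "x \<in> space M"
  defines "F \<equiv> vimage_algebra (space M) Z borel"
    and "p \<equiv> measure M {y \<in> space M. Z y = Z x}"
  shows "real_cond_exp M F (\<lambda>\<omega>. indicator A (X \<omega>) * indicator B (Y \<omega>)) x * p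
       = measure M {y \<in> space M. X y \<in> A \<and> Y y \<in> B \<and> Z y = Z x}"
    and "real_cond_exp M F (\<lambda>\<omega>. indicator A (X \<omega>)) x * p
       = measure M {y \<in> space M. X y \<in> A \<and> Z y = Z x}"
    and "real_cond_exp M F (\<lambda>\<omega>. indicator B (Y \<omega>)) x * p
       = measure M {y \<in> space M. Y y \<in> B \<and> Z y = Z x}"
proof -
  interpret prob_space M by fact
  have i: "integrable M (\<lambda>\<omega>. indicator A (X \<omega>) * indicator B (Y \<omega>) :: real)"
    if [measurable]: "A \<in> sets borel" "B \<in> sets borel" for A B
    by (rule integrable_const_bound[where B=1]) (auto simp: indicator_def)
  have e: "real_cond_exp M F (\<lambda>\<omega>. indicator A (X \<omega>) * indicator B (Y \<omega>)) x * p
       = measure M {y \<in> space M. X y \<in> A \<and> Y y \<in> B \<and> Z y = Z x}"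
    if [measurable]: "A \<in> sets borel" "B \<in> sets borel" for A B
    unfolding F_def p_def
    using real_cond_exp_atom[OF M _ i[OF that] x, of Z] integral_atom_indicator[of M Z "Z x" A X B Y]
    by simp
  show "real_cond_exp M F (\<lambda>\<omega>. indicator A (X \<omega>) * indicator B (Y \<omega>)) x * p
       = measure M {y \<in> space M. X y \<in> A \<and> Y y \<in> B \<and> Z y = Z x}"
    by (rule e) fact+
  show "real_cond_exp M F (\<lambda>\<omega>. indicator A (X \<omega>)) x * p
       = measure M {y \<in> space M. X y \<in> A \<and> Z y = Z x}"
    using e[of A UNIV] by simp
  show "real_cond_exp M F (\<lambda>\<omega>. indicator B (Y \<omega>)) x * p
       = measure M {y \<in> space M. Y y \<in> B \<and> Z y = Z x}"
    using e[of UNIV B] by simp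
qed

text \<open>On a level of positive mass the almost sure identity holds at some point of the level,
  where the three conditional expectations times the mass are the masses in the claim. On a null
  level both sides vanish.\<close>

lemma cond_indep_atom:
  fixes X :: "'a \<Rightarrow> 'b::topological_space" and Y :: "'a \<Rightarrow> 'c::topological_space"
    and Z :: "'a \<Rightarrow> 'd::t1_space"
  assumes M: "prob_space M"
    and XYZ[measurable]: "X \<in> borel_measurable M" "Y \<in> borel_measurable M" "Z \<in> borel_measurable M"
    and AB[measurable]: "A \<in> sets borel" "B \<in> sets borel"
    and ci: "cond_indep M X Y Z"
  shows "measure M {y \<in> space M. X y \<in> A \<and> Y y \<in> B \<and> Z y = z} * measure M {y \<in> space M. Z y = z}
       = measure M {y \<in> space M. X y \<in> A \<and> Z y = z} * measure M {y \<in> space M. Y y \<in> B \<and> Z y = z}"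
    (is "?l * ?p = ?r1 * ?r2")
proof (cases "?p = 0")
  case True
  interpret prob_space M by fact
  have "?r1 \<le> ?p" by (intro finite_measure_mono) auto
  then have "?r1 = 0" using True measure_nonneg[of M] by (simp add: order_antisym)
  then show ?thesis using True by simp
next
  case False
  interpret prob_space M by fact
  let ?F = "vimage_algebra (space M) Z borel"
  let ?P = "\<lambda>x. real_cond_exp M ?F (\<lambda>\<omega>. indicator A (X \<omega>) * indicator B (Y \<omega>)) x
               = real_cond_exp M ?F (\<lambda>\<omega>. indicator A (X \<omega>)) x
                 * real_cond_exp M ?F (\<lambda>\<omega>. indicator B (Y \<omega>)) x"
  have ae: "AE x in M. ?P x"
    using ci AB unfolding cond_indep_def by (auto simp: Let_def)
  have "\<exists>x\<in>space M. Z x = z \<and> ?P x"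
  proof (rule ccontr)
    assume "\<not> ?thesis"
    with ae have "AE x in M. Z x \<noteq> z" by (auto elim!: AE_mp)
    then have "?p = 0" by (subst prob_eq_0) (auto elim!: AE_mp)
    with False show False by simp
  qed
  then obtain x where x: "x \<in> space M" "Z x = z" "?P x" by blast
  note e = cond_indep_atom_aux[OF M XYZ AB x(1), unfolded x(2)]
  show ?thesis
    unfolding e(1)[symmetric] e(2)[symmetric] e(3)[symmetric] x(3) by simp
qed

text \<open>Converse for a variable with countably many values: the levels of mass zero together
  form a null set, and on every other level the identity can be divided by the square of the
  mass.\<close>

lemma cond_indepI_atom:
  fixes X :: "'a \<Rightarrow> 'b::topological_space" and Y :: "'a \<Rightarrow> 'c::topological_space"
    and Z :: "'a \<Rightarrow> 'd::t1_space"
  assumes M: "prob_space M"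
    and XYZ[measurable]: "X \<in> borel_measurable M" "Y \<in> borel_measurable M" "Z \<in> borel_measurable M"
    and S: "countable S" "AE x in M. Z x \<in> S"
    and id: "\<And>A B z. A \<in> sets borel \<Longrightarrow> B \<in> sets borel \<Longrightarrow>
      measure M {y \<in> space M. X y \<in> A \<and> Y y \<in> B \<and> Z y = z} * measure M {y \<in> space M. Z y = z}
       = measure M {y \<in> space M. X y \<in> A \<and> Z y = z} * measure M {y \<in> space M. Y y \<in> B \<and> Z y = z}"
  shows "cond_indep M X Y Z"
  unfolding cond_indep_def Let_def
proof (intro ballI)
  interpret prob_space M by fact
  fix A :: "'b set" and B :: "'c set" assume AB: "A \<in> sets borel" "B \<in> sets borel"
  define N where "N = {z\<in>S. prob {y \<in> space M. Z y = z} = 0}"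
  have "AE x in M. \<forall>z\<in>N. Z x \<noteq> z"
    unfolding N_def using S(1)
    by (subst AE_ball_countable) (auto simp: prob_eq_0)
  with S(2) AE_space
  show "AE x in M. real_cond_exp M (vimage_algebra (space M) Z borel)
            (\<lambda>\<omega>. indicator A (X \<omega>) * indicator B (Y \<omega>)) x
               = real_cond_exp M (vimage_algebra (space M) Z borel) (\<lambda>\<omega>. indicator A (X \<omega>)) x
                 * real_cond_exp M (vimage_algebra (space M) Z borel) (\<lambda>\<omega>. indicator B (Y \<omega>)) x"
  proof eventually_elim
    case (elim x)
    let ?p = "prob {y \<in> space M. Z y = Z x}"
    have "?p \<noteq> 0" using elim by (auto simp: N_def)
    note e = cond_indep_atom_aux[OF M XYZ AB elim(2)]
    show ?case
      using id[OF AB, of "Z x"] \<open>?p \<noteq> 0\<close>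
      unfolding e(1)[symmetric] e(2)[symmetric] e(3)[symmetric] by (simp add: field_simps)
  qed
qed

section \<open>Empirical frequencies and product measures\<close>

lemma (in prob_space) indep_vars_empty: "indep_vars M' X {}"
  by (simp add: indep_vars_def indep_sets_def)

text \<open>The targets \<open>M'\<close> share only the sigma-algebras of \<open>N\<close>, so
  independence can be stated with \<open>borel\<close>. The empty index set, a batch of size 0, is
  treated apart because the characterisation by product laws is applied to nonempty
  \<open>I\<close>.\<close>

lemma indep_vars_PiM_coordinates:
  assumes N: "\<And>i. i \<in> I \<Longrightarrow> prob_space (N i)" and M': "\<And>i. i \<in> I \<Longrightarrow> sets (M' i) = sets (N i)"
  shows "prob_space.indep_vars (PiM I N) M' (\<lambda>i x. x i) I"
proof -
  interpret P: prob_space "PiM I N" using N by (rule prob_space_PiM)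
  have "P.indep_vars N (\<lambda>i x. x i) I"
  proof (cases "I = {}")
    case True
    have "P.indep_vars N (\<lambda>i x. x i) J" if "J = {}" for J
      unfolding that by (rule P.indep_vars_empty)
    then show ?thesis using True .
  next
    case False
    have "distr (PiM I N) (PiM I N) (\<lambda>x. \<lambda>i\<in>I. x i) = distr (PiM I N) (PiM I N) (\<lambda>x. x)"
      by (intro distr_cong) (auto simp: space_PiM PiE_def extensional_restrict)
    moreover have "PiM I (\<lambda>i. distr (PiM I N) (N i) (\<lambda>x. x i)) = PiM I N"
      using N by (intro PiM_cong distr_PiM_component) auto
    ultimately show ?thesis
      using False by (subst P.indep_vars_iff_distr_eq_PiM') (auto simp: distr_id)
  qed
  then show ?thesis
  proof (rule P.indep_vars_compose2[where Y = "\<lambda>_ x. x"])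
    show "(\<lambda>x. x) \<in> N i \<rightarrow>\<^sub>M M' i" if "i \<in> I" for i
      using M'[OF that] by (rule measurable_ident_sets[OF sym])
  qed
qed

definition freq :: "nat \<Rightarrow> 'a set \<Rightarrow> (nat \<Rightarrow> 'a) \<Rightarrow> real" where
  "freq n D xs = real (card {i. i < n \<and> xs i \<in> D}) / real n"

lemma freq_eq_sum: "freq n D xs = (\<Sum>i<n. indicator D (xs i)) / real n"
  unfolding freq_def card_eq_sum_of_bool by (simp add: indicator_def of_bool_def)

lemma freq_bounds: "0 \<le> freq n D xs" "freq n D xs \<le> 1"
proof -
  have "card {i. i < n \<and> xs i \<in> D} \<le> card {..<n}" by (intro card_mono) auto
  then show "0 \<le> freq n D xs" "freq n D xs \<le> 1"
    by (auto simp: freq_def divide_le_eq)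
qed

lemma measurable_freq:
  assumes "D \<in> sets N" shows "freq n D \<in> borel_measurable (PiM {..<n} (\<lambda>_. N))"
  using assms unfolding freq_eq_sum[abs_def] by measurable

text \<open>The bound depends on \<open>n\<close> and \<open>e\<close> only. This uniformity in
  \<open>N\<close> matters because the laws at inner nodes change with \<open>n\<close>.\<close>

lemma freq_hoeffding:
  fixes N :: "'a measure"
  assumes N: "prob_space N" and D[measurable]: "D \<in> sets N" and n: "n > 0" and e: "e \<ge> 0"
  shows "measure (PiM {..<n} (\<lambda>_. N)) {xs \<in> space (PiM {..<n} (\<lambda>_. N)). \<bar>freq n D xs - measure N D\<bar> \<ge> e}
      \<le> 2 * exp (-2 * real n * e\<^sup>2)"
proof -
  let ?M = "PiM {..<n} (\<lambda>_. N)"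
  interpret N: prob_space N by fact
  interpret P: prob_space ?M by (intro prob_space_PiM N)
  have c: "distr ?M N (\<lambda>xs. xs i) = N" if "i < n" for i
    using that by (intro distr_PiM_component N) auto
  have d: "distr ?M borel (\<lambda>xs. indicator D (xs i) :: real) = distr N borel (indicator D)" if "i < n" for i
  proof -
    have "distr (distr ?M N (\<lambda>xs. xs i)) borel (indicator D :: _ \<Rightarrow> real)
        = distr ?M borel (indicator D \<circ> (\<lambda>xs. xs i))"
      using that by (intro distr_distr) auto
    then show ?thesis by (simp add: c[OF that] o_def)
  qed
  have "P.indep_vars (\<lambda>_. N) (\<lambda>i xs. xs i) {..<n}"
    by (intro indep_vars_PiM_coordinates N) auto
  then have ind: "P.indep_vars (\<lambda>_. borel) (\<lambda>i xs. indicator D (xs i) :: real) {..<n}"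
    by (rule P.indep_vars_compose2) auto
  have E: "P.expectation (\<lambda>xs. indicator D (xs 0) :: real) = measure N D"
  proof -
    have "P.expectation (\<lambda>xs. indicator D (xs 0) :: real) = integral\<^sup>L (distr ?M N (\<lambda>xs. xs 0)) (indicator D)"
      using n by (intro integral_distr[symmetric]) auto
    also have "\<dots> = measure N D" using D by (simp add: c n)
    finally show ?thesis .
  qed
  have [measurable]: "(\<lambda>xs. xs 0) \<in> ?M \<rightarrow>\<^sub>M N"
    using n by (intro measurable_component_singleton) auto
  interpret H: Hoeffding_ineq_iid ?M "{..<n}" "\<lambda>i xs. indicator D (xs i)" "\<lambda>xs. indicator D (xs 0)"
      0 1 "P.expectation (\<lambda>xs. indicator D (xs 0))"
  proof unfold_locales
    show "P.indep_vars (\<lambda>_. borel) (\<lambda>i xs. indicator D (xs i) :: real) {..<n}" by (rule ind)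
    show "(\<lambda>xs. indicator D (xs 0) :: real) \<in> borel_measurable ?M"
      by measurable
  qed (use d n in \<open>auto simp: indicator_def\<close>)
  show ?thesis
    using H.Hoeffding_ineq_abs_ge'[OF e] n by (simp add: E freq_eq_sum lessThan_empty_iff)
qed

text \<open>Split at \<open>e\<close>: deviations below \<open>e\<close> contribute at most
  \<open>e\<close>, larger ones are at most 1 and contribute at most the Hoeffding tail.\<close>

lemma freq_deviation:
  fixes N :: "'a measure"
  assumes N: "prob_space N" and D: "D \<in> sets N" and n: "n > 0" and e: "e \<ge> 0"
  shows "(\<integral>xs. \<bar>freq n D xs - measure N D\<bar> \<partial>(PiM {..<n} (\<lambda>_. N))) \<le> e + 2 * exp (-2 * real n * e\<^sup>2)"
proof -
  let ?M = "PiM {..<n} (\<lambda>_. N)"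
  let ?E = "{xs \<in> space ?M. \<bar>freq n D xs - measure N D\<bar> \<ge> e}"
  interpret N: prob_space N by fact
  interpret P: prob_space ?M by (intro prob_space_PiM N)
  note [measurable] = measurable_freq[OF D]
  have b: "\<bar>freq n D xs - measure N D\<bar> \<le> 1" for xs
    using freq_bounds[of n D xs] N.prob_le_1[of D] measure_nonneg[of N D] by linarith
  have "(\<integral>xs. \<bar>freq n D xs - measure N D\<bar> \<partial>?M) \<le> (\<integral>xs. e + indicator ?E xs \<partial>?M)"
  proof (rule integral_mono)
    show "integrable ?M (\<lambda>xs. \<bar>freq n D xs - measure N D\<bar>)"
      using b by (intro P.integrable_const_bound[where B=1]) auto
    show "integrable ?M (\<lambda>xs. e + indicator ?E xs)"
      by (intro P.integrable_const_bound[where B="e + 1"]) (auto simp: indicator_def e)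
    show "\<bar>freq n D xs - measure N D\<bar> \<le> e + indicator ?E xs" if "xs \<in> space ?M" for xs
      using that b[of xs] e by (auto simp: indicator_def)
  qed
  also have "\<dots> = e + P.prob ?E"
    by (subst Bochner_Integration.integral_add) (auto intro!: P.integrable_const_bound[where B=1] simp: P.prob_space)
  also have "\<dots> \<le> e + 2 * exp (-2 * real n * e\<^sup>2)"
    using freq_hoeffding[OF N D n e] by simp
  finally show ?thesis .
qed

lemma expectation_freq:
  fixes N :: "'a measure"
  assumes N: "prob_space N" and D[measurable]: "D \<in> sets N" and n: "n > 0"
  shows "(\<integral>xs. freq n D xs \<partial>(PiM {..<n} (\<lambda>_. N))) = measure N D"
proof -
  let ?M = "PiM {..<n} (\<lambda>_. N)"
  interpret N: prob_space N by fact
  interpret P: prob_space ?M by (intro prob_space_PiM N)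
  have i: "(\<integral>xs. indicator D (xs i) \<partial>?M) = measure N D" if "i < n" for i
  proof -
    have "(\<integral>xs. indicator D (xs i) \<partial>?M) = integral\<^sup>L (distr ?M N (\<lambda>xs. xs i)) (indicator D :: _ \<Rightarrow> real)"
      using that by (intro integral_distr[symmetric]) auto
    also have "\<dots> = measure N D"
      using that D N distr_PiM_component[of "{..<n}" "\<lambda>_. N" i] by simp
    finally show ?thesis .
  qed
  have "integrable ?M (\<lambda>xs. indicator D (xs i) :: real)" if "i < n" for i
    using that by (intro P.integrable_const_bound[where B=1]) (auto simp: indicator_def)
  then have "(\<integral>xs. freq n D xs \<partial>?M) = (\<Sum>i<n. (\<integral>xs. indicator D (xs i) \<partial>?M)) / n"
    unfolding freq_eq_sum by (simp add: Bochner_Integration.integral_sum)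
  then show ?thesis using n by (simp add: i)
qed

lemma distr_pair_snd:
  assumes "prob_space N" "prob_space M"
  shows "distr (N \<Otimes>\<^sub>M M) M snd = M"
proof (intro measure_eqI)
  interpret N: prob_space N by fact
  interpret M: prob_space M by fact
  fix A assume "A \<in> sets (distr (N \<Otimes>\<^sub>M M) M snd)"
  then have A: "A \<in> sets M" by simp
  then have "emeasure (distr (N \<Otimes>\<^sub>M M) M snd) A = emeasure (N \<Otimes>\<^sub>M M) (space N \<times> A)"
    by (auto simp: emeasure_distr space_pair_measure dest: sets.sets_into_space
        intro!: arg_cong2[where f=emeasure])
  with A show "emeasure (distr (N \<Otimes>\<^sub>M M) M snd) A = emeasure M A"
    by (simp add: M.emeasure_pair_measure_Times N.emeasure_space_1)
qed simp

text \<open>Since \<open>k\<close> already belongs to \<open>I\<close>, adjoining a coordinate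
  \<open>k\<close> to the product overwrites the old value by an independent draw from the same law,
  which leaves the product unchanged.\<close>

lemma nn_integral_PiM_resample:
  assumes N: "\<And>i. i \<in> I \<Longrightarrow> prob_space (N i)" and R: "prob_space R" and k: "k \<in> I"
    and f[measurable]: "f \<in> borel_measurable (PiM I N \<Otimes>\<^sub>M R)"
  shows "(\<integral>\<^sup>+\<omega>. f \<omega> \<partial>(PiM I N \<Otimes>\<^sub>M R))
       = (\<integral>\<^sup>+x. \<integral>\<^sup>+\<omega>. f ((fst \<omega>)(k := x), snd \<omega>) \<partial>(PiM I N \<Otimes>\<^sub>M R) \<partial>(N k))"
proof -
  interpret R: prob_space R by fact
  interpret P: prob_space "PiM I N" using N by (rule prob_space_PiM)
  interpret K: prob_space "N k" using N k by blast
  have ins: "insert k I = I" using k by auto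
  have u: "(\<lambda>(x, X). X(k := x)) \<in> N k \<Otimes>\<^sub>M PiM I N \<rightarrow>\<^sub>M PiM I N"
    using measurable_add_dim[of k I N] by (simp add: ins measurable_pair_swap_iff[of _ "N k"] split_beta' comp_def)
  have u1: "(\<lambda>\<omega>. (fst \<omega>)(k := x)) \<in> PiM I N \<Otimes>\<^sub>M R \<rightarrow>\<^sub>M PiM I N"
    if "x \<in> space (N k)" for x
    using that k by (intro measurable_fun_upd[where J=I]) auto
  have "(\<integral>\<^sup>+\<omega>. f \<omega> \<partial>(PiM I N \<Otimes>\<^sub>M R)) = (\<integral>\<^sup>+a. \<integral>\<^sup>+r. f (a, r) \<partial>R \<partial>(PiM I N))"
    by (rule R.nn_integral_fst[symmetric]) fact
  also have "\<dots> = (\<integral>\<^sup>+a. \<integral>\<^sup>+r. f (a, r) \<partial>R \<partial>distr (N k \<Otimes>\<^sub>M PiM I N) (PiM I N) (\<lambda>(x, X). X(k := x)))"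
    using distr_pair_PiM_eq_PiM[of I N k] N k by (simp add: ins)
  also have "\<dots> = (\<integral>\<^sup>+z. \<integral>\<^sup>+r. f ((snd z)(k := fst z), r) \<partial>R \<partial>(N k \<Otimes>\<^sub>M PiM I N))"
    by (subst nn_integral_distr[OF u]) (auto simp: split_beta')
  also have "\<dots> = (\<integral>\<^sup>+x. \<integral>\<^sup>+a. \<integral>\<^sup>+r. f (a(k := x), r) \<partial>R \<partial>PiM I N \<partial>N k)"
  proof (subst P.nn_integral_fst[symmetric])
    have [measurable]: "(\<lambda>z. (snd z)(k := fst z)) \<in> N k \<Otimes>\<^sub>M PiM I N \<rightarrow>\<^sub>M PiM I N"
      using u by (simp add: split_beta')
    show "(\<lambda>z. \<integral>\<^sup>+ r. f ((snd z)(k := fst z), r) \<partial>R) \<in> borel_measurable (N k \<Otimes>\<^sub>M PiM I N)"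
      by measurable
  qed simp
  also have "\<dots> = (\<integral>\<^sup>+x. \<integral>\<^sup>+\<omega>. f ((fst \<omega>)(k := x), snd \<omega>) \<partial>(PiM I N \<Otimes>\<^sub>M R) \<partial>(N k))"
  proof (intro nn_integral_cong)
    fix x assume x: "x \<in> space (N k)"
    show "(\<integral>\<^sup>+a. \<integral>\<^sup>+r. f (a(k := x), r) \<partial>R \<partial>PiM I N)
        = (\<integral>\<^sup>+\<omega>. f ((fst \<omega>)(k := x), snd \<omega>) \<partial>(PiM I N \<Otimes>\<^sub>M R))"
    proof (subst R.nn_integral_fst[symmetric])
      show "(\<lambda>\<omega>. f ((fst \<omega>)(k := x), snd \<omega>)) \<in> borel_measurable (PiM I N \<Otimes>\<^sub>M R)"
        using measurable_compose[OF measurable_Pair[OF u1[OF x] measurable_snd] f] by simp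
    qed simp
  qed
  finally show ?thesis .
qed

section \<open>One branching node\<close>

lemma sets_copula_measure [simp, measurable_cong]: "sets (copula_measure c) = sets borel"
  by (simp add: copula_measure_def)

lemma space_copula_measure [simp]: "space (copula_measure c) = UNIV"
  by (simp add: copula_measure_def)

lemma sets_unif01 [simp, measurable_cong]: "sets unif01 = sets borel"
  by (simp add: unif01_def)

lemma space_unif01 [simp]: "space unif01 = UNIV"
  by (simp add: unif01_def)

lemma prob_space_unif01: "prob_space unif01"
  unfolding unif01_def by (rule prob_space_uniform_measure) auto

lemma unif01_singleton: "emeasure unif01 {x} = 0"
  by (simp add: unif01_def emeasure_uniform_measure) (metis Int_lower2 emeasure_lborel_singleton emeasure_mono le_zero_eq sets.sets_into_space borel_singleton sets_lborel sets.empty_sets)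

lemma unif01_atMost:
  assumes "0 \<le> a" "a \<le> 1" shows "measure unif01 {..a} = a"
proof -
  have "{0..1} \<inter> {..a} = {0..a}" using assms by auto
  then show ?thesis using assms by (simp add: unif01_def measure_uniform_measure)
qed

text \<open>Redraw coordinate i as an independent value x. By Fubini the event v i = v j becomes v j
  = x, which is null for each fixed x because \<open>N\<close> has no atoms.\<close>

lemma AE_PiM_distinct:
  fixes N :: "real measure"
  assumes N: "prob_space N" and sets[measurable_cong]: "sets N = sets borel"
    and atomless: "\<And>x. emeasure N {x} = 0" and I: "finite I"
  shows "AE v in PiM I (\<lambda>_. N). inj_on v I"
proof -
  let ?P = "PiM I (\<lambda>_. N)"
  interpret N: prob_space N by fact
  interpret P: prob_space ?P by (intro prob_space_PiM N)
  have ins: "insert k I = I" if "k \<in> I" for k using that by auto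
  have "AE v in ?P. v i \<noteq> v j" if ij: "i \<in> I" "j \<in> I" "i \<noteq> j" for i j
  proof -
    have [measurable]: "(\<lambda>v. v i) \<in> borel_measurable ?P" "(\<lambda>v. v j) \<in> borel_measurable ?P"
      using ij by simp_all
    have 0: "emeasure ?P {v \<in> space ?P. v j = x} = 0" for x
    proof -
      have "emeasure ?P {v \<in> space ?P. v j = x} = emeasure (distr ?P N (\<lambda>v. v j)) {x}"
        using ij sets by (subst emeasure_distr) (auto intro!: arg_cong[where f="emeasure ?P"])
      then show ?thesis
        using distr_PiM_component[of I "\<lambda>_. N" j] ij N atomless by simp
    qed
    have u: "(\<lambda>(x, X). X(i := x)) \<in> N \<Otimes>\<^sub>M ?P \<rightarrow>\<^sub>M ?P"
      using measurable_add_dim[of i I "\<lambda>_. N"] ij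
      by (simp add: ins measurable_pair_swap_iff[of _ "N"] split_beta' comp_def)
    have "emeasure ?P {v \<in> space ?P. v i = v j}
        = (\<integral>\<^sup>+v. indicator {v \<in> space ?P. v i = v j} v \<partial>?P)"
      by simp
    also have "\<dots> = (\<integral>\<^sup>+v. indicator {v \<in> space ?P. v i = v j} v
          \<partial>distr (N \<Otimes>\<^sub>M ?P) ?P (\<lambda>(x, X). X(i := x)))"
      using distr_pair_PiM_eq_PiM[of I "\<lambda>_. N" i] N ij by (simp add: ins)
    also have "\<dots> = (\<integral>\<^sup>+z. indicator {v \<in> space ?P. v i = v j} ((snd z)(i := fst z)) \<partial>(N \<Otimes>\<^sub>M ?P))"
      by (subst nn_integral_distr[OF u]) (auto simp: split_beta')
    also have "\<dots> = (\<integral>\<^sup>+z. indicator {z \<in> space (N \<Otimes>\<^sub>M ?P). snd z j = fst z} z \<partial>(N \<Otimes>\<^sub>M ?P))"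
      using ij by (intro nn_integral_cong)
        (auto simp: indicator_def space_pair_measure space_PiM PiE_fun_upd extensional_def)
    also have "\<dots> = (\<integral>\<^sup>+x. \<integral>\<^sup>+v. indicator {z \<in> space (N \<Otimes>\<^sub>M ?P). snd z j = fst z} (x, v) \<partial>?P \<partial>N)"
      by (subst P.nn_integral_fst[symmetric]) auto
    also have "\<dots> = (\<integral>\<^sup>+x. \<integral>\<^sup>+v. indicator {v \<in> space ?P. v j = x} v \<partial>?P \<partial>N)"
      by (intro nn_integral_cong) (auto simp: indicator_def space_pair_measure)
    also have "\<dots> = 0" by (simp add: 0)
    finally show ?thesis by (subst AE_iff_measurable[OF _ refl]) auto
  qed
  then have "AE v in ?P. \<forall>i\<in>I. \<forall>j\<in>I. i \<noteq> j \<longrightarrow> v i \<noteq> v j"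
    using I by (intro AE_finite_allI) (auto intro!: AE_I2)
  then show ?thesis by eventually_elim (auto simp: inj_on_def)
qed

lemma measurable_rank:
  assumes w: "\<And>j. j < n \<Longrightarrow> (\<lambda>\<omega>. w \<omega> j) \<in> borel_measurable M"
    and v: "\<And>j. j < n \<Longrightarrow> (\<lambda>\<omega>. v \<omega> j) \<in> borel_measurable M" and k: "k < n"
  shows "(\<lambda>\<omega>. rank n (w \<omega>) (v \<omega>) k) \<in> M \<rightarrow>\<^sub>M count_space UNIV"
  unfolding rank_def
proof (rule measurable_card)
  fix j
  note [measurable] = w[OF k] v[OF k]
  show "{\<omega> \<in> space M. j \<in> {j. j < n \<and> (w \<omega> j < w \<omega> k \<or> w \<omega> j = w \<omega> k \<and>
      (v \<omega> j < v \<omega> k \<or> v \<omega> j = v \<omega> k \<and> j < k))}} \<in> sets M"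
  proof (cases "j < n")
    case True
    note [measurable] = w[OF True] v[OF True]
    show ?thesis by simp
  qed simp
qed

text \<open>The index selected in the second batch, isolated for two reasons: it takes finitely many
  values, and it sees the first batch only through the sums \<open>s1\<close>.\<close>

definition item_sigma :: "nat \<Rightarrow> ('a \<Rightarrow> real) \<Rightarrow> ('b \<Rightarrow> real) \<Rightarrow> nat
    \<Rightarrow> (nat \<Rightarrow> 'a) \<times> (nat \<Rightarrow> 'b) \<times> (nat \<Rightarrow> real \<times> real) \<times> (nat \<Rightarrow> real) \<times> (nat \<Rightarrow> real) \<Rightarrow> nat" where
  "item_sigma n s1 s2 k = (\<lambda>(a, b, u, v1, v2).
     mra_sigma n (rank n (\<lambda>j. s1 (a j)) v1) (rank n (\<lambda>j. fst (u j)) (\<lambda>_. 0))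
       (rank n (\<lambda>j. snd (u j)) (\<lambda>_. 0)) (rank n (\<lambda>j. s2 (b j)) v2) k)"

lemma mra_item_eq: "mra_item n s1 s2 k \<omega> = (fst \<omega> k, fst (snd \<omega>) (item_sigma n s1 s2 k \<omega>))"
  by (cases \<omega>) (simp add: mra_item_def item_sigma_def Let_def)

lemma item_sigma_less: "k < n \<Longrightarrow> item_sigma n s1 s2 k \<omega> < n"
  by (cases \<omega>) (simp add: item_sigma_def mra_sigma_less rank_bij)

text \<open>Removes the inverse permutations, which are definite descriptions, in favour of a finite
  existential over equalities of ranks. In this form the event is visibly measurable.\<close>

lemma item_sigma_eq_iff:
  assumes "k < n" "j < n"
  shows "item_sigma n s1 s2 k (a, b, u, v1, v2) = j \<longleftrightarrow>
    (\<exists>i<n. rank n (\<lambda>j. fst (u j)) (\<lambda>_. 0) i = rank n (\<lambda>j. s1 (a j)) v1 k \<and>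
       rank n (\<lambda>j. snd (u j)) (\<lambda>_. 0) i = rank n (\<lambda>j. s2 (b j)) v2 j)"
    (is "_ \<longleftrightarrow> (\<exists>i<n. ?p1 i = ?q1 k \<and> ?p2 i = ?q2 j)")
proof
  let ?i = "perm_inv n ?p1 (?q1 k)"
  have i: "?i < n" "?p1 ?i = ?q1 k"
    using assms by (auto intro!: perm_inv rank_bij rank_less)
  have j: "?q2 (item_sigma n s1 s2 k (a, b, u, v1, v2)) = ?p2 ?i"
    using i(1) by (simp add: item_sigma_def mra_sigma_def perm_inv rank_bij rank_less)
  { assume "item_sigma n s1 s2 k (a, b, u, v1, v2) = j"
    with i j show "\<exists>i<n. ?p1 i = ?q1 k \<and> ?p2 i = ?q2 j" by metis }
  assume "\<exists>i<n. ?p1 i = ?q1 k \<and> ?p2 i = ?q2 j"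
  then obtain i' where i': "i' < n" "?p1 i' = ?q1 k" "?p2 i' = ?q2 j" by blast
  have "?i = i'"
    unfolding i'(2)[symmetric] by (rule perm_inv_eq[OF rank_bij i'(1)])
  then have "?q2 (item_sigma n s1 s2 k (a, b, u, v1, v2)) = ?q2 j" using j i' by simp
  then show "item_sigma n s1 s2 k (a, b, u, v1, v2) = j"
    using bij_betw_imp_inj_on[OF rank_bij[of n "\<lambda>j. s2 (b j)" v2]] assms(2) item_sigma_less[OF assms(1)]
    by (auto dest!: inj_onD)
qed

lemma pred_eq_nat:
  fixes f g :: "'a \<Rightarrow> nat"
  assumes [measurable]: "f \<in> M \<rightarrow>\<^sub>M count_space UNIV" "g \<in> M \<rightarrow>\<^sub>M count_space UNIV"
  shows "Measurable.pred M (\<lambda>x. f x = g x)"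
proof -
  have "(\<lambda>x. f x = g x) = (\<lambda>x. \<exists>m. f x = m \<and> g x = m)" by auto
  moreover have "Measurable.pred M (\<lambda>x. \<exists>m. f x = m \<and> g x = m)" by measurable
  ultimately show ?thesis by (simp only:)
qed

text \<open>The children enter only through the laws \<open>NA\<close> and \<open>NB\<close> of
  single items, their batches being i.i.d. powers. The output of a node again has this form by
  \<open>mra_node_eq\<close>, so the locale can be instantiated level by level.\<close>

locale mra_branch =
  fixes n :: nat and s1 :: "'a::second_countable_topology \<Rightarrow> real"
    and s2 :: "'b::second_countable_topology \<Rightarrow> real"
    and NA :: "'a measure" and NB :: "'b measure" and c :: "real \<times> real \<Rightarrow> real"
  assumes NA: "prob_space NA" and NB: "prob_space NB"
    and sets_NA [simp, measurable_cong]: "sets NA = sets borel"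
    and sets_NB [simp, measurable_cong]: "sets NB = sets borel"
    and s1 [measurable]: "s1 \<in> borel_measurable borel"
    and s2 [measurable]: "s2 \<in> borel_measurable borel"
    and cop: "is_copula_density c"
begin

abbreviation "PA \<equiv> PiM {..<n} (\<lambda>_. NA)"
abbreviation "PB \<equiv> PiM {..<n} (\<lambda>_. NB)"
abbreviation "PU \<equiv> PiM {..<n} (\<lambda>_. copula_measure c)"
abbreviation "PV \<equiv> PiM {..<n} (\<lambda>_. unif01)"
abbreviation "rest \<equiv> PB \<Otimes>\<^sub>M PU \<Otimes>\<^sub>M PV \<Otimes>\<^sub>M PV"
abbreviation "trial \<equiv> PA \<Otimes>\<^sub>M rest"

text \<open>Index 0 is an arbitrary choice; \<open>distr_mra_item\<close> shows that every index
  below \<open>n\<close> gives the same law.\<close>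

definition item_law :: "('a \<times> 'b) measure" where
  "item_law = distr trial borel (mra_item n s1 s2 0)"

lemma space_NA [simp]: "space NA = UNIV" using sets_eq_imp_space_eq[OF sets_NA] by simp
lemma space_NB [simp]: "space NB = UNIV" using sets_eq_imp_space_eq[OF sets_NB] by simp

lemma prob_copula: "prob_space (copula_measure c)"
  using cop by (simp add: is_copula_density_def)

lemma prob_PA: "prob_space PA" and prob_PB: "prob_space PB"
  and prob_PU: "prob_space PU" and prob_PV: "prob_space PV"
  by (intro prob_space_PiM NA NB prob_copula prob_space_unif01)+

lemma prob_rest: "prob_space rest" and prob_trial: "prob_space trial"
  by (intro prob_space_pair prob_PA prob_PB prob_PU prob_PV)+

lemma measurable_item_sigma:
  assumes "k < n"
  shows "item_sigma n s1 s2 k \<in> trial \<rightarrow>\<^sub>M count_space {..<n}"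
proof (subst measurable_count_space_eq2, simp, intro conjI ballI)
  show "item_sigma n s1 s2 k \<in> space trial \<rightarrow> {..<n}"
    using item_sigma_less[OF assms] by auto
  have [measurable]: "(\<lambda>\<omega>. fst \<omega> j) \<in> trial \<rightarrow>\<^sub>M borel"
    "(\<lambda>\<omega>. fst (snd \<omega>) j) \<in> trial \<rightarrow>\<^sub>M borel"
    "(\<lambda>\<omega>. fst (snd (snd \<omega>)) j) \<in> trial \<rightarrow>\<^sub>M borel"
    "(\<lambda>\<omega>. fst (snd (snd (snd \<omega>))) j) \<in> trial \<rightarrow>\<^sub>M borel"
    "(\<lambda>\<omega>. snd (snd (snd (snd \<omega>))) j) \<in> trial \<rightarrow>\<^sub>M borel" if "j < n" for j
    using that by simp_all
  have [measurable]: "(\<lambda>\<omega>. fst (fst (snd (snd \<omega>)) j)) \<in> trial \<rightarrow>\<^sub>M borel"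
    "(\<lambda>\<omega>. snd (fst (snd (snd \<omega>)) j)) \<in> trial \<rightarrow>\<^sub>M borel" if "j < n" for j
  proof -
    have "(\<lambda>\<omega>. fst (snd (snd \<omega>)) j) \<in> trial \<rightarrow>\<^sub>M borel \<Otimes>\<^sub>M borel"
      unfolding borel_prod using that by simp
    then show "(\<lambda>\<omega>. fst (fst (snd (snd \<omega>)) j)) \<in> trial \<rightarrow>\<^sub>M borel"
      "(\<lambda>\<omega>. snd (fst (snd (snd \<omega>)) j)) \<in> trial \<rightarrow>\<^sub>M borel"
      by (auto intro: measurable_compose[OF _ measurable_fst] measurable_compose[OF _ measurable_snd])
  qed
  fix j assume "j \<in> {..<n}"
  then have j: "j < n" by simp
  have m:
    "(\<lambda>\<omega>. rank n (\<lambda>j. fst (fst (snd (snd \<omega>)) j)) (\<lambda>_. 0) i) \<in> trial \<rightarrow>\<^sub>M count_space UNIV"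
    "(\<lambda>\<omega>. rank n (\<lambda>j. snd (fst (snd (snd \<omega>)) j)) (\<lambda>_. 0) i) \<in> trial \<rightarrow>\<^sub>M count_space UNIV"
    "(\<lambda>\<omega>. rank n (\<lambda>j. s1 (fst \<omega> j)) (fst (snd (snd (snd \<omega>)))) i) \<in> trial \<rightarrow>\<^sub>M count_space UNIV"
    "(\<lambda>\<omega>. rank n (\<lambda>j. s2 (fst (snd \<omega>) j)) (snd (snd (snd (snd \<omega>)))) i) \<in> trial \<rightarrow>\<^sub>M count_space UNIV"
    if "i < n" for i
    using that by (auto intro!: measurable_rank)
  have iff: "item_sigma n s1 s2 k \<omega> = j \<longleftrightarrow>
    (\<exists>i\<in>{..<n}. rank n (\<lambda>j. fst (fst (snd (snd \<omega>)) j)) (\<lambda>_. 0) i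
           = rank n (\<lambda>j. s1 (fst \<omega> j)) (fst (snd (snd (snd \<omega>)))) k \<and>
       rank n (\<lambda>j. snd (fst (snd (snd \<omega>)) j)) (\<lambda>_. 0) i
           = rank n (\<lambda>j. s2 (fst (snd \<omega>) j)) (snd (snd (snd (snd \<omega>)))) j)" for \<omega>
    by (cases \<omega>) (simp only: item_sigma_eq_iff[OF assms j] fst_conv snd_conv Bex_def lessThan_iff)
  have "item_sigma n s1 s2 k -` {j} \<inter> space trial = {\<omega> \<in> space trial.
     \<exists>i\<in>{..<n}. rank n (\<lambda>j. fst (fst (snd (snd \<omega>)) j)) (\<lambda>_. 0) i
           = rank n (\<lambda>j. s1 (fst \<omega> j)) (fst (snd (snd (snd \<omega>)))) k \<and>
       rank n (\<lambda>j. snd (fst (snd (snd \<omega>)) j)) (\<lambda>_. 0) i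
           = rank n (\<lambda>j. s2 (fst (snd \<omega>) j)) (snd (snd (snd (snd \<omega>)))) j}"
    unfolding vimage_def using iff by (simp add: Int_def conj_commute)
  also have "\<dots> \<in> sets trial"
    by (rule predE, intro pred_intros_finite(4) finite_lessThan pred_intros_logic(3) pred_eq_nat m)
      (use assms j in auto)
  finally show "item_sigma n s1 s2 k -` {j} \<inter> space trial \<in> sets trial" .
qed

lemma measurable_mra_item:
  assumes "k < n"
  shows "mra_item n s1 s2 k \<in> trial \<rightarrow>\<^sub>M borel"
proof -
  have [measurable]: "(\<lambda>\<omega>. fst \<omega> k) \<in> trial \<rightarrow>\<^sub>M borel"
    "\<And>j. j \<in> {..<n} \<Longrightarrow> (\<lambda>\<omega>. fst (snd \<omega>) j) \<in> trial \<rightarrow>\<^sub>M borel"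
    using assms by simp_all
  have [measurable]: "(\<lambda>\<omega>. fst (snd \<omega>) (item_sigma n s1 s2 k \<omega>)) \<in> trial \<rightarrow>\<^sub>M borel"
    by (rule measurable_compose_countable'[OF _ measurable_item_sigma[OF assms]]) auto
  show ?thesis
    unfolding mra_item_eq[abs_def] borel_prod[symmetric] by measurable
qed

end

lemma distr_pair_preserving:
  assumes N: "prob_space N" and f: "f \<in> M \<rightarrow>\<^sub>M M" "distr M M f = M" and g: "g \<in> N \<rightarrow>\<^sub>M N" "distr N N g = N"
  shows "distr (M \<Otimes>\<^sub>M N) (M \<Otimes>\<^sub>M N) (\<lambda>(x, y). (f x, g y)) = M \<Otimes>\<^sub>M N"
    and "(\<lambda>(x, y). (f x, g y)) \<in> M \<Otimes>\<^sub>M N \<rightarrow>\<^sub>M M \<Otimes>\<^sub>M N"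
proof -
  interpret N: prob_space N by fact
  show "distr (M \<Otimes>\<^sub>M N) (M \<Otimes>\<^sub>M N) (\<lambda>(x, y). (f x, g y)) = M \<Otimes>\<^sub>M N"
    using pair_measure_distr[OF f(1) g(1)] N.sigma_finite_measure_axioms by (simp add: f g)
  note [measurable] = f(1) g(1)
  show "(\<lambda>(x, y). (f x, g y)) \<in> M \<Otimes>\<^sub>M N \<rightarrow>\<^sub>M M \<Otimes>\<^sub>M N" by measurable
qed

lemma sets_borel_pair_Collect:
  fixes P :: "'a::second_countable_topology \<times> 'b::second_countable_topology \<Rightarrow> bool"
  assumes "Measurable.pred (borel \<Otimes>\<^sub>M borel) P"
  shows "{p. P p} \<in> sets borel"
  using assms by (simp add: pred_def space_pair_measure borel_prod)

section \<open>Component laws of one sub-experiment and exchangeability of its items\<close>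

context mra_branch
begin

lemma distr_a: "distr trial PA fst = PA"
  by (rule prob_space.distr_pair_fst[OF prob_rest])

lemma distr_rest: "distr trial rest snd = rest"
  by (rule distr_pair_snd[OF prob_PA prob_rest])

lemma distr_b: "distr trial PB (\<lambda>\<omega>. fst (snd \<omega>)) = PB"
proof -
  have "distr (distr trial rest snd) PB fst = distr trial PB (fst \<circ> snd)"
    by (intro distr_distr) auto
  moreover have "distr rest PB fst = PB"
    by (intro prob_space.distr_pair_fst prob_space_pair prob_PU prob_PV)
  ultimately show ?thesis by (simp only: distr_rest o_def)
qed

lemma distr_uv: "distr trial (PU \<Otimes>\<^sub>M PV \<Otimes>\<^sub>M PV) (\<lambda>\<omega>. snd (snd \<omega>)) = PU \<Otimes>\<^sub>M PV \<Otimes>\<^sub>M PV"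
proof -
  have "distr (distr trial rest snd) (PU \<Otimes>\<^sub>M PV \<Otimes>\<^sub>M PV) snd
      = distr trial (PU \<Otimes>\<^sub>M PV \<Otimes>\<^sub>M PV) (snd \<circ> snd)"
    by (intro distr_distr) auto
  moreover have "distr rest (PU \<Otimes>\<^sub>M PV \<Otimes>\<^sub>M PV) snd = PU \<Otimes>\<^sub>M PV \<Otimes>\<^sub>M PV"
    by (intro distr_pair_snd prob_space_pair prob_PB prob_PU prob_PV)
  ultimately show ?thesis by (simp only: distr_rest o_def)
qed

lemma distr_u: "distr trial PU (\<lambda>\<omega>. fst (snd (snd \<omega>))) = PU"
proof -
  have "distr (distr trial (PU \<Otimes>\<^sub>M PV \<Otimes>\<^sub>M PV) (\<lambda>\<omega>. snd (snd \<omega>))) PU fst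
      = distr trial PU (fst \<circ> (\<lambda>\<omega>. snd (snd \<omega>)))"
    by (intro distr_distr) auto
  moreover have "distr (PU \<Otimes>\<^sub>M PV \<Otimes>\<^sub>M PV) PU fst = PU"
    by (intro prob_space.distr_pair_fst prob_space_pair prob_PU prob_PV)
  ultimately show ?thesis by (simp only: distr_uv o_def)
qed

lemma distr_v1: "distr trial PV (\<lambda>\<omega>. fst (snd (snd (snd \<omega>)))) = PV"
proof -
  have "distr (distr trial (PU \<Otimes>\<^sub>M PV \<Otimes>\<^sub>M PV) (\<lambda>\<omega>. snd (snd \<omega>))) PV (\<lambda>\<omega>. fst (snd \<omega>))
      = distr trial PV ((\<lambda>\<omega>. fst (snd \<omega>)) \<circ> (\<lambda>\<omega>. snd (snd \<omega>)))"
    by (intro distr_distr) auto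
  moreover have "distr (distr (PU \<Otimes>\<^sub>M PV \<Otimes>\<^sub>M PV) (PV \<Otimes>\<^sub>M PV) snd) PV fst
      = distr (PU \<Otimes>\<^sub>M PV \<Otimes>\<^sub>M PV) PV (fst \<circ> snd)"
    by (intro distr_distr) auto
  moreover have "distr (PU \<Otimes>\<^sub>M PV \<Otimes>\<^sub>M PV) (PV \<Otimes>\<^sub>M PV) snd = PV \<Otimes>\<^sub>M PV"
    by (intro distr_pair_snd prob_space_pair prob_PU prob_PV)
  moreover have "distr (PV \<Otimes>\<^sub>M PV) PV fst = PV"
    by (intro prob_space.distr_pair_fst prob_PV)
  ultimately show ?thesis by (simp only: distr_uv o_def)
qed

text \<open>Exchanging entries 0 and k of an i.i.d. family preserves its law, and almost surely it
  carries item k to item 0.\<close>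

lemma distr_mra_item:
  assumes k: "k < n"
  shows "distr trial borel (mra_item n s1 s2 k) = item_law"
proof -
  define \<tau> where "\<tau> i = (if i = 0 then k else if i = k then 0 else i)" for i
  have \<tau>: "bij_betw \<tau> {..<n} {..<n}"
    by (rule bij_betw_byWitness[where f' = \<tau>]) (use k in \<open>auto simp: \<tau>_def\<close>)
  have P: "(\<lambda>\<omega>. \<lambda>i\<in>{..<n}. \<omega> (\<tau> i)) \<in> PiM {..<n} (\<lambda>_. N) \<rightarrow>\<^sub>M PiM {..<n} (\<lambda>_. N)"
    "distr (PiM {..<n} (\<lambda>_. N)) (PiM {..<n} (\<lambda>_. N)) (\<lambda>\<omega>. \<lambda>i\<in>{..<n}. \<omega> (\<tau> i)) = PiM {..<n} (\<lambda>_. N)"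
    if "prob_space N" for N :: "'x measure"
  proof -
    show "(\<lambda>\<omega>. \<lambda>i\<in>{..<n}. \<omega> (\<tau> i)) \<in> PiM {..<n} (\<lambda>_. N) \<rightarrow>\<^sub>M PiM {..<n} (\<lambda>_. N)"
      using bij_betw_less[OF \<tau>] by (intro measurable_restrict measurable_component_singleton) auto
    show "distr (PiM {..<n} (\<lambda>_. N)) (PiM {..<n} (\<lambda>_. N)) (\<lambda>\<omega>. \<lambda>i\<in>{..<n}. \<omega> (\<tau> i)) = PiM {..<n} (\<lambda>_. N)"
      using \<tau> that by (intro distr_PiM_reindex) (auto simp: bij_betw_def)
  qed
  \<comment> \<open>Only the first child and its tie breakers are permuted: the permutation \<sigma> depends on the
    index of the item solely through its rank in the first batch.\<close>
  define T where "T = (\<lambda>(a :: nat \<Rightarrow> 'a, r). (\<lambda>i\<in>{..<n}. a (\<tau> i),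
    (\<lambda>(b :: nat \<Rightarrow> 'b, r). (b, (\<lambda>(u :: nat \<Rightarrow> real \<times> real, r).
      (u, (\<lambda>(v1 :: nat \<Rightarrow> real, v2 :: nat \<Rightarrow> real). (\<lambda>i\<in>{..<n}. v1 (\<tau> i), v2)) r)) r)) r))"
  \<comment> \<open>The map \<open>T\<close> is the identity on \<open>b\<close>, \<open>u\<close>
    and \<open>v2\<close>; invariance of the nested product is assembled from the innermost pair
    outwards.\<close>
  note VV = distr_pair_preserving[OF prob_PV P[OF prob_space_unif01] measurable_ident_sets[OF refl] distr_id]
  note UVV = distr_pair_preserving[OF prob_space_pair[OF prob_PV prob_PV] measurable_ident_sets[OF refl] distr_id VV(2,1), of PU]
  note BUVV = distr_pair_preserving[OF prob_space_pair[OF prob_PU prob_space_pair[OF prob_PV prob_PV]]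
      measurable_ident_sets[OF refl] distr_id UVV(2,1), of PB]
  note T = distr_pair_preserving[OF prob_rest P[OF NA] BUVV(2,1), folded T_def]
  \<comment> \<open>Distinct tie breakers are what \<open>rank_reindex\<close> requires; equality of
    the two items can fail only on this null set.\<close>
  have "AE v in PV. inj_on v {..<n}"
    using prob_space_unif01 unif01_singleton by (intro AE_PiM_distinct) auto
  then have "AE v in distr trial PV (\<lambda>\<omega>. fst (snd (snd (snd \<omega>)))). inj_on v {..<n}"
    by (simp only: distr_v1)
  then have "AE \<omega> in trial. inj_on (fst (snd (snd (snd \<omega>)))) {..<n}"
    by (rule AE_distrD[rotated]) measurable
  then have ae: "AE \<omega> in trial. mra_item n s1 s2 0 (T \<omega>) = mra_item n s1 s2 k \<omega>"
  proof eventually_elim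
    case (elim \<omega>)
    obtain a b u v1 v2 where \<omega>: "\<omega> = (a, b, u, v1, v2)" by (cases \<omega>) auto
    have "rank n (\<lambda>j. s1 ((\<lambda>i\<in>{..<n}. a (\<tau> i)) j)) (\<lambda>i\<in>{..<n}. v1 (\<tau> i)) 0 = rank n (\<lambda>j. s1 (a j)) v1 (\<tau> 0)"
      using elim k by (intro rank_reindex[OF \<tau>]) (auto simp: \<omega>)
    then show ?case
      using k by (simp add: \<omega> T_def mra_item_eq item_sigma_def mra_sigma_def \<tau>_def)
  qed
  have [measurable]: "mra_item n s1 s2 0 \<in> trial \<rightarrow>\<^sub>M borel" "mra_item n s1 s2 k \<in> trial \<rightarrow>\<^sub>M borel"
    using k by (auto intro: measurable_mra_item)
  note [measurable] = T(2)
  have "item_law = distr (distr trial trial T) borel (mra_item n s1 s2 0)"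
    unfolding item_law_def T(1) ..
  also have "\<dots> = distr trial borel (mra_item n s1 s2 0 \<circ> T)"
    by (rule distr_distr) measurable
  also have "\<dots> = distr trial borel (mra_item n s1 s2 k)"
    using ae by (intro distr_cong_AE) (auto simp: o_def)
  finally show ?thesis ..
qed

text \<open>A product measure because each kept item comes from its own sub-experiment, with equal
  factors because the position of an item does not affect its law.\<close>

lemma mra_node_eq: "mra_node n s1 s2 PA PB c = PiM {..<n} (\<lambda>_. item_law)"
  unfolding mra_node_def by (intro PiM_cong distr_mra_item) auto

lemma sets_item_law [simp, measurable_cong]: "sets item_law = sets borel"
  by (simp add: item_law_def)

lemma space_item_law [simp]: "space item_law = UNIV"
  by (simp add: item_law_def)

end

section \<open>The law of a single item and its conditional independence\<close>

locale mra_branch_pos = mra_branch +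
  assumes n: "n > 0"
begin

lemma measurable_item0 [measurable]: "mra_item n s1 s2 0 \<in> trial \<rightarrow>\<^sub>M borel"
  using n by (rule measurable_mra_item)

lemma prob_item_law: "prob_space item_law"
  unfolding item_law_def by (intro prob_space.prob_space_distr prob_trial) measurable

text \<open>Reordering moves only the second batch: the first component of item 0 is entry 0 of the
  first batch, so its law is exactly \<open>NA\<close> for every \<open>n\<close>.\<close>

lemma measure_item_law_fst:
  assumes A[measurable]: "A \<in> sets borel"
  shows "measure item_law {p. fst p \<in> A} = measure NA A"
proof -
  have "{p::'a \<times> 'b. fst p \<in> A} \<in> sets borel"
    by (rule sets_borel_pair_Collect) measurable
  then have "measure item_law {p. fst p \<in> A} = measure trial ((\<lambda>\<omega>. fst \<omega> 0) -` A \<inter> space trial)"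
    unfolding item_law_def by (subst measure_distr) (auto intro!: arg_cong[where f="measure _"] simp: mra_item_eq)
  also have "\<dots> = measure (distr (distr trial PA fst) NA (\<lambda>a. a 0)) A"
    using n A by (subst distr_distr) (auto simp: measure_distr o_def)
  also have "\<dots> = measure NA A"
    unfolding distr_a using n NA by (subst distr_PiM_component) auto
  finally show ?thesis .
qed

text \<open>Redraw entry 0 of the first batch as x. If s1 x = z, the ranks of the first batch, hence
  the selected index and the second component, are the same as with a fixed representative x0 of the
  level. The event for the second component thus becomes independent of x, and \<open>h\<close> is
  its probability. The point of the formulation is that \<open>h\<close> does not depend on
  \<open>A\<close>.\<close>

lemma item_law_resample:
  assumes B[measurable]: "B \<in> sets borel"
  obtains h where "\<And>A. A \<in> sets borel \<Longrightarrow>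
    measure item_law {p. fst p \<in> A \<and> s1 (fst p) = z \<and> snd p \<in> B} = measure NA {x \<in> A. s1 x = z} * h"
proof (cases "\<exists>x0. s1 x0 = z")
  case False
  \<comment> \<open>The level is empty: both sides vanish and any factor will do.\<close>
  then show ?thesis using that[of 0] by simp
next
  case True
  then obtain x0 where x0: "s1 x0 = z" by blast
  define H where "H = {\<omega> \<in> space trial. snd (mra_item n s1 s2 0 ((fst \<omega>)(0 := x0), snd \<omega>)) \<in> B}"
  have u: "(\<lambda>\<omega>. ((fst \<omega>)(0 := x0), snd \<omega>)) \<in> trial \<rightarrow>\<^sub>M trial"
    using n by (intro measurable_Pair measurable_snd measurable_fun_upd[where J="{..<n}"] measurable_fst)
      (auto simp: insert_absorb)
  have sB: "{p::'a \<times> 'b. snd p \<in> B} \<in> sets borel"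
    by (rule sets_borel_pair_Collect) measurable
  have H: "H \<in> sets trial"
    using measurable_sets[OF measurable_compose[OF u measurable_item0] sB]
    by (simp add: H_def vimage_def Int_def conj_commute)
  have snd_upd: "snd (mra_item n s1 s2 0 ((fst \<omega>)(0 := x), snd \<omega>))
      = snd (mra_item n s1 s2 0 ((fst \<omega>)(0 := x0), snd \<omega>))" if "s1 x = z" for \<omega> x
  proof -
    have "(\<lambda>j. s1 (((fst \<omega>)(0 := x)) j)) = (\<lambda>j. s1 (((fst \<omega>)(0 := x0)) j))"
      using that x0 by auto
    then show ?thesis by (simp add: mra_item_eq item_sigma_def split_beta' del: fun_upd_apply)
  qed
  show ?thesis
  proof (rule that[of "measure trial H"])
    fix A :: "'a set" assume A[measurable]: "A \<in> sets borel"
    define Q where "Q = {p::'a \<times> 'b. fst p \<in> A \<and> s1 (fst p) = z \<and> snd p \<in> B}"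
    have Q: "Q \<in> sets borel"
      unfolding Q_def by (rule sets_borel_pair_Collect) measurable
    have A': "{x \<in> A. s1 x = z} \<in> sets NA"
      using A by simp
    have "emeasure item_law Q = (\<integral>\<^sup>+\<omega>. indicator Q (mra_item n s1 s2 0 \<omega>) \<partial>trial)"
      unfolding item_law_def using Q by (simp add: nn_integral_distr flip: nn_integral_indicator)
    also have "\<dots> = (\<integral>\<^sup>+x. \<integral>\<^sup>+\<omega>. indicator Q (mra_item n s1 s2 0 ((fst \<omega>)(0 := x), snd \<omega>)) \<partial>trial \<partial>NA)"
      using n Q NA prob_rest by (intro nn_integral_PiM_resample) auto
    also have "\<dots> = (\<integral>\<^sup>+x. \<integral>\<^sup>+\<omega>. indicator {x \<in> A. s1 x = z} x * indicator H \<omega> \<partial>trial \<partial>NA)"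
    proof (intro nn_integral_cong)
      fix x \<omega> assume "\<omega> \<in> space trial"
      then show "indicator Q (mra_item n s1 s2 0 ((fst \<omega>)(0 := x), snd \<omega>))
          = (indicator {x \<in> A. s1 x = z} x * indicator H \<omega> :: ennreal)"
        using snd_upd[of x \<omega>] by (auto simp: Q_def H_def indicator_def mra_item_eq)
    qed
    also have "\<dots> = emeasure NA {x \<in> A. s1 x = z} * emeasure trial H"
      using A' H by (simp add: nn_integral_cmult nn_integral_multc)
    finally show "measure item_law {p. fst p \<in> A \<and> s1 (fst p) = z \<and> snd p \<in> B}
        = measure NA {x \<in> A. s1 x = z} * measure trial H"
      by (simp add: measure_def Q_def enn2real_mult)
  qed
qed

text \<open>Apply the factorisation with the same \<open>h\<close> to \<open>A\<close> and to
  \<open>UNIV\<close>; each side becomes NA{x in A, s1 x = z} * NA{s1 = z} * h.\<close>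

lemma item_law_cond_indep:
  assumes A[measurable]: "A \<in> sets borel" and B[measurable]: "B \<in> sets borel"
  shows "measure item_law {p. fst p \<in> A \<and> s1 (fst p) = z \<and> snd p \<in> B} * measure item_law {p. s1 (fst p) = z}
       = measure item_law {p. fst p \<in> A \<and> s1 (fst p) = z} * measure item_law {p. s1 (fst p) = z \<and> snd p \<in> B}"
proof -
  obtain h where h: "\<And>A. A \<in> sets borel \<Longrightarrow>
    measure item_law {p. fst p \<in> A \<and> s1 (fst p) = z \<and> snd p \<in> B} = measure NA {x \<in> A. s1 x = z} * h"
    using item_law_resample[OF B] by blast
  have "measure item_law {p. fst p \<in> A \<and> s1 (fst p) = z} = measure NA {x \<in> A. s1 x = z}"
    if "A \<in> sets borel" for A
  proof -
    have "{x \<in> A. s1 x = z} \<in> sets borel" using that by measurable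
    from measure_item_law_fst[OF this] show ?thesis by simp
  qed
  from this[OF A] this[of UNIV] h[OF A] h[of UNIV] show ?thesis by simp
qed

end

section \<open>Rectangle probabilities at a branching node\<close>

lemma copula_marginal:
  assumes cop: "is_copula_density c" and a: "0 \<le> a" "a \<le> 1"
  shows "measure (copula_measure c) {u. fst u \<le> a} = a"
    and "measure (copula_measure c) {u. snd u \<le> a} = a"
proof -
  have [measurable]: "fst \<in> copula_measure c \<rightarrow>\<^sub>M borel" "snd \<in> copula_measure c \<rightarrow>\<^sub>M borel"
    by (simp_all add: borel_prod[symmetric] cong: measurable_cong_sets)
  have "measure (distr (copula_measure c) borel fst) {..a} = a"
    "measure (distr (copula_measure c) borel snd) {..a} = a"
    using cop a unif01_atMost[of a] by (simp_all add: is_copula_density_def unif01_def)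
  then show "measure (copula_measure c) {u. fst u \<le> a} = a"
    "measure (copula_measure c) {u. snd u \<le> a} = a"
    by (simp_all add: measure_distr vimage_def)
qed

lemma copula_cdf_alt: "copula_cdf c a b = measure (copula_measure c) {u. fst u \<le> a \<and> snd u \<le> b}"
  unfolding copula_cdf_def by (rule arg_cong[where f="measure _"]) auto

lemma borel_prod_halfplanes:
  fixes a b :: real
  shows "{u::real \<times> real. fst u \<le> a} \<in> sets borel" "{u::real \<times> real. snd u \<le> b} \<in> sets borel"
    "{u::real \<times> real. fst u \<le> a \<and> snd u \<le> b} \<in> sets borel"
proof -
  have [measurable]: "(fst :: real \<times> real \<Rightarrow> real) \<in> borel \<Otimes>\<^sub>M borel \<rightarrow>\<^sub>M borel"
    "(snd :: real \<times> real \<Rightarrow> real) \<in> borel \<Otimes>\<^sub>M borel \<rightarrow>\<^sub>M borel"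
    by (rule measurable_fst, rule measurable_snd)
  show "{u::real \<times> real. fst u \<le> a} \<in> sets borel" "{u::real \<times> real. snd u \<le> b} \<in> sets borel"
    "{u::real \<times> real. fst u \<le> a \<and> snd u \<le> b} \<in> sets borel"
    by (rule sets_borel_pair_Collect; measurable)+
qed

text \<open>The part of one quadrant outside the other lies in a vertical and a horizontal strip,
  and a strip has mass equal to its width because the marginals are uniform.\<close>

lemma copula_cdf_diff:
  assumes cop: "is_copula_density c"
    and a: "0 \<le> a" "a \<le> 1" "0 \<le> b" "b \<le> 1" and a': "0 \<le> a'" "a' \<le> 1" "0 \<le> b'" "b' \<le> 1"
  shows "\<bar>copula_cdf c a b - copula_cdf c a' b'\<bar> \<le> \<bar>a - a'\<bar> + \<bar>b - b'\<bar>"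
proof -
  interpret C: prob_space "copula_measure c" using cop by (simp add: is_copula_density_def)
  note S = borel_prod_halfplanes
  have strip: "C.prob ({u. fst u \<le> a} - {u. fst u \<le> a'}) \<le> \<bar>a - a'\<bar>"
    "C.prob ({u. snd u \<le> a} - {u. snd u \<le> a'}) \<le> \<bar>a - a'\<bar>"
    if "0 \<le> a" "a \<le> 1" "0 \<le> a'" "a' \<le> 1" for a a'
  proof -
    have "C.prob ({u. fst u \<le> a} - {u. fst u \<le> a'}) \<le> \<bar>a - a'\<bar> \<and>
        C.prob ({u. snd u \<le> a} - {u. snd u \<le> a'}) \<le> \<bar>a - a'\<bar>"
    proof (cases "a' \<le> a")
      case True
      then have "{u::real\<times>real. fst u \<le> a'} \<subseteq> {u. fst u \<le> a}" "{u::real\<times>real. snd u \<le> a'} \<subseteq> {u. snd u \<le> a}"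
        by auto
      then show ?thesis
        using that S(1,2) True by (simp add: C.finite_measure_Diff copula_marginal[OF cop])
    next
      case False
      then have "{u::real\<times>real. fst u \<le> a} - {u. fst u \<le> a'} = {}" "{u::real\<times>real. snd u \<le> a} - {u. snd u \<le> a'} = {}"
        by auto
      then have "C.prob ({u. fst u \<le> a} - {u. fst u \<le> a'}) = 0" "C.prob ({u. snd u \<le> a} - {u. snd u \<le> a'}) = 0"
        by (simp_all only: measure_empty)
      then show ?thesis by simp
    qed
    then show "C.prob ({u. fst u \<le> a} - {u. fst u \<le> a'}) \<le> \<bar>a - a'\<bar>"
      "C.prob ({u. snd u \<le> a} - {u. snd u \<le> a'}) \<le> \<bar>a - a'\<bar>" by simp_all
  qed
  have half: "copula_cdf c a b \<le> copula_cdf c a' b' + (\<bar>a - a'\<bar> + \<bar>b - b'\<bar>)"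
    if h: "0 \<le> a" "a \<le> 1" "0 \<le> b" "b \<le> 1" "0 \<le> a'" "a' \<le> 1" "0 \<le> b'" "b' \<le> 1" for a b a' b'
  proof -
    let ?E = "{u. fst u \<le> a' \<and> snd u \<le> b'}"
    let ?F = "{u::real\<times>real. fst u \<le> a} - {u. fst u \<le> a'}" and ?G = "{u::real\<times>real. snd u \<le> b} - {u. snd u \<le> b'}"
    have "copula_cdf c a b \<le> C.prob (?E \<union> (?F \<union> ?G))"
      unfolding copula_cdf_alt using S by (intro C.finite_measure_mono) auto
    also have "\<dots> \<le> C.prob ?E + (C.prob ?F + C.prob ?G)"
      using S by (intro order_trans[OF measure_Un_le] add_left_mono measure_Un_le) auto
    also have "\<dots> \<le> copula_cdf c a' b' + (\<bar>a - a'\<bar> + \<bar>b - b'\<bar>)"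
      unfolding copula_cdf_alt using h by (intro add_left_mono add_mono strip)
    finally show ?thesis .
  qed
  show ?thesis
    using half[OF a a'] half[OF a' a] by (simp add: abs_minus_commute)
qed

lemma copula_cdf_tendsto:
  assumes cop: "is_copula_density c"
    and x: "x \<longlonglongrightarrow> a" "y \<longlonglongrightarrow> b"
    and bd: "\<And>n. 0 \<le> x n" "\<And>n. x n \<le> 1" "\<And>n. 0 \<le> y n" "\<And>n. y n \<le> 1"
  shows "(\<lambda>n. copula_cdf c (x n) (y n)) \<longlonglongrightarrow> copula_cdf c a b"
proof -
  have ab: "0 \<le> a" "a \<le> 1" "0 \<le> b" "b \<le> 1"
    by (rule LIMSEQ_le_const[OF x(1)] LIMSEQ_le_const2[OF x(1)] LIMSEQ_le_const[OF x(2)]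
        LIMSEQ_le_const2[OF x(2)], rule exI[of _ 0], rule allI, rule impI, rule bd)+
  have 0: "(\<lambda>n. \<bar>x n - a\<bar> + \<bar>y n - b\<bar>) \<longlonglongrightarrow> \<bar>a - a\<bar> + \<bar>b - b\<bar>"
    by (intro tendsto_add tendsto_rabs tendsto_diff tendsto_const x)
  have "(\<lambda>n. copula_cdf c (x n) (y n) - copula_cdf c a b) \<longlonglongrightarrow> 0"
  proof (rule Lim_null_comparison)
    show "(\<lambda>n. \<bar>x n - a\<bar> + \<bar>y n - b\<bar>) \<longlonglongrightarrow> 0" using 0 by simp
    show "eventually (\<lambda>n. norm (copula_cdf c (x n) (y n) - copula_cdf c a b)
        \<le> \<bar>x n - a\<bar> + \<bar>y n - b\<bar>) sequentially"
      unfolding real_norm_def by (intro always_eventually allI copula_cdf_diff[OF cop] bd ab)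
  qed
  then show ?thesis by (simp add: LIM_zero_iff)
qed

definition freq_dev :: "nat \<Rightarrow> 'a set \<Rightarrow> real \<Rightarrow> (nat \<Rightarrow> 'a) \<Rightarrow> real" where
  "freq_dev n D p xs = \<bar>freq n D xs - p\<bar>"

context mra_branch_pos
begin

text \<open>The items of one sub-experiment are dependent but identically distributed, so averaging
  over all of them does not change the mean. This gives access to the whole permutation although the
  algorithm keeps a single item of it.\<close>

lemma expectation_item_freq:
  assumes R: "R \<in> sets borel"
  shows "(\<integral>\<omega>. freq n R (\<lambda>k. mra_item n s1 s2 k \<omega>) \<partial>trial) = measure item_law R"
proof -
  interpret E: prob_space trial by (rule prob_trial)
  have m: "(\<lambda>\<omega>. indicator R (mra_item n s1 s2 k \<omega>) :: real) \<in> borel_measurable trial" if "k < n" for k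
    using measurable_compose[OF measurable_mra_item[OF that] borel_measurable_indicator[OF R]] .
  have int: "integrable trial (\<lambda>\<omega>. indicator R (mra_item n s1 s2 k \<omega>) :: real)" if "k < n" for k
    using m[OF that] by (intro E.integrable_const_bound[where B=1]) (auto simp: indicator_def)
  have "(\<integral>\<omega>. indicator R (mra_item n s1 s2 k \<omega>) \<partial>trial) = measure item_law R" if "k < n" for k
  proof -
    have "(\<integral>\<omega>. indicator R (mra_item n s1 s2 k \<omega>) \<partial>trial)
        = integral\<^sup>L (distr trial borel (mra_item n s1 s2 k)) (indicator R :: _ \<Rightarrow> real)"
      using measurable_mra_item[OF that] R by (intro integral_distr[symmetric]) auto
    then show ?thesis using R by (simp add: distr_mra_item[OF that])
  qed
  with int have "(\<integral>\<omega>. freq n R (\<lambda>k. mra_item n s1 s2 k \<omega>) \<partial>trial) = (\<Sum>k<n. measure item_law R) / n"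
    unfolding freq_eq_sum by (simp add: Bochner_Integration.integral_sum)
  then show ?thesis using n by simp
qed

text \<open>Take expectations in \<open>mra_rectangle_count\<close> with T1 = {..a} and T2 = {..b}.
  The factor 4 counts four deviations: one for each child batch and one for each coordinate of the
  copula samples.\<close>

lemma item_law_rectangle:
  assumes D1[measurable]: "D1 \<in> sets borel" and D2[measurable]: "D2 \<in> sets borel"
    and D: "down_closed D1" "down_closed D2" and e: "e \<ge> 0"
  shows "\<bar>measure item_law {p. s1 (fst p) \<in> D1 \<and> s2 (snd p) \<in> D2}
         - copula_cdf c (measure NA {x. s1 x \<in> D1}) (measure NB {y. s2 y \<in> D2})\<bar>
       \<le> 4 * (e + 2 * exp (-2 * real n * e\<^sup>2))" (is "\<bar>measure item_law ?R - _\<bar> \<le> 4 * ?\<delta>")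
proof -
  interpret E: prob_space trial by (rule prob_trial)
  interpret A: prob_space NA by (rule NA)
  interpret B: prob_space NB by (rule NB)
  \<comment> \<open>The strips of copula samples with coordinate at most \<open>a\<close> or
    \<open>b\<close> have copula mass exactly \<open>a\<close> or \<open>b\<close>, so each batch
    frequency and its strip frequency concentrate around the same number.\<close>
  define a b where "a = measure NA {x. s1 x \<in> D1}" and "b = measure NB {y. s2 y \<in> D2}"
  let ?A = "{x. s1 x \<in> D1}" and ?B = "{y. s2 y \<in> D2}"
  let ?U1 = "{u::real\<times>real. fst u \<le> a}" and ?U2 = "{u::real\<times>real. snd u \<le> b}"
  let ?T = "{u::real\<times>real. fst u \<le> a \<and> snd u \<le> b}"
  have ab: "0 \<le> a" "a \<le> 1" "0 \<le> b" "b \<le> 1" by (auto simp: a_def b_def)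
  have R: "?R \<in> sets borel" by (rule sets_borel_pair_Collect) measurable
  have AB: "?A \<in> sets NA" "?B \<in> sets NB" by simp_all
  note S = borel_prod_halfplanes[of a] borel_prod_halfplanes(2)[of b] borel_prod_halfplanes(3)[of a b]
  have U: "?U1 \<in> sets (copula_measure c)" "?U2 \<in> sets (copula_measure c)" "?T \<in> sets (copula_measure c)"
    using S by simp_all
  \<comment> \<open>Integrals of a function of one component of the sub-experiment are computed
    under the law of that component. The constant 2 is a crude common bound for frequencies and
    their deviations.\<close>
  have transport: "(\<integral>\<omega>. g (h \<omega>) \<partial>trial) = (\<integral>x. g x \<partial>Q)" "integrable trial (\<lambda>\<omega>. g (h \<omega>))"
    if "distr trial Q h = Q" "h \<in> trial \<rightarrow>\<^sub>M Q" "g \<in> borel_measurable Q" "\<And>x. \<bar>g x\<bar> \<le> 2"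
    for Q :: "'x measure" and g :: "'x \<Rightarrow> real" and h
  proof -
    have "(\<integral>x. g x \<partial>distr trial Q h) = (\<integral>\<omega>. g (h \<omega>) \<partial>trial)"
      using that by (intro integral_distr)
    then show "(\<integral>\<omega>. g (h \<omega>) \<partial>trial) = (\<integral>x. g x \<partial>Q)" using that by simp
    show "integrable trial (\<lambda>\<omega>. g (h \<omega>))"
      using that by (intro E.integrable_const_bound[where B=2]) (auto intro: measurable_compose)
  qed
  have dev_bd: "\<bar>freq_dev n D p xs\<bar> \<le> 2" if "0 \<le> p" "p \<le> 1" for D :: "'x set" and p xs
    using freq_bounds[of n D xs] that unfolding freq_dev_def by linarith
  have freq_bd: "\<bar>freq n D xs\<bar> \<le> 2" for D :: "'x set" and xs
    using freq_bounds[of n D xs] by linarith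
  have mdev: "freq_dev n D p \<in> borel_measurable (PiM {..<n} (\<lambda>_. Q))" if "D \<in> sets Q" for D p and Q :: "'x measure"
    using measurable_freq[OF that, of n] unfolding freq_dev_def[abs_def] by measurable
  have h: "fst \<in> trial \<rightarrow>\<^sub>M PA" "(\<lambda>\<omega>. fst (snd \<omega>)) \<in> trial \<rightarrow>\<^sub>M PB" "(\<lambda>\<omega>. fst (snd (snd \<omega>))) \<in> trial \<rightarrow>\<^sub>M PU"
    by measurable
  note tA = transport[OF distr_a h(1) mdev[OF AB(1)] dev_bd[OF ab(1,2)]]
  note tB = transport[OF distr_b h(2) mdev[OF AB(2)] dev_bd[OF ab(3,4)]]
  note tU1 = transport[OF distr_u h(3) mdev[OF U(1)] dev_bd[OF ab(1,2)]]
  note tU2 = transport[OF distr_u h(3) mdev[OF U(2)] dev_bd[OF ab(3,4)]]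
  note tT = transport[OF distr_u h(3) measurable_freq[OF U(3)] freq_bd]
  have dA: "(\<integral>\<omega>. freq_dev n ?A a (fst \<omega>) \<partial>trial) \<le> ?\<delta>"
    unfolding tA(1) unfolding freq_dev_def a_def by (rule freq_deviation[OF NA AB(1) n e])
  have dB: "(\<integral>\<omega>. freq_dev n ?B b (fst (snd \<omega>)) \<partial>trial) \<le> ?\<delta>"
    unfolding tB(1) unfolding freq_dev_def b_def by (rule freq_deviation[OF NB AB(2) n e])
  have dU1: "(\<integral>\<omega>. freq_dev n ?U1 a (fst (snd (snd \<omega>))) \<partial>trial) \<le> ?\<delta>"
    unfolding tU1(1) unfolding freq_dev_def using freq_deviation[OF prob_copula U(1) n e]
    by (simp add: copula_marginal[OF cop ab(1,2)])
  have dU2: "(\<integral>\<omega>. freq_dev n ?U2 b (fst (snd (snd \<omega>))) \<partial>trial) \<le> ?\<delta>"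
    unfolding tU2(1) unfolding freq_dev_def using freq_deviation[OF prob_copula U(2) n e]
    by (simp add: copula_marginal[OF cop ab(3,4)])
  have T: "(\<integral>\<omega>. freq n ?T (fst (snd (snd \<omega>))) \<partial>trial) = copula_cdf c a b"
    unfolding tT(1) copula_cdf_alt by (rule expectation_freq[OF prob_copula U(3) n])
  let ?i = "\<lambda>\<omega> k. mra_item n s1 s2 k \<omega>"
  have iR: "integrable trial (\<lambda>\<omega>. freq n ?R (?i \<omega>))"
  proof -
    have "(\<lambda>\<omega>. indicator ?R (?i \<omega> k) :: real) \<in> borel_measurable trial" if "k < n" for k
      using measurable_compose[OF measurable_mra_item[OF that] borel_measurable_indicator[OF R]] .
    then have "(\<lambda>\<omega>. freq n ?R (?i \<omega>)) \<in> borel_measurable trial"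
      unfolding freq_eq_sum by (intro borel_measurable_divide borel_measurable_sum) auto
    then show ?thesis
      using freq_bd by (intro E.integrable_const_bound[where B=2]) auto
  qed
  have pointwise: "\<bar>freq n ?R (?i \<omega>) - freq n ?T (fst (snd (snd \<omega>)))\<bar>
      \<le> freq_dev n ?A a (fst \<omega>) + freq_dev n ?U1 a (fst (snd (snd \<omega>))) + freq_dev n ?B b (fst (snd \<omega>)) + freq_dev n ?U2 b (fst (snd (snd \<omega>)))"
    for \<omega>
  proof -
    obtain x y u v1 v2 where \<omega>: "\<omega> = (x, y, u, v1, v2)" by (cases \<omega>) auto
    have "\<bar>real (card {k. k < n \<and> ?i \<omega> k \<in> ?R}) - real (card {j. j < n \<and> u j \<in> ?T})\<bar>
      \<le> \<bar>real (card {i. i < n \<and> x i \<in> ?A}) - real (card {i. i < n \<and> u i \<in> ?U1})\<bar>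
        + \<bar>real (card {i. i < n \<and> y i \<in> ?B}) - real (card {i. i < n \<and> u i \<in> ?U2})\<bar>"
      using mra_rectangle_count[OF D down_closed_atMost[of a] down_closed_atMost[of b], of n "\<lambda>j. s1 (x j)" "\<lambda>j. s2 (y j)"
          v1 "\<lambda>j. fst (u j)" "\<lambda>_. 0" "\<lambda>j. snd (u j)" "\<lambda>_. 0" v2]
      by (simp add: \<omega> mra_item_eq item_sigma_def)
    then have "\<bar>freq n ?R (?i \<omega>) - freq n ?T u\<bar>
        \<le> \<bar>freq n ?A x - freq n ?U1 u\<bar> + \<bar>freq n ?B y - freq n ?U2 u\<bar>"
      using n unfolding freq_def diff_divide_distrib[symmetric] abs_divide add_divide_distrib[symmetric]
      by (simp add: divide_right_mono)
    then show ?thesis unfolding freq_dev_def by (simp add: \<omega>)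
  qed
  have "\<bar>measure item_law ?R - copula_cdf c a b\<bar>
      = \<bar>\<integral>\<omega>. freq n ?R (?i \<omega>) - freq n ?T (fst (snd (snd \<omega>))) \<partial>trial\<bar>"
    using iR tT(2) by (simp add: expectation_item_freq[OF R] T)
  also have "\<dots> \<le> (\<integral>\<omega>. \<bar>freq n ?R (?i \<omega>) - freq n ?T (fst (snd (snd \<omega>)))\<bar> \<partial>trial)"
    by (rule integral_abs_bound)
  also have "\<dots> \<le> (\<integral>\<omega>. freq_dev n ?A a (fst \<omega>) + freq_dev n ?U1 a (fst (snd (snd \<omega>)))
      + freq_dev n ?B b (fst (snd \<omega>)) + freq_dev n ?U2 b (fst (snd (snd \<omega>))) \<partial>trial)"
    using iR tA(2) tB(2) tU1(2) tU2(2) tT(2) by (intro integral_mono pointwise) auto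
  also have "\<dots> \<le> 4 * ?\<delta>"
    using dA dB dU1 dU2 tA(2) tB(2) tU1(2) tU2(2) by simp
  finally show ?thesis unfolding a_def b_def .
qed

end

text \<open>Both child laws may vary with \<open>n\<close>, as happens at the root; only the masses
  of the two half-line preimages have to converge.\<close>

lemma item_law_rectangle_limit:
  fixes NA :: "nat \<Rightarrow> 'a::second_countable_topology measure"
    and NB :: "nat \<Rightarrow> 'b::second_countable_topology measure"
  assumes br: "\<And>n. n > 0 \<Longrightarrow> mra_branch_pos n s1 s2 (NA n) (NB n) c"
    and D: "D1 \<in> sets borel" "D2 \<in> sets borel" "down_closed D1" "down_closed D2"
    and A: "(\<lambda>n. measure (NA n) {x. s1 x \<in> D1}) \<longlonglongrightarrow> a"
    and B: "(\<lambda>n. measure (NB n) {y. s2 y \<in> D2}) \<longlonglongrightarrow> b"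
  shows "(\<lambda>n. measure (mra_branch.item_law n s1 s2 (NA n) (NB n) c)
           {p. s1 (fst p) \<in> D1 \<and> s2 (snd p) \<in> D2}) \<longlonglongrightarrow> copula_cdf c a b"
proof -
  let ?m = "\<lambda>n. measure (mra_branch.item_law n s1 s2 (NA n) (NB n) c)
           {p. s1 (fst p) \<in> D1 \<and> s2 (snd p) \<in> D2}"
  let ?a = "\<lambda>n. measure (NA n) {x. s1 x \<in> D1}" and ?b = "\<lambda>n. measure (NB n) {y. s2 y \<in> D2}"
  \<comment> \<open>With e = n^(-1/4) the exponent n * e^2 is sqrt n, so both e and the exponential
    tail tend to 0.\<close>
  let ?e = "\<lambda>n::nat. real n powr (-1/4)"
  have cop: "is_copula_density c"
    using br[of 1] by (simp add: mra_branch_pos_def mra_branch_def)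
  have bd: "0 \<le> ?a (Suc n)" "?a (Suc n) \<le> 1" "0 \<le> ?b (Suc n)" "?b (Suc n) \<le> 1" for n
    using br[of "Suc n"] by (auto simp: mra_branch_pos_def mra_branch_def intro: prob_space.prob_le_1)
  have 1: "(\<lambda>n. copula_cdf c (?a (Suc n)) (?b (Suc n))) \<longlonglongrightarrow> copula_cdf c a b"
    using A B by (intro copula_cdf_tendsto[OF cop] bd) (auto dest: LIMSEQ_Suc)
  have "(\<lambda>n. 4 * (?e n + 2 * exp (-2 * real n * (?e n)\<^sup>2))) \<longlonglongrightarrow> 0"
    by real_asymp
  then have 2: "(\<lambda>n. 4 * (?e (Suc n) + 2 * exp (-2 * real (Suc n) * (?e (Suc n))\<^sup>2))) \<longlonglongrightarrow> 0"
    by (rule LIMSEQ_Suc)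
  have "(\<lambda>n. ?m (Suc n) - copula_cdf c (?a (Suc n)) (?b (Suc n))) \<longlonglongrightarrow> 0"
  proof (rule Lim_null_comparison[OF always_eventually 2], rule allI)
    fix n
    show "norm (?m (Suc n) - copula_cdf c (?a (Suc n)) (?b (Suc n)))
        \<le> 4 * (?e (Suc n) + 2 * exp (-2 * real (Suc n) * (?e (Suc n))\<^sup>2))"
      unfolding real_norm_def
      using mra_branch_pos.item_law_rectangle[OF br[OF zero_less_Suc] D powr_ge_zero] .
  qed
  from tendsto_add[OF this 1] have "(\<lambda>n. ?m (Suc n)) \<longlonglongrightarrow> copula_cdf c a b" by simp
  then show ?thesis by (rule LIMSEQ_imp_Suc)
qed

section \<open>Convergence of atoms\<close>

text \<open>Write d for the sum of differences on \<open>S\<close>. The integrals over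
  \<open>S\<close> differ by at most K * d, and those over the complement are at most K * P(-S) and
  K * Q(-S). As both masses are 1 in total, P(-S) is at most Q(-S) + d, so tightness of
  \<open>P\<close> comes for free.\<close>

lemma integral_diff_atoms_le:
  fixes P Q :: "'a::t1_space measure" and f :: "'a \<Rightarrow> real"
  assumes P: "prob_space P" "sets P = sets borel" and Q: "prob_space Q" "sets Q = sets borel"
    and S: "finite S" and f: "f \<in> borel_measurable borel" "\<And>x. \<bar>f x\<bar> \<le> K"
  shows "\<bar>(\<integral>x. f x \<partial>P) - (\<integral>x. f x \<partial>Q)\<bar>
      \<le> 2 * K * ((\<Sum>s\<in>S. \<bar>measure P {s} - measure Q {s}\<bar>) + measure Q (- S))"
proof -
  have K: "0 \<le> K" using f(2)[of undefined] by linarith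
  have split: "(\<integral>x. f x \<partial>P) = (\<Sum>s\<in>S. f s * measure P {s}) + (\<integral>x. indicator (- S) x * f x \<partial>P)"
    "\<bar>\<integral>x. indicator (- S) x * f x \<partial>P\<bar> \<le> K * measure P (- S)"
    "measure P (- S) = 1 - (\<Sum>s\<in>S. measure P {s})"
    if P: "prob_space P" "sets P = sets borel" for P :: "'a measure"
  proof -
    interpret P: prob_space P by fact
    have sp: "space P = UNIV" using sets_eq_imp_space_eq[OF P(2)] by simp
    have S': "- S \<in> sets P" "S \<in> sets P" and S1: "{s} \<in> sets P" for s
      using P(2) borel_closed[OF finite_imp_closed[OF S]] by auto
    have fm[measurable]: "f \<in> borel_measurable P" using f(1) P(2) by (simp cong: measurable_cong_sets)
    have i1: "integrable P (\<lambda>x. indicator (- S) x * f x)"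
      using S' f(2) K by (intro P.integrable_const_bound[where B=K]) (auto simp: indicator_def)
    have i2: "integrable P (\<lambda>x. f s * indicator {s} x)" for s
      by (intro integrable_mult_right integrable_real_indicator S1) (simp add: P.emeasure_finite less_top[symmetric])
    have eq: "f = (\<lambda>x. (\<Sum>s\<in>S. f s * indicator {s} x) + indicator (- S) x * f x)"
    proof
      fix x
      have "(\<Sum>s\<in>S. f s * indicator {s} x) = (\<Sum>s\<in>S. if s = x then f s else 0)"
        by (intro sum.cong) (auto simp: indicator_def)
      then show "f x = (\<Sum>s\<in>S. f s * indicator {s} x) + indicator (- S) x * f x"
        using S by (simp add: sum.delta indicator_def)
    qed
    have "(\<integral>x. f x \<partial>P) = (\<integral>x. (\<Sum>s\<in>S. f s * indicator {s} x) + indicator (- S) x * f x \<partial>P)"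
      by (subst eq) (rule refl)
    also have "\<dots> = (\<Sum>s\<in>S. f s * measure P {s}) + (\<integral>x. indicator (- S) x * f x \<partial>P)"
      using i1 i2 S1 by (simp add: Bochner_Integration.integral_sum sp)
    finally show "(\<integral>x. f x \<partial>P) = (\<Sum>s\<in>S. f s * measure P {s}) + (\<integral>x. indicator (- S) x * f x \<partial>P)" .
    have "\<bar>\<integral>x. indicator (- S) x * f x \<partial>P\<bar> \<le> (\<integral>x. \<bar>indicator (- S) x * f x\<bar> \<partial>P)"
      by (rule integral_abs_bound)
    also have "\<dots> \<le> (\<integral>x. K * indicator (- S) x \<partial>P)"
    proof (rule integral_mono)
      show "integrable P (\<lambda>x. K * indicator (- S) x)"
        by (intro integrable_mult_right integrable_real_indicator S') (simp add: P.emeasure_finite less_top[symmetric])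
      show "\<bar>indicator (- S) x * f x\<bar> \<le> K * indicator (- S) x" for x
        using f(2)[of x] K by (simp add: indicator_def)
    qed (rule integrable_abs[OF i1])
    also have "\<dots> = K * measure P (- S)" using S' by (simp add: sp)
    finally show "\<bar>\<integral>x. indicator (- S) x * f x \<partial>P\<bar> \<le> K * measure P (- S)" .
    have "measure P (- S) = 1 - measure P S"
      using P.prob_compl[OF S'(2)] by (simp add: sp Compl_eq_Diff_UNIV)
    then show "measure P (- S) = 1 - (\<Sum>s\<in>S. measure P {s})"
      using P.finite_measure_eq_sum_singleton[OF S] S1 by simp
  qed
  let ?d = "\<Sum>s\<in>S. \<bar>measure P {s} - measure Q {s}\<bar>"
  have "\<bar>(\<Sum>s\<in>S. f s * measure P {s}) - (\<Sum>s\<in>S. f s * measure Q {s})\<bar> \<le> (\<Sum>s\<in>S. \<bar>f s\<bar> * \<bar>measure P {s} - measure Q {s}\<bar>)"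
    unfolding sum_subtractf[symmetric] right_diff_distrib[symmetric] abs_mult[symmetric] by (rule sum_abs)
  also have "\<dots> \<le> K * ?d"
    unfolding sum_distrib_left using f(2) by (intro sum_mono mult_right_mono) auto
  finally have 1: "\<bar>(\<Sum>s\<in>S. f s * measure P {s}) - (\<Sum>s\<in>S. f s * measure Q {s})\<bar> \<le> K * ?d" .
  have "\<bar>(\<Sum>s\<in>S. measure P {s}) - (\<Sum>s\<in>S. measure Q {s})\<bar> \<le> ?d"
    unfolding sum_subtractf[symmetric] by (rule sum_abs)
  then have "measure P (- S) \<le> measure Q (- S) + ?d"
    unfolding split(3)[OF P] split(3)[OF Q] by linarith
  then have "K * measure P (- S) \<le> K * (measure Q (- S) + ?d)"
    using K by (rule mult_left_mono)
  then show ?thesis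
    using 1 split(1)[OF P] split(1)[OF Q] split(2)[OF P] split(2)[OF Q] by (simp add: algebra_simps)
qed

lemma finite_atoms_exhaust:
  fixes Q :: "'a::t1_space measure"
  assumes Q: "prob_space Q" "sets Q = sets borel" and C: "countable C" "AE x in Q. x \<in> C" and e: "e > 0"
  obtains S where "finite S" "S \<subseteq> C" "measure Q (- S) < e"
proof -
  interpret Q: prob_space Q by fact
  have sp: "space Q = UNIV" using sets_eq_imp_space_eq[OF Q(2)] by simp
  have sets: "A \<in> sets Q" if "countable A" for A
    unfolding Q(2) by (rule sets.countable[OF _ that]) simp
  have ne: "C \<noteq> {}"
  proof
    assume "C = {}"
    with C(2) have "AE x in Q. False" by simp
    then show False using Q.AE_False by simp
  qed
  define S where "S n = from_nat_into C ` {..n}" for n :: nat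
  have S: "finite (S n)" "S n \<subseteq> C" for n
    using from_nat_into[OF ne] by (auto simp: S_def)
  have SQ: "S n \<in> sets Q" for n by (rule sets[OF countable_finite[OF S(1)]])
  have "incseq S" unfolding S_def by (intro monoI image_mono) simp
  then have "(\<lambda>n. Q.prob (S n)) \<longlonglongrightarrow> Q.prob (\<Union>n. S n)"
    using SQ by (intro Q.finite_Lim_measure_incseq) blast
  also have "(\<Union>n. S n) = C"
  proof
    show "(\<Union>n. S n) \<subseteq> C" using S(2) by blast
    show "C \<subseteq> (\<Union>n. S n)"
    proof
      fix x assume "x \<in> C"
      then obtain n where "from_nat_into C n = x" using from_nat_into_surj[OF C(1)] by blast
      then have "x \<in> S n" unfolding S_def by blast
      then show "x \<in> (\<Union>n. S n)" by blast
    qed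
  qed
  also have "Q.prob C = 1"
    unfolding Q.prob_eq_1[OF sets[OF C(1)]] by (rule C(2))
  finally have "eventually (\<lambda>n. Q.prob (S n) > 1 - e) sequentially"
    by (rule order_tendstoD) (use e in simp)
  then obtain n where "Q.prob (S n) > 1 - e"
    unfolding eventually_sequentially by blast
  then have "Q.prob (- S n) < e"
    using Q.prob_compl[OF SQ, of n] by (simp add: sp Compl_eq_Diff_UNIV)
  then show ?thesis by (rule that[OF S])
qed

text \<open>The finite set \<open>S\<close> and the threshold for \<open>n\<close> depend on
  \<open>K\<close> and \<open>r\<close> but not on \<open>f\<close>, so one \<open>n\<close> serves
  all functions bounded by \<open>K\<close>. This uniformity later yields the supremum over all
  orthants.\<close>

lemma uniform_convergence_of_atoms:
  fixes P :: "nat \<Rightarrow> 'a::t1_space measure"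
  assumes P: "\<And>n. n > 0 \<Longrightarrow> prob_space (P n)" "\<And>n. n > 0 \<Longrightarrow> sets (P n) = sets borel"
    and Q: "prob_space Q" "sets Q = sets borel" and C: "countable C" "AE x in Q. x \<in> C"
    and lim: "\<And>s. s \<in> C \<Longrightarrow> (\<lambda>n. measure (P n) {s}) \<longlonglongrightarrow> measure Q {s}" and r: "(r::real) > 0"
  shows "eventually (\<lambda>n. \<forall>f\<in>borel_measurable borel. (\<forall>x. \<bar>f x\<bar> \<le> (K::real)) \<longrightarrow>
           \<bar>(\<integral>x. f x \<partial>P n) - (\<integral>x. f x \<partial>Q)\<bar> \<le> r) sequentially"
proof -
  \<comment> \<open>The error is at most 2 * K * (e + e) = 4 * K * e. Absolute value and +1 keep the
    denominator positive whatever \<open>K\<close> is.\<close>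
  define e where "e = r / (4 * (\<bar>K\<bar> + 1))"
  have e: "e > 0" using r by (simp add: e_def)
  obtain S where S: "finite S" "S \<subseteq> C" "measure Q (- S) < e"
    by (rule finite_atoms_exhaust[OF Q C e])
  have "(\<lambda>n. \<Sum>s\<in>S. \<bar>measure (P n) {s} - measure Q {s}\<bar>) \<longlonglongrightarrow> (\<Sum>s\<in>S. \<bar>measure Q {s} - measure Q {s}\<bar>)"
    using S(2) by (intro tendsto_sum tendsto_rabs tendsto_diff tendsto_const lim) auto
  then have "eventually (\<lambda>n. (\<Sum>s\<in>S. \<bar>measure (P n) {s} - measure Q {s}\<bar>) < e) sequentially"
    using e by (intro order_tendstoD) auto
  with eventually_gt_at_top[of 0] show ?thesis
  proof eventually_elim
    case (elim n)
    show ?case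
    proof (intro ballI impI)
      fix f :: "'a \<Rightarrow> real" assume f: "f \<in> borel_measurable borel" "\<forall>x. \<bar>f x\<bar> \<le> K"
      have K: "0 \<le> K" using f(2)[rule_format, of undefined] by linarith
      have "\<bar>(\<integral>x. f x \<partial>P n) - (\<integral>x. f x \<partial>Q)\<bar>
        \<le> 2 * K * ((\<Sum>s\<in>S. \<bar>measure (P n) {s} - measure Q {s}\<bar>) + measure Q (- S))"
        using f by (intro integral_diff_atoms_le P Q S(1) elim) auto
      also have "\<dots> \<le> 2 * K * (e + e)"
        using K elim S(3) by (intro mult_left_mono) auto
      also have "\<dots> \<le> r"
      proof -
        have "4 * (K + 1) * e = r" using K unfolding e_def by simp
        then show ?thesis using e by (simp add: algebra_simps)
      qed
      finally show "\<bar>(\<integral>x. f x \<partial>P n) - (\<integral>x. f x \<partial>Q)\<bar> \<le> r" .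
    qed
  qed
qed

lemma integral_tendsto_of_atoms:
  fixes P :: "nat \<Rightarrow> 'a::t1_space measure" and f :: "'a \<Rightarrow> real"
  assumes "\<And>n. n > 0 \<Longrightarrow> prob_space (P n)" "\<And>n. n > 0 \<Longrightarrow> sets (P n) = sets borel"
    and "prob_space Q" "sets Q = sets borel" and "countable C" "AE x in Q. x \<in> C"
    and "\<And>s. s \<in> C \<Longrightarrow> (\<lambda>n. measure (P n) {s}) \<longlonglongrightarrow> measure Q {s}"
    and f: "f \<in> borel_measurable borel" "\<And>x. \<bar>f x\<bar> \<le> K"
  shows "(\<lambda>n. \<integral>x. f x \<partial>P n) \<longlonglongrightarrow> (\<integral>x. f x \<partial>Q)"
proof (rule tendstoI)
  fix r :: real assume "r > 0"
  then have "r / 2 > 0" by simp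
  have "eventually (\<lambda>n. \<forall>f\<in>borel_measurable borel. (\<forall>x. \<bar>f x\<bar> \<le> K) \<longrightarrow>
           \<bar>(\<integral>x. f x \<partial>P n) - (\<integral>x. f x \<partial>Q)\<bar> \<le> r / 2) sequentially"
    by (rule uniform_convergence_of_atoms[where C=C]) (fact assms \<open>r / 2 > 0\<close>)+
  then show "eventually (\<lambda>n. dist (\<integral>x. f x \<partial>P n) (\<integral>x. f x \<partial>Q) < r) sequentially"
  proof eventually_elim
    case (elim n)
    then have "\<bar>(\<integral>x. f x \<partial>P n) - (\<integral>x. f x \<partial>Q)\<bar> \<le> r / 2" using f by blast
    then show ?case using \<open>r > 0\<close> by (simp add: dist_real_def)
  qed
qed

text \<open>Every Borel set is allowed, whatever the mass of its boundary. This is what half-planes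
  x + y <= t demand, whose boundary lines may carry atoms of the sum.\<close>

lemma measure_tendsto_of_atoms:
  fixes P :: "nat \<Rightarrow> 'a::t1_space measure"
  assumes P: "\<And>n. n > 0 \<Longrightarrow> prob_space (P n)" "\<And>n. n > 0 \<Longrightarrow> sets (P n) = sets borel"
    and Q: "prob_space Q" "sets Q = sets borel" and C: "countable C" "AE x in Q. x \<in> C"
    and lim: "\<And>s. s \<in> C \<Longrightarrow> (\<lambda>n. measure (P n) {s}) \<longlonglongrightarrow> measure Q {s}"
    and A: "A \<in> sets borel"
  shows "(\<lambda>n. measure (P n) A) \<longlonglongrightarrow> measure Q A"
proof -
  have "(\<lambda>n. \<integral>x. indicator A x \<partial>P n) \<longlonglongrightarrow> (\<integral>x. indicator A x \<partial>Q :: real)"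
    by (rule integral_tendsto_of_atoms[where C=C and K=1])
      (fact P Q C lim | use A in \<open>simp add: indicator_def\<close>)+
  moreover have "(\<integral>x. indicator A x \<partial>Q) = measure Q A"
    using sets_eq_imp_space_eq[OF Q(2)] by simp
  moreover have "eventually (\<lambda>n. (\<integral>x. indicator A x \<partial>P n) = measure (P n) A) sequentially"
    using eventually_gt_at_top[of 0]
    by eventually_elim (use P(2) sets_eq_imp_space_eq[OF P(2)] in simp)
  ultimately show ?thesis by (simp add: tendsto_cong)
qed

text \<open>The batches form a triangular array whose row law changes with \<open>n\<close>. The
  exponential tails are summable along the rows, so Borel-Cantelli applies to a single set
  \<open>D\<close>.\<close>

lemma AE_freq_atom_tendsto:
  fixes L :: "nat \<Rightarrow> 'a measure"
  assumes L: "\<And>n. n > 0 \<Longrightarrow> prob_space (L n)" and D: "\<And>n. n > 0 \<Longrightarrow> D \<in> sets (L n)"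
    and lim: "(\<lambda>n. measure (L n) D) \<longlonglongrightarrow> p"
  shows "AE \<omega> in (PiM UNIV (\<lambda>n. PiM {..<n} (\<lambda>_. L n))). (\<lambda>n. freq n D (\<omega> n)) \<longlonglongrightarrow> p"
proof -
  let ?R = "\<lambda>n. PiM {..<n} (\<lambda>_. L n)"
  let ?M = "PiM UNIV ?R"
  have R: "prob_space (?R n)" for n
    using L by (intro prob_space_PiM) auto
  interpret M: prob_space ?M by (intro prob_space_PiM R)
  \<comment> \<open>The thresholds 1/(m+1) are countably many, so a single null set suffices for all
    of them. The shift by \<open>Suc\<close> skips row 0, about which nothing is assumed.\<close>
  have "AE \<omega> in ?M. eventually (\<lambda>n. \<bar>freq (Suc n) D (\<omega> (Suc n)) - measure (L (Suc n)) D\<bar> < 1 / real (Suc m)) sequentially" for m :: nat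
  proof -
    let ?e = "1 / real (Suc m)"
    let ?B = "\<lambda>n. {xs \<in> space (?R (Suc n)). \<bar>freq (Suc n) D xs - measure (L (Suc n)) D\<bar> \<ge> ?e}"
    have B: "?B n \<in> sets (?R (Suc n))" for n
    proof -
      note [measurable] = measurable_freq[where n = "Suc n", OF D[of "Suc n", OF zero_less_Suc]]
      show ?thesis by measurable
    qed
    define A where "A n = (\<lambda>\<omega>. \<omega> (Suc n)) -` ?B n \<inter> space ?M" for n
    have A: "A n \<in> sets ?M" for n
      unfolding A_def by (intro measurable_sets[OF _ B] measurable_component_singleton) simp
    have prob_A: "measure ?M (A n) \<le> 2 * exp (-2 * ?e\<^sup>2) ^ Suc n" for n
    proof -
      have "measure ?M (A n) = measure (distr ?M (?R (Suc n)) (\<lambda>\<omega>. \<omega> (Suc n))) (?B n)"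
        unfolding A_def using B by (subst measure_distr) auto
      also have "\<dots> = measure (?R (Suc n)) (?B n)"
        using R by (subst distr_PiM_component) auto
      also have "\<dots> \<le> 2 * exp (-2 * real (Suc n) * ?e\<^sup>2)"
        by (intro freq_hoeffding L D) auto
      \<comment> \<open>For a fixed threshold the tail is a power of a number below 1: a geometric
        series.\<close>
      also have "\<dots> = 2 * exp (-2 * ?e\<^sup>2) ^ Suc n"
        by (subst exp_of_nat_mult[symmetric]) (simp add: algebra_simps)
      finally show ?thesis .
    qed
    have "summable (\<lambda>n. 2 * exp (-2 * ?e\<^sup>2) ^ Suc n)"
      by (intro summable_mult summable_Suc_iff[THEN iffD2] summable_geometric) simp
    then have "summable (\<lambda>n. measure ?M (A n))"
      by (rule summable_comparison_test'[where N=0]) (use prob_A in simp)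
    then have "AE \<omega> in ?M. eventually (\<lambda>n. \<omega> \<in> space ?M - A n) sequentially"
      using A by (intro borel_cantelli_AE1) (auto simp: M.emeasure_finite less_top[symmetric])
    then show ?thesis
    proof eventually_elim
      case (elim \<omega>)
      then show ?case
        by (rule eventually_mono) (auto simp: A_def space_PiM)
    qed
  qed
  then have "AE \<omega> in ?M. \<forall>m. eventually (\<lambda>n. \<bar>freq (Suc n) D (\<omega> (Suc n)) - measure (L (Suc n)) D\<bar> < 1 / real (Suc m)) sequentially"
    by (simp add: AE_all_countable)
  then show ?thesis
  proof eventually_elim
    case (elim \<omega>)
    have "(\<lambda>n. freq (Suc n) D (\<omega> (Suc n)) - measure (L (Suc n)) D) \<longlonglongrightarrow> 0"
    proof (rule tendstoI)
      fix r :: real assume "r > 0"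
      then obtain m where "1 / real (Suc m) < r" using nat_approx_posE by blast
      then show "eventually (\<lambda>n. dist (freq (Suc n) D (\<omega> (Suc n)) - measure (L (Suc n)) D) 0 < r) sequentially"
        using elim[rule_format, of m] by (auto elim!: eventually_mono)
    qed
    from tendsto_add[OF this LIMSEQ_Suc[OF lim]] show ?case
      by (simp add: LIMSEQ_imp_Suc)
  qed
qed

text \<open>Presents relative frequencies as masses of a probability measure, so that
  \<open>uniform_convergence_of_atoms\<close> applies to the empirical laws.\<close>

lemma empirical_measure:
  fixes xs :: "nat \<Rightarrow> 'a::topological_space"
  assumes n: "n > 0" and A: "A \<in> sets borel"
  shows "measure (distr (measure_pmf (pmf_of_set {..<n})) borel xs) A = freq n A xs"
proof -
  have "measure (distr (measure_pmf (pmf_of_set {..<n})) borel xs) A = measure_pmf.prob (pmf_of_set {..<n}) (xs -` A)"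
    using A by (subst measure_distr) auto
  also have "\<dots> = real (card ({..<n} \<inter> xs -` A)) / real (card {..<n})"
    using n by (intro measure_pmf_of_set) auto
  also have "{..<n} \<inter> xs -` A = {k. k < n \<and> xs k \<in> A}" by auto
  finally show ?thesis by (simp add: freq_def)
qed

text \<open>Randomness enters only through the frequencies of countably many atoms. Outside one null
  set the rest is deterministic: the empirical laws of a fixed path converge atomwise, hence
  uniformly over all Borel sets.\<close>

lemma glivenko_cantelli_atoms:
  fixes L :: "nat \<Rightarrow> 'a::t1_space measure" and D :: "'i \<Rightarrow> 'a set"
  assumes L: "\<And>n. n > 0 \<Longrightarrow> prob_space (L n)" "\<And>n. n > 0 \<Longrightarrow> sets (L n) = sets borel"
    and Q: "prob_space Q" "sets Q = sets borel" and C: "countable C" "AE x in Q. x \<in> C"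
    and lim: "\<And>s. s \<in> C \<Longrightarrow> (\<lambda>n. measure (L n) {s}) \<longlonglongrightarrow> measure Q {s}"
    and D: "\<And>i. D i \<in> sets borel"
  shows "AE \<omega> in (PiM UNIV (\<lambda>n. PiM {..<n} (\<lambda>_. L n))).
           (\<lambda>n. \<Squnion>i. \<bar>freq n (D i) (\<omega> n) - measure Q (D i)\<bar>) \<longlonglongrightarrow> 0"
proof -
  have "AE \<omega> in (PiM UNIV (\<lambda>n. PiM {..<n} (\<lambda>_. L n))). \<forall>s\<in>C. (\<lambda>n. freq n {s} (\<omega> n)) \<longlonglongrightarrow> measure Q {s}"
    using C(1) by (intro AE_ball_countable[THEN iffD2] ballI AE_freq_atom_tendsto L lim)
      (auto simp: L(2))
  then show ?thesis
  proof eventually_elim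
    case (elim \<omega>)
    define E where "E n = distr (measure_pmf (pmf_of_set {..<n})) borel (\<omega> n)" for n
    have E: "prob_space (E n)" "sets (E n) = sets borel" for n
      by (auto simp: E_def intro!: measure_pmf.prob_space_distr)
    have Eint: "(\<integral>x. indicator A x \<partial>E n) = freq n A (\<omega> n)" if "n > 0" "A \<in> sets borel" for n A
      using that empirical_measure[OF that] by (simp add: E_def)
    have Qint: "(\<integral>x. indicator A x \<partial>Q) = measure Q A" for A
      using sets_eq_imp_space_eq[OF Q(2)] by simp
    have limE: "(\<lambda>n. measure (E n) {s}) \<longlonglongrightarrow> measure Q {s}" if "s \<in> C" for s
    proof -
      have "eventually (\<lambda>n. measure (E n) {s} = freq n {s} (\<omega> n)) sequentially"
        using eventually_gt_at_top[of 0] by eventually_elim (simp add: E_def empirical_measure)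
      then show ?thesis using elim that by (simp add: tendsto_cong)
    qed
    show ?case
    proof (rule tendstoI)
      fix r :: real assume r: "r > 0"
      then have "r / 2 > 0" by simp
      have "eventually (\<lambda>n. \<forall>f\<in>borel_measurable borel. (\<forall>x. \<bar>f x\<bar> \<le> 1) \<longrightarrow>
           \<bar>(\<integral>x. f x \<partial>E n) - (\<integral>x. f x \<partial>Q)\<bar> \<le> r / 2) sequentially"
        by (rule uniform_convergence_of_atoms[where C=C]) (rule E Q C \<open>r / 2 > 0\<close> | erule limE)+
      with eventually_gt_at_top[of 0]
      show "eventually (\<lambda>n. dist (\<Squnion>i. \<bar>freq n (D i) (\<omega> n) - measure Q (D i)\<bar>) 0 < r) sequentially"
      proof eventually_elim
        case (elim n)
        have b: "\<bar>freq n (D i) (\<omega> n) - measure Q (D i)\<bar> \<le> r / 2" for i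
          using elim(2)[rule_format, of "indicator (D i)"] D[of i]
          unfolding Eint[OF elim(1) D] Qint by (simp add: indicator_def)
        have "(\<Squnion>i. \<bar>freq n (D i) (\<omega> n) - measure Q (D i)\<bar>) \<le> r / 2"
          by (intro cSUP_least b) auto
        moreover have "0 \<le> (\<Squnion>i. \<bar>freq n (D i) (\<omega> n) - measure Q (D i)\<bar>)"
          \<comment> \<open>A supremum of reals is bounded below only through some index and
            boundedness of the family; \<open>undefined\<close> is an arbitrary index.\<close>
          by (rule cSUP_upper2[where x=undefined]) (auto intro!: bdd_aboveI[where M="r / 2"] b)
        ultimately show ?case using r by (simp add: dist_real_def)
      qed
    qed
  qed
qed

section \<open>From rectangles to atoms\<close>

text \<open>The index into the second batch is random, so all \<open>n\<close> entries of that batch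
  are required to lie in \<open>T\<close>; for the first batch entry 0 is enough.\<close>

lemma (in mra_branch_pos) AE_item_law:
  assumes S: "S \<in> sets borel" "AE x in NA. x \<in> S" and T: "T \<in> sets borel" "AE y in NB. y \<in> T"
  shows "AE p in item_law. p \<in> S \<times> T"
proof -
  have "AE a in PA. a 0 \<in> S"
    using n NA S by (intro AE_PiM_component) auto
  then have "AE a in distr trial PA fst. a 0 \<in> S" by (simp only: distr_a)
  then have 1: "AE \<omega> in trial. fst \<omega> 0 \<in> S" by (rule AE_distrD[rotated]) measurable
  have "AE b in PB. \<forall>j\<in>{..<n}. b j \<in> T"
    using NB T by (intro AE_finite_allI AE_PiM_component) auto
  then have "AE b in distr trial PB (\<lambda>\<omega>. fst (snd \<omega>)). \<forall>j\<in>{..<n}. b j \<in> T" by (simp only: distr_b)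
  then have 2: "AE \<omega> in trial. \<forall>j\<in>{..<n}. fst (snd \<omega>) j \<in> T" by (rule AE_distrD[rotated]) measurable
  have ST: "S \<times> T \<in> sets borel"
    unfolding borel_prod[symmetric] using S(1) T(1) by (rule pair_measureI)
  from 1 2 have "AE \<omega> in trial. mra_item n s1 s2 0 \<omega> \<in> S \<times> T"
  proof eventually_elim
    case (elim \<omega>)
    have "item_sigma n s1 s2 0 \<omega> \<in> {..<n}" using item_sigma_less[OF n] by simp
    with elim show ?case by (simp only: mra_item_eq mem_Times_iff fst_conv snd_conv)
  qed
  then show ?thesis
    unfolding item_law_def using ST by (subst AE_distr_iff) auto
qed

lemma halfline_approx:
  fixes x :: real
  assumes "D \<in> {{..x}, {..<x}}"
  obtains t where "incseq (\<lambda>m. {..t m :: real})" "(\<Union>m::nat. {..t m}) = D"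
proof (cases "D = {..x}")
  case True
  show ?thesis by (rule that[of "\<lambda>_. x"]) (auto simp: True)
next
  case False
  then have D: "D = {..<x}" using assms by blast
  show ?thesis
  proof (rule that[of "\<lambda>m. x - 1 / real (Suc m)"])
    show "incseq (\<lambda>m. {..x - 1 / real (Suc m)})"
      by (intro incseq_SucI) (simp add: frac_le)
    show "(\<Union>m. {..x - 1 / real (Suc m)}) = D"
      unfolding D
    proof (intro equalityI subsetI)
      fix y assume "y \<in> {..<x}"
      then obtain m where "1 / real (Suc m) < x - y"
        using nat_approx_posE[of "x - y"] by auto
      then have "y \<in> {..x - 1 / real (Suc m)}" by simp
      then show "y \<in> (\<Union>m. {..x - 1 / real (Suc m)})" by blast
    next
      fix y assume "y \<in> (\<Union>m. {..x - 1 / real (Suc m)})"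
      then obtain m where "y \<le> x - 1 / real (Suc m)" by auto
      moreover have "0 < 1 / real (Suc m)" by simp
      ultimately show "y \<in> {..<x}" unfolding lessThan_iff by linarith
    qed
  qed
qed

text \<open>The model prescribes the copula identity for closed half-lines. Open ones are increasing
  unions of closed ones, and the identity passes to the limit by continuity from below on one side
  and continuity of the copula on the other.\<close>

lemma copula_rectangle_extend:
  fixes f g :: "'a \<Rightarrow> real"
  assumes Q: "prob_space Q" and f[measurable]: "f \<in> borel_measurable Q" and g[measurable]: "g \<in> borel_measurable Q"
    and cop: "is_copula_density c"
    and closed: "\<And>x y. measure Q {\<omega> \<in> space Q. f \<omega> \<le> x \<and> g \<omega> \<le> y}
      = copula_cdf c (measure Q {\<omega> \<in> space Q. f \<omega> \<le> x}) (measure Q {\<omega> \<in> space Q. g \<omega> \<le> y})"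
    and D: "D1 \<in> {{..x}, {..<x}}" "D2 \<in> {{..y}, {..<y}}"
  shows "measure Q {\<omega> \<in> space Q. f \<omega> \<in> D1 \<and> g \<omega> \<in> D2}
      = copula_cdf c (measure Q {\<omega> \<in> space Q. f \<omega> \<in> D1}) (measure Q {\<omega> \<in> space Q. g \<omega> \<in> D2})"
proof -
  interpret Q: prob_space Q by fact
  obtain t1 where t1: "incseq (\<lambda>m. {..t1 m})" "(\<Union>m::nat. {..t1 m}) = D1" by (rule halfline_approx[OF D(1)])
  obtain t2 where t2: "incseq (\<lambda>m. {..t2 m})" "(\<Union>m::nat. {..t2 m}) = D2" by (rule halfline_approx[OF D(2)])
  have mono: "t1 i \<le> t1 j" "t2 i \<le> t2 j" if "i \<le> j" for i j
    using t1(1) t2(1) that unfolding incseq_def by auto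
  have lim: "(\<lambda>m. Q.prob (A m)) \<longlonglongrightarrow> Q.prob B"
    if "\<And>m. A m \<in> sets Q" "incseq A" "(\<Union>m. A m) = B" for A B
    using Q.finite_Lim_measure_incseq[of A] that by auto
  have 1: "(\<lambda>m. Q.prob {\<omega> \<in> space Q. f \<omega> \<le> t1 m}) \<longlonglongrightarrow> Q.prob {\<omega> \<in> space Q. f \<omega> \<in> D1}"
  proof (rule lim)
    show "incseq (\<lambda>m. {\<omega> \<in> space Q. f \<omega> \<le> t1 m})"
      unfolding incseq_def using mono(1) order_trans by blast
    show "(\<Union>m. {\<omega> \<in> space Q. f \<omega> \<le> t1 m}) = {\<omega> \<in> space Q. f \<omega> \<in> D1}"
      unfolding t1(2)[symmetric] by auto
  qed simp
  have 2: "(\<lambda>m. Q.prob {\<omega> \<in> space Q. g \<omega> \<le> t2 m}) \<longlonglongrightarrow> Q.prob {\<omega> \<in> space Q. g \<omega> \<in> D2}"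
  proof (rule lim)
    show "incseq (\<lambda>m. {\<omega> \<in> space Q. g \<omega> \<le> t2 m})"
      unfolding incseq_def using mono(2) order_trans by blast
    show "(\<Union>m. {\<omega> \<in> space Q. g \<omega> \<le> t2 m}) = {\<omega> \<in> space Q. g \<omega> \<in> D2}"
      unfolding t2(2)[symmetric] by auto
  qed simp
  have 3: "(\<lambda>m. Q.prob {\<omega> \<in> space Q. f \<omega> \<le> t1 m \<and> g \<omega> \<le> t2 m}) \<longlonglongrightarrow> Q.prob {\<omega> \<in> space Q. f \<omega> \<in> D1 \<and> g \<omega> \<in> D2}"
  proof (rule lim)
    show "incseq (\<lambda>m. {\<omega> \<in> space Q. f \<omega> \<le> t1 m \<and> g \<omega> \<le> t2 m})"
      unfolding incseq_def using mono order_trans by blast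
    show "(\<Union>m. {\<omega> \<in> space Q. f \<omega> \<le> t1 m \<and> g \<omega> \<le> t2 m}) = {\<omega> \<in> space Q. f \<omega> \<in> D1 \<and> g \<omega> \<in> D2}"
    proof (intro equalityI subsetI)
      fix \<omega> assume "\<omega> \<in> {\<omega> \<in> space Q. f \<omega> \<in> D1 \<and> g \<omega> \<in> D2}"
      then obtain i j where "\<omega> \<in> space Q" "f \<omega> \<le> t1 i" "g \<omega> \<le> t2 j"
        unfolding t1(2)[symmetric] t2(2)[symmetric] by auto
      \<comment> \<open>Both coordinates are approximated along the same index, so separate indices
        i and j are merged into their maximum.\<close>
      then have "\<omega> \<in> {\<omega> \<in> space Q. f \<omega> \<le> t1 (max i j) \<and> g \<omega> \<le> t2 (max i j)}"
        using mono(1)[of i "max i j"] mono(2)[of j "max i j"] by auto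
      then show "\<omega> \<in> (\<Union>m. {\<omega> \<in> space Q. f \<omega> \<le> t1 m \<and> g \<omega> \<le> t2 m})" by blast
    qed (auto simp: t1(2)[symmetric] t2(2)[symmetric])
  qed simp
  have "(\<lambda>m. Q.prob {\<omega> \<in> space Q. f \<omega> \<le> t1 m \<and> g \<omega> \<le> t2 m}) \<longlonglongrightarrow>
      copula_cdf c (Q.prob {\<omega> \<in> space Q. f \<omega> \<in> D1}) (Q.prob {\<omega> \<in> space Q. g \<omega> \<in> D2})"
    unfolding closed by (rule copula_cdf_tendsto[OF cop 1 2]) auto
  then show ?thesis by (rule LIMSEQ_unique[OF 3])
qed

lemma measure_atom_rectangles:
  fixes f g :: "'a \<Rightarrow> real"
  assumes Q: "prob_space Q" and f[measurable]: "f \<in> borel_measurable Q" and g[measurable]: "g \<in> borel_measurable Q"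
  defines "m D1 D2 \<equiv> measure Q {\<omega> \<in> space Q. f \<omega> \<in> D1 \<and> g \<omega> \<in> D2}"
  shows "measure Q {\<omega> \<in> space Q. f \<omega> = x \<and> g \<omega> = y}
      = m {..x} {..y} - m {..<x} {..y} - (m {..x} {..<y} - m {..<x} {..<y})"
proof -
  interpret Q: prob_space Q by fact
  have 1: "m {..x} D = m {..<x} D + m {x} D" if [measurable]: "D \<in> sets borel" for D
  proof -
    have "m {..x} D = Q.prob ({\<omega> \<in> space Q. f \<omega> \<in> {..<x} \<and> g \<omega> \<in> D} \<union> {\<omega> \<in> space Q. f \<omega> \<in> {x} \<and> g \<omega> \<in> D})"
      unfolding m_def by (rule arg_cong[where f=Q.prob]) auto
    also have "\<dots> = m {..<x} D + m {x} D"
      unfolding m_def by (rule Q.finite_measure_Union) auto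
    finally show ?thesis .
  qed
  have "m {x} {..y} = Q.prob ({\<omega> \<in> space Q. f \<omega> \<in> {x} \<and> g \<omega> \<in> {..<y}} \<union> {\<omega> \<in> space Q. f \<omega> \<in> {x} \<and> g \<omega> \<in> {y}})"
    unfolding m_def by (rule arg_cong[where f=Q.prob]) auto
  also have "\<dots> = m {x} {..<y} + m {x} {y}"
    unfolding m_def by (rule Q.finite_measure_Union) auto
  finally have "m {x} {..y} = m {x} {..<y} + m {x} {y}" .
  moreover have "measure Q {\<omega> \<in> space Q. f \<omega> = x \<and> g \<omega> = y} = m {x} {y}"
    by (simp add: m_def)
  ultimately show ?thesis using 1[of "{..y}"] 1[of "{..<y}"] by simp
qed

lemma atom_tendsto_of_rectangles:
  fixes f g :: "'a \<Rightarrow> real" and f' g' :: "'b \<Rightarrow> real"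
  assumes P: "\<And>n::nat. n > 0 \<Longrightarrow> prob_space (P n)"
    "\<And>n. n > 0 \<Longrightarrow> f \<in> borel_measurable (P n)" "\<And>n. n > 0 \<Longrightarrow> g \<in> borel_measurable (P n)"
    and Q: "prob_space Q" "f' \<in> borel_measurable Q" "g' \<in> borel_measurable Q"
    and lim: "\<And>D1 D2. D1 \<in> {{..x}, {..<x}} \<Longrightarrow> D2 \<in> {{..y}, {..<y}} \<Longrightarrow>
      (\<lambda>n. measure (P n) {\<omega> \<in> space (P n). f \<omega> \<in> D1 \<and> g \<omega> \<in> D2})
        \<longlonglongrightarrow> measure Q {\<omega> \<in> space Q. f' \<omega> \<in> D1 \<and> g' \<omega> \<in> D2}"
  shows "(\<lambda>n. measure (P n) {\<omega> \<in> space (P n). f \<omega> = x \<and> g \<omega> = y})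
        \<longlonglongrightarrow> measure Q {\<omega> \<in> space Q. f' \<omega> = x \<and> g' \<omega> = y}"
proof -
  let ?m = "\<lambda>n D1 D2. measure (P n) {\<omega> \<in> space (P n). f \<omega> \<in> D1 \<and> g \<omega> \<in> D2}"
  have "(\<lambda>n. ?m n {..x} {..y} - ?m n {..<x} {..y} - (?m n {..x} {..<y} - ?m n {..<x} {..<y}))
      \<longlonglongrightarrow> measure Q {\<omega> \<in> space Q. f' \<omega> = x \<and> g' \<omega> = y}"
    unfolding measure_atom_rectangles[OF Q] by (intro tendsto_diff lim) simp_all
  moreover have "eventually (\<lambda>n. measure (P n) {\<omega> \<in> space (P n). f \<omega> = x \<and> g \<omega> = y}
      = ?m n {..x} {..y} - ?m n {..<x} {..y} - (?m n {..x} {..<y} - ?m n {..<x} {..<y})) sequentially"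
    using eventually_gt_at_top[of 0]
    by eventually_elim (rule measure_atom_rectangles[OF P])
  ultimately show ?thesis by (simp only: tendsto_cong)
qed

text \<open>The identity map moves the pmf from the discrete to the Borel sigma-algebra. The body
  agrees with the factors of \<open>mra_leaf\<close>.\<close>

definition leaf_law :: "real pmf \<Rightarrow> real measure" where
  "leaf_law p = distr (measure_pmf p) borel (\<lambda>x. x)"

lemma sets_leaf_law [simp, measurable_cong]: "sets (leaf_law p) = sets borel"
  and space_leaf_law [simp]: "space (leaf_law p) = UNIV"
  by (simp_all add: leaf_law_def)

lemma prob_space_leaf_law: "prob_space (leaf_law p)"
  unfolding leaf_law_def by (rule measure_pmf.prob_space_distr) simp

lemma countable_borel: "countable C \<Longrightarrow> C \<in> sets (borel :: 'a::t1_space measure)"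
  by (rule sets.countable) simp_all

lemma AE_leaf_law: "AE x in leaf_law p. x \<in> set_pmf p"
  unfolding leaf_law_def using countable_borel[OF countable_set_pmf[of p]]
  by (subst AE_distr_iff) (simp_all add: AE_measure_pmf)

lemma distr_eq_leaf_law:
  assumes Q: "prob_space Q" and f[measurable]: "f \<in> borel_measurable Q"
    and cdf: "\<And>x. measure Q {\<omega> \<in> space Q. f \<omega> \<le> x} = pmf_cdf p x"
  shows "distr Q borel f = leaf_law p"
proof (rule cdf_unique)
  interpret Q: prob_space Q by fact
  interpret L: prob_space "leaf_law p" by (rule prob_space_leaf_law)
  show "real_distribution (distr Q borel f)"
    by (rule Q.real_distribution_distr) fact
  show "real_distribution (leaf_law p)"
    by unfold_locales simp_all
  show "cdf (distr Q borel f) = cdf (leaf_law p)"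
  proof
    fix x
    have "cdf (distr Q borel f) x = measure Q {\<omega> \<in> space Q. f \<omega> \<le> x}"
      unfolding cdf_def by (subst measure_distr) (auto intro!: arg_cong[where f="measure Q"])
    also have "\<dots> = cdf (leaf_law p) x"
      unfolding cdf pmf_cdf_def cdf_def leaf_law_def by (subst measure_distr) auto
    finally show "cdf (distr Q borel f) x = cdf (leaf_law p) x" .
  qed
qed

section \<open>The tree\<close>

locale mra_tree =
  fixes p11 p12 p2 :: "real pmf" and c1 c0 :: "real \<times> real \<Rightarrow> real"
    and \<mu> :: "((real \<times> real) \<times> real) measure"
  assumes cop1: "is_copula_density c1" and cop0: "is_copula_density c0"
    and tree: "tree_dependent \<mu> p11 p12 p2 c1 c0"
begin

abbreviation (input) "add \<equiv> \<lambda>(x11, x12). x11 + x12 :: real"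

definition law1 :: "nat \<Rightarrow> (real \<times> real) measure" where
  "law1 n = mra_branch.item_law n (\<lambda>x. x) (\<lambda>x. x) (leaf_law p11) (leaf_law p12) c1"

definition root_law :: "nat \<Rightarrow> ((real \<times> real) \<times> real) measure" where
  "root_law n = mra_branch.item_law n add (\<lambda>x. x) (law1 n) (leaf_law p2) c0"

lemma borel_pair [measurable]:
  "(fst :: real \<times> real \<Rightarrow> real) \<in> borel_measurable borel"
  "(snd :: real \<times> real \<Rightarrow> real) \<in> borel_measurable borel"
  "add \<in> borel_measurable borel"
proof -
  show f: "(fst :: real \<times> real \<Rightarrow> real) \<in> borel_measurable borel"
    and s: "(snd :: real \<times> real \<Rightarrow> real) \<in> borel_measurable borel"
    unfolding borel_prod[symmetric] by (rule measurable_fst measurable_snd)+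
  show "add \<in> borel_measurable borel"
    unfolding split_beta' by (intro borel_measurable_add f s)
qed

lemma borel_triple [measurable]:
  "(fst :: (real \<times> real) \<times> real \<Rightarrow> real \<times> real) \<in> borel_measurable borel"
  "(snd :: (real \<times> real) \<times> real \<Rightarrow> real) \<in> borel_measurable borel"
  unfolding borel_prod[symmetric] by (rule measurable_fst measurable_snd)+

lemma coordinates [measurable]:
  "(\<lambda>\<omega>::(real \<times> real) \<times> real. fst (fst \<omega>)) \<in> borel_measurable borel"
  "(\<lambda>\<omega>::(real \<times> real) \<times> real. snd (fst \<omega>)) \<in> borel_measurable borel"
  "(\<lambda>\<omega>::(real \<times> real) \<times> real. fst (fst \<omega>) + snd (fst \<omega>)) \<in> borel_measurable borel"
proof -
  show f: "(\<lambda>\<omega>::(real \<times> real) \<times> real. fst (fst \<omega>)) \<in> borel_measurable borel"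
    and s: "(\<lambda>\<omega>::(real \<times> real) \<times> real. snd (fst \<omega>)) \<in> borel_measurable borel"
    by (rule measurable_compose[OF borel_triple(1)] borel_pair)+
  show "(\<lambda>\<omega>::(real \<times> real) \<times> real. fst (fst \<omega>) + snd (fst \<omega>)) \<in> borel_measurable borel"
    by (intro borel_measurable_add f s)
qed

lemma branch1: "mra_branch (\<lambda>x. x) (\<lambda>x. x) (leaf_law p11) (leaf_law p12) c1"
  by (rule mra_branch.intro) (simp_all add: prob_space_leaf_law cop1)

lemma branch1_pos: "n > 0 \<Longrightarrow> mra_branch_pos n (\<lambda>x. x) (\<lambda>x. x) (leaf_law p11) (leaf_law p12) c1"
  using branch1 by (simp add: mra_branch_pos_def mra_branch_pos_axioms_def)

lemma sets_law1 [simp, measurable_cong]: "sets (law1 n) = sets borel"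
  unfolding law1_def by (rule mra_branch.sets_item_law[OF branch1])

lemma space_law1 [simp]: "space (law1 n) = UNIV"
  unfolding law1_def by (rule mra_branch.space_item_law[OF branch1])

lemma prob_law1: "n > 0 \<Longrightarrow> prob_space (law1 n)"
  unfolding law1_def by (rule mra_branch_pos.prob_item_law[OF branch1_pos])

lemma branch0: "n > 0 \<Longrightarrow> mra_branch_pos n add (\<lambda>x. x) (law1 n) (leaf_law p2) c0"
  by (intro mra_branch_pos.intro mra_branch.intro mra_branch_pos_axioms.intro)
    (simp_all add: prob_space_leaf_law prob_law1 cop0)

lemma branch0': "n > 0 \<Longrightarrow> mra_branch add (\<lambda>x. x) (law1 n) (leaf_law p2) c0"
  using branch0[of n] by (simp add: mra_branch_pos_def)

lemma sets_root_law [simp]: "n > 0 \<Longrightarrow> sets (root_law n) = sets borel"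
  unfolding root_law_def by (rule mra_branch.sets_item_law[OF branch0'])

lemma space_root_law [simp]: "n > 0 \<Longrightarrow> space (root_law n) = UNIV"
  unfolding root_law_def by (rule mra_branch.space_item_law[OF branch0'])

lemma prob_root_law: "n > 0 \<Longrightarrow> prob_space (root_law n)"
  unfolding root_law_def by (rule mra_branch_pos.prob_item_law[OF branch0])

lemma mra_root_eq: "mra_root n p11 p12 p2 c1 c0 = PiM {..<n} (\<lambda>_. root_law n)"
proof (cases "n = 0")
  case True
  \<comment> \<open>Both sides are products over the empty index set. The branch facts are available
    only for positive \<open>n\<close>, where \<open>law1 n\<close> is known to be a probability
    measure.\<close>
  then show ?thesis unfolding mra_root_def mra_node_def[of n add] by (intro PiM_cong) auto
next
  case False
  then have "n > 0" by simp
  have leaf: "mra_leaf n p = PiM {..<n} (\<lambda>_. leaf_law p)" for p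
    by (simp add: mra_leaf_def leaf_law_def)
  show ?thesis
    unfolding mra_root_def leaf mra_branch.mra_node_eq[OF branch1] law1_def[symmetric]
      mra_branch.mra_node_eq[OF branch0'[OF \<open>n > 0\<close>]] root_law_def[symmetric] ..
qed

lemma prob_\<mu>: "prob_space \<mu>" and sets_\<mu> [simp, measurable_cong]: "sets \<mu> = sets borel"
  using tree by (simp_all add: tree_dependent_def)

lemma space_\<mu> [simp]: "space \<mu> = UNIV"
  using sets_eq_imp_space_eq[OF sets_\<mu>] by simp

lemma marginals:
  "distr \<mu> borel (\<lambda>\<omega>. fst (fst \<omega>)) = leaf_law p11"
  "distr \<mu> borel (\<lambda>\<omega>. snd (fst \<omega>)) = leaf_law p12"
  "distr \<mu> borel snd = leaf_law p2"
  using tree unfolding tree_dependent_def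
  by (auto intro!: distr_eq_leaf_law[OF prob_\<mu>] simp: measurable_cong_sets[OF sets_\<mu>])

lemma measure_leaf:
  assumes D: "D \<in> sets borel"
  shows "measure (leaf_law p11) D = measure \<mu> {\<omega>. fst (fst \<omega>) \<in> D}"
    "measure (leaf_law p12) D = measure \<mu> {\<omega>. snd (fst \<omega>) \<in> D}"
    "measure (leaf_law p2) D = measure \<mu> {\<omega>. snd \<omega> \<in> D}"
  unfolding marginals[symmetric] using D by (simp_all add: measure_distr vimage_def)

lemma rectangle1:
  assumes "D1 \<in> {{..x}, {..<x}}" "D2 \<in> {{..y}, {..<y}}"
  shows "measure \<mu> {\<omega>. fst (fst \<omega>) \<in> D1 \<and> snd (fst \<omega>) \<in> D2}
    = copula_cdf c1 (measure \<mu> {\<omega>. fst (fst \<omega>) \<in> D1}) (measure \<mu> {\<omega>. snd (fst \<omega>) \<in> D2})"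
  using copula_rectangle_extend[OF prob_\<mu> _ _ cop1 _ assms, of "\<lambda>\<omega>. fst (fst \<omega>)" "\<lambda>\<omega>. snd (fst \<omega>)"] tree
  unfolding tree_dependent_def by (simp add: measurable_cong_sets[OF sets_\<mu>])

lemma rectangle0:
  assumes "D1 \<in> {{..x}, {..<x}}" "D2 \<in> {{..y}, {..<y}}"
  shows "measure \<mu> {\<omega>. fst (fst \<omega>) + snd (fst \<omega>) \<in> D1 \<and> snd \<omega> \<in> D2}
    = copula_cdf c0 (measure \<mu> {\<omega>. fst (fst \<omega>) + snd (fst \<omega>) \<in> D1}) (measure \<mu> {\<omega>. snd \<omega> \<in> D2})"
  using copula_rectangle_extend[OF prob_\<mu> _ _ cop0 _ assms, of "\<lambda>\<omega>. fst (fst \<omega>) + snd (fst \<omega>)" snd] tree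
  unfolding tree_dependent_def by (simp add: measurable_cong_sets[OF sets_\<mu>])

section \<open>Limits of point masses at node (1) and at the root\<close>

definition supp1 :: "(real \<times> real) set" where "supp1 = set_pmf p11 \<times> set_pmf p12"

definition supp :: "((real \<times> real) \<times> real) set" where "supp = supp1 \<times> set_pmf p2"

lemma countable_supp: "countable supp1" "countable supp"
  by (simp_all add: supp1_def supp_def)

lemma AE_supp: "AE \<omega> in \<mu>. \<omega> \<in> supp"
proof -
  have "AE \<omega> in \<mu>. fst (fst \<omega>) \<in> set_pmf p11" "AE \<omega> in \<mu>. snd (fst \<omega>) \<in> set_pmf p12" "AE \<omega> in \<mu>. snd \<omega> \<in> set_pmf p2"
    using AE_leaf_law[of p11] AE_leaf_law[of p12] AE_leaf_law[of p2] unfolding marginals[symmetric]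
    by (auto dest!: AE_distrD[rotated] simp: measurable_cong_sets[OF sets_\<mu>])
  then show ?thesis by eventually_elim (simp add: supp_def supp1_def mem_Times_iff)
qed

definition \<mu>1 :: "(real \<times> real) measure" where "\<mu>1 = distr \<mu> borel fst"

lemma prob_\<mu>1: "prob_space \<mu>1" and sets_\<mu>1 [simp, measurable_cong]: "sets \<mu>1 = sets borel"
  unfolding \<mu>1_def by (auto intro: prob_space.prob_space_distr[OF prob_\<mu>] simp: measurable_cong_sets[OF sets_\<mu>])

lemma measure_\<mu>1: "A \<in> sets borel \<Longrightarrow> measure \<mu>1 A = measure \<mu> {\<omega>. fst \<omega> \<in> A}"
  unfolding \<mu>1_def by (subst measure_distr) (auto simp: vimage_def measurable_cong_sets[OF sets_\<mu>])

lemma AE_supp1: "AE x in \<mu>1. x \<in> supp1"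
  unfolding \<mu>1_def using AE_supp countable_borel[OF countable_supp(1)]
  by (subst AE_distr_iff) (auto simp: supp_def measurable_cong_sets[OF sets_\<mu>])

lemma law1_atom_tendsto: "(\<lambda>n. measure (law1 n) {q}) \<longlonglongrightarrow> measure \<mu>1 {q}"
proof -
  obtain x y where q: "q = (x, y)" by (cases q)
  have "(\<lambda>n. measure (law1 n) {p \<in> space (law1 n). fst p = x \<and> snd p = y})
      \<longlonglongrightarrow> measure \<mu> {\<omega> \<in> space \<mu>. fst (fst \<omega>) = x \<and> snd (fst \<omega>) = y}"
  proof (rule atom_tendsto_of_rectangles)
    fix D1 D2 assume D: "D1 \<in> {{..x}, {..<x}}" "D2 \<in> {{..y}, {..<y}}"
    have D': "D1 \<in> sets borel" "D2 \<in> sets borel" "down_closed D1" "down_closed D2"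
      using D by auto
    have "(\<lambda>n. measure (law1 n) {p. fst p \<in> D1 \<and> snd p \<in> D2})
        \<longlonglongrightarrow> copula_cdf c1 (measure (leaf_law p11) {x. x \<in> D1}) (measure (leaf_law p12) {x. x \<in> D2})"
      unfolding law1_def by (rule item_law_rectangle_limit[OF branch1_pos D' tendsto_const tendsto_const])
    then show "(\<lambda>n. measure (law1 n) {p \<in> space (law1 n). fst p \<in> D1 \<and> snd p \<in> D2})
        \<longlonglongrightarrow> measure \<mu> {\<omega> \<in> space \<mu>. fst (fst \<omega>) \<in> D1 \<and> snd (fst \<omega>) \<in> D2}"
      using D' rectangle1[OF D] by (simp add: measure_leaf)
  qed (simp_all add: prob_law1 prob_\<mu> measurable_cong_sets[OF sets_\<mu>] measurable_cong_sets[OF sets_law1])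
  moreover have "{p. fst p = x \<and> snd p = y} = {q}" by (auto simp: q)
  moreover have "{\<omega>. fst (fst \<omega>) = x \<and> snd (fst \<omega>) = y} = {\<omega>::(real\<times>real)\<times>real. fst \<omega> \<in> {q}}"
    by (auto simp: q prod_eq_iff)
  ultimately show ?thesis by (simp add: measure_\<mu>1)
qed

text \<open>The step from node (1) to the root: convergence of rectangles gives atoms, and atoms
  give every Borel set, in particular the sets where the sum lies in a half-line. Their masses are
  the first copula argument at the root.\<close>

lemma law1_tendsto: "A \<in> sets borel \<Longrightarrow> (\<lambda>n. measure (law1 n) A) \<longlonglongrightarrow> measure \<mu>1 A"
  by (rule measure_tendsto_of_atoms[where C=supp1])
    (simp_all add: prob_law1 prob_\<mu>1 countable_supp AE_supp1 law1_atom_tendsto)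

lemma measure_root_law_fst:
  "n > 0 \<Longrightarrow> A \<in> sets borel \<Longrightarrow> measure (root_law n) {p. fst p \<in> A} = measure (law1 n) A"
  unfolding root_law_def by (rule mra_branch_pos.measure_item_law_fst[OF branch0])

lemma root_law_fst_tendsto:
  assumes A: "A \<in> sets borel"
  shows "(\<lambda>n. measure (root_law n) {p. fst p \<in> A}) \<longlonglongrightarrow> measure \<mu> {\<omega>. fst \<omega> \<in> A}"
proof -
  have "eventually (\<lambda>n. measure (root_law n) {p. fst p \<in> A} = measure (law1 n) A) sequentially"
    using eventually_gt_at_top[of 0] by eventually_elim (rule measure_root_law_fst[OF _ A])
  then show ?thesis using law1_tendsto[OF A] by (simp add: tendsto_cong measure_\<mu>1[OF A])
qed

text \<open>The rectangle limit with a first child whose law \<open>law1 n\<close> moves with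
  \<open>n\<close>. Its half-line masses converge by \<open>law1_tendsto\<close>, and the limits
  match the defining identity of the tree dependent law.\<close>

lemma root_law_sum_atom_tendsto:
  "(\<lambda>n. measure (root_law n) {p. add (fst p) = s \<and> snd p = z})
     \<longlonglongrightarrow> measure \<mu> {\<omega>. fst (fst \<omega>) + snd (fst \<omega>) = s \<and> snd \<omega> = z}"
proof -
  have "(\<lambda>n. measure (root_law n) {p \<in> space (root_law n). add (fst p) = s \<and> snd p = z})
      \<longlonglongrightarrow> measure \<mu> {\<omega> \<in> space \<mu>. fst (fst \<omega>) + snd (fst \<omega>) = s \<and> snd \<omega> = z}"
  proof (rule atom_tendsto_of_rectangles)
    fix D1 D2 assume D: "D1 \<in> {{..s}, {..<s}}" "D2 \<in> {{..z}, {..<z}}"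
    have D': "D1 \<in> sets borel" "D2 \<in> sets borel" "down_closed D1" "down_closed D2"
      using D by auto
    have A: "{x. add x \<in> D1} \<in> sets borel"
      using measurable_sets[OF borel_pair(3) D'(1)] by (simp add: vimage_def)
    have "(\<lambda>n. measure (root_law n) {p. add (fst p) \<in> D1 \<and> snd p \<in> D2})
        \<longlonglongrightarrow> copula_cdf c0 (measure \<mu>1 {x. add x \<in> D1}) (measure (leaf_law p2) {x. x \<in> D2})"
      unfolding root_law_def by (rule item_law_rectangle_limit[OF branch0 D' law1_tendsto[OF A] tendsto_const])
    then have "(\<lambda>n. measure (root_law n) {p. add (fst p) \<in> D1 \<and> snd p \<in> D2})
        \<longlonglongrightarrow> measure \<mu> {\<omega> \<in> space \<mu>. fst (fst \<omega>) + snd (fst \<omega>) \<in> D1 \<and> snd \<omega> \<in> D2}"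
      using measure_\<mu>1[OF A] D' rectangle0[OF D] by (simp add: measure_leaf split_beta')
    moreover have "eventually (\<lambda>n. measure (root_law n) {p \<in> space (root_law n). add (fst p) \<in> D1 \<and> snd p \<in> D2}
        = measure (root_law n) {p. add (fst p) \<in> D1 \<and> snd p \<in> D2}) sequentially"
      using eventually_gt_at_top[of 0] by eventually_elim simp
    ultimately show "(\<lambda>n. measure (root_law n) {p \<in> space (root_law n). add (fst p) \<in> D1 \<and> snd p \<in> D2})
        \<longlonglongrightarrow> measure \<mu> {\<omega> \<in> space \<mu>. fst (fst \<omega>) + snd (fst \<omega>) \<in> D1 \<and> snd \<omega> \<in> D2}"
      by (simp only: tendsto_cong)
  next
    fix n :: nat assume n: "n > 0"
    show "prob_space (root_law n)" by (rule prob_root_law[OF n])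
    show "(\<lambda>p. add (fst p)) \<in> borel_measurable (root_law n)" "snd \<in> borel_measurable (root_law n)"
      using measurable_compose[OF borel_triple(1) borel_pair(3)] borel_triple(2)
      by (simp_all add: measurable_cong_sets[OF sets_root_law[OF n] refl])
  qed (simp_all add: prob_\<mu> measurable_cong_sets[OF sets_\<mu>])
  moreover have "eventually (\<lambda>n. measure (root_law n) {p \<in> space (root_law n). add (fst p) = s \<and> snd p = z}
        = measure (root_law n) {p. add (fst p) = s \<and> snd p = z}) sequentially"
    using eventually_gt_at_top[of 0] by eventually_elim simp
  ultimately show ?thesis by (simp add: tendsto_cong)
qed

lemma measurable_leaves_sum:
  "(\<lambda>\<omega>::(real \<times> real) \<times> real. (fst (fst \<omega>), snd (fst \<omega>), fst (fst \<omega>) + snd (fst \<omega>))) \<in> borel_measurable borel"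
  by (intro borel_measurable_Pair coordinates)

lemma measurable_leaf_total:
  "(\<lambda>\<omega>::(real \<times> real) \<times> real. (snd \<omega>, fst (fst \<omega>) + snd (fst \<omega>) + snd \<omega>)) \<in> borel_measurable borel"
  by (intro borel_measurable_Pair borel_measurable_add coordinates borel_triple)

lemma root_law_identity:
  assumes n: "n > 0" and A: "A \<in> sets borel" and B: "B \<in> sets borel"
  shows "measure (root_law n) {p. fst p \<in> A \<and> fst (fst p) + snd (fst p) = s \<and> snd p \<in> B}
        * measure (root_law n) {p. fst (fst p) + snd (fst p) = s}
       = measure (root_law n) {p. fst p \<in> A \<and> fst (fst p) + snd (fst p) = s}
        * measure (root_law n) {p. fst (fst p) + snd (fst p) = s \<and> snd p \<in> B}"
  using mra_branch_pos.item_law_cond_indep[OF branch0[OF n] A B, of s]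
  unfolding root_law_def by (simp add: split_beta')

text \<open>Conditional independence evaluated on singletons. On the level where the sum is x + y,
  the sum coordinates of both vectors are determined by the leaves, so the singletons describe plain
  point masses.\<close>

lemma \<mu>_identity:
  "measure \<mu> {((x, y), z)} * measure \<mu> {\<omega>. fst (fst \<omega>) + snd (fst \<omega>) = x + y}
   = measure \<mu> {\<omega>. fst \<omega> \<in> {(x, y)}} * measure \<mu> {\<omega>. fst (fst \<omega>) + snd (fst \<omega>) = x + y \<and> snd \<omega> = z}"
proof -
  let ?X = "\<lambda>\<omega>::(real \<times> real) \<times> real. (fst (fst \<omega>), snd (fst \<omega>), fst (fst \<omega>) + snd (fst \<omega>))"
  let ?Y = "\<lambda>\<omega>::(real \<times> real) \<times> real. (snd \<omega>, fst (fst \<omega>) + snd (fst \<omega>) + snd \<omega>)"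
  let ?Z = "\<lambda>\<omega>::(real \<times> real) \<times> real. fst (fst \<omega>) + snd (fst \<omega>)"
  have "cond_indep \<mu> ?X ?Y ?Z"
    using tree by (simp add: tree_dependent_def)
  then have "measure \<mu> {\<omega> \<in> space \<mu>. ?X \<omega> \<in> {(x, y, x + y)} \<and> ?Y \<omega> \<in> {(z, x + y + z)} \<and> ?Z \<omega> = x + y}
        * measure \<mu> {\<omega> \<in> space \<mu>. ?Z \<omega> = x + y}
      = measure \<mu> {\<omega> \<in> space \<mu>. ?X \<omega> \<in> {(x, y, x + y)} \<and> ?Z \<omega> = x + y}
        * measure \<mu> {\<omega> \<in> space \<mu>. ?Y \<omega> \<in> {(z, x + y + z)} \<and> ?Z \<omega> = x + y}"
    using measurable_leaves_sum measurable_leaf_total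
    by (intro cond_indep_atom prob_\<mu>) (simp_all add: measurable_cong_sets[OF sets_\<mu>])
  moreover have "{\<omega> \<in> space \<mu>. ?X \<omega> \<in> {(x, y, x + y)} \<and> ?Y \<omega> \<in> {(z, x + y + z)} \<and> ?Z \<omega> = x + y} = {((x, y), z)}"
    by (auto simp: prod_eq_iff)
  moreover have "{\<omega> \<in> space \<mu>. ?X \<omega> \<in> {(x, y, x + y)} \<and> ?Z \<omega> = x + y} = {\<omega>. fst \<omega> \<in> {(x, y)}}"
    by (auto simp: prod_eq_iff)
  moreover have "{\<omega> \<in> space \<mu>. ?Y \<omega> \<in> {(z, x + y + z)} \<and> ?Z \<omega> = x + y} = {\<omega>. ?Z \<omega> = x + y \<and> snd \<omega> = z}"
    by auto
  ultimately show ?thesis by simp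
qed

text \<open>The identity m * q = r * t holds for \<open>root_law n\<close> and for
  \<open>\<mu>\<close>, where m is the mass of the triple, q of its sum level, r of its first two
  leaves, and t of the sum together with the third leaf. As q, r and t converge, so does m = r * t /
  q if the limit of q is nonzero; otherwise 0 <= m <= q squeezes m to 0.\<close>

lemma root_law_atom_tendsto: "(\<lambda>n. measure (root_law n) {w}) \<longlonglongrightarrow> measure \<mu> {w}"
proof -
  obtain x y z where w: "w = ((x, y), z)" by (cases w) auto
  define s where "s = x + y"
  let ?Z = "\<lambda>\<omega>::(real \<times> real) \<times> real. fst (fst \<omega>) + snd (fst \<omega>)"
  let ?q = "\<lambda>n. measure (root_law n) {p. ?Z p = s}"
  let ?r = "\<lambda>n. measure (root_law n) {p. fst p \<in> {(x, y)}}"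
  let ?t = "\<lambda>n. measure (root_law n) {p. ?Z p = s \<and> snd p = z}"
  let ?m = "\<lambda>n. measure (root_law n) {w}"
  have S: "{x. add x = s} \<in> sets borel"
    using measurable_sets[OF borel_pair(3), of "{s}"] by (simp add: vimage_def)
  have q: "?q \<longlonglongrightarrow> measure \<mu> {\<omega>. ?Z \<omega> = s}"
    using root_law_fst_tendsto[OF S] by (simp add: split_beta')
  have r: "?r \<longlonglongrightarrow> measure \<mu> {\<omega>. fst \<omega> \<in> {(x, y)}}"
    by (rule root_law_fst_tendsto) simp
  have t: "?t \<longlonglongrightarrow> measure \<mu> {\<omega>. ?Z \<omega> = s \<and> snd \<omega> = z}"
    using root_law_sum_atom_tendsto[of s z] by (simp add: split_beta')
  have id: "?m n * ?q n = ?r n * ?t n" if "n > 0" for n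
  proof -
    have "{p. fst p \<in> {(x, y)} \<and> ?Z p = s \<and> snd p \<in> {z}} = {w}"
      "{p. fst p \<in> {(x, y)} \<and> ?Z p = s} = {p::(real\<times>real)\<times>real. fst p \<in> {(x, y)}}"
      "{p. ?Z p = s \<and> snd p \<in> {z}} = {p. ?Z p = s \<and> snd p = z}"
      by (auto simp: w s_def prod_eq_iff)
    then show ?thesis
      using root_law_identity[OF that, of "{(x, y)}" "{z}" s] by (simp only:) simp
  qed
  have \<mu>id: "measure \<mu> {w} * measure \<mu> {\<omega>. ?Z \<omega> = s}
      = measure \<mu> {\<omega>. fst \<omega> \<in> {(x, y)}} * measure \<mu> {\<omega>. ?Z \<omega> = s \<and> snd \<omega> = z}"
    unfolding w s_def by (rule \<mu>_identity)
  have Zs: "{\<omega>. ?Z \<omega> = s} \<in> sets borel"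
    using measurable_sets[OF coordinates(3), of "{s}"] by (simp add: vimage_def)
  show ?thesis
  proof (cases "measure \<mu> {\<omega>. ?Z \<omega> = s} = 0")
    case False
    have "(\<lambda>n. ?r n * ?t n / ?q n) \<longlonglongrightarrow> measure \<mu> {\<omega>. fst \<omega> \<in> {(x, y)}}
        * measure \<mu> {\<omega>. ?Z \<omega> = s \<and> snd \<omega> = z} / measure \<mu> {\<omega>. ?Z \<omega> = s}"
      by (intro tendsto_divide tendsto_mult r t q False)
    also have "measure \<mu> {\<omega>. fst \<omega> \<in> {(x, y)}}
        * measure \<mu> {\<omega>. ?Z \<omega> = s \<and> snd \<omega> = z} / measure \<mu> {\<omega>. ?Z \<omega> = s} = measure \<mu> {w}"
      unfolding \<mu>id[symmetric] using False by simp
    finally have "(\<lambda>n. ?r n * ?t n / ?q n) \<longlonglongrightarrow> measure \<mu> {w}" .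
    moreover have "eventually (\<lambda>n. ?r n * ?t n / ?q n = ?m n) sequentially"
      using tendsto_imp_eventually_ne[OF q False] eventually_gt_at_top[of 0]
    proof eventually_elim
      case (elim n)
      then show ?case
        unfolding id[OF elim(2), symmetric] by (intro nonzero_mult_div_cancel_right)
    qed
    ultimately show ?thesis by (simp only: tendsto_cong)
  next
    case True
    interpret M: prob_space \<mu> by (rule prob_\<mu>)
    have "measure \<mu> {w} \<le> measure \<mu> {\<omega>. ?Z \<omega> = s}"
      using Zs by (intro M.finite_measure_mono) (auto simp: w s_def)
    then have 0: "measure \<mu> {w} = 0" using True measure_nonneg[of \<mu> "{w}"] by simp
    have "eventually (\<lambda>n. norm (?m n) \<le> ?q n) sequentially"
      using eventually_gt_at_top[of 0]
    proof eventually_elim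
      case (elim n)
      interpret R: prob_space "root_law n" by (rule prob_root_law[OF elim])
      show ?case
        using Zs elim by (simp, intro R.finite_measure_mono) (auto simp: w s_def)
    qed
    then show ?thesis
      unfolding 0 by (rule Lim_null_comparison) (use q True in simp)
  qed
qed

text \<open>Supplies, for each finite \<open>n\<close>, the countable range of the conditioning sum
  that \<open>cond_indepI_atom\<close> asks for.\<close>

lemma AE_root_law:
  assumes n: "n > 0"
  shows "AE p in root_law n. fst p \<in> supp1"
proof -
  have b: "set_pmf p \<in> sets borel" for p :: "real pmf" by (rule countable_borel) simp
  have "AE p in law1 n. p \<in> set_pmf p11 \<times> set_pmf p12"
    unfolding law1_def by (rule mra_branch_pos.AE_item_law[OF branch1_pos[OF n] b AE_leaf_law b AE_leaf_law])
  then have 1: "AE p in law1 n. p \<in> supp1" by (simp only: supp1_def)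
  have "AE p in root_law n. p \<in> supp1 \<times> set_pmf p2"
    unfolding root_law_def
    by (rule mra_branch_pos.AE_item_law[OF branch0[OF n] countable_borel[OF countable_supp(1)] 1 b AE_leaf_law])
  then show ?thesis by eventually_elim auto
qed

section \<open>Transfer to the batch returned at the root\<close>

lemma prob_root: "prob_space (mra_root n p11 p12 p2 c1 c0)"
  unfolding mra_root_eq by (intro prob_space_PiM prob_root_law) auto

lemma coordinate_measurable:
  "k < n \<Longrightarrow> (\<lambda>xs. xs k) \<in> mra_root n p11 p12 p2 c1 c0 \<rightarrow>\<^sub>M borel"
  unfolding mra_root_eq
  using measurable_component_singleton[of k "{..<n}" "\<lambda>_. root_law n"]
  by (simp add: measurable_cong_sets[OF refl sets_root_law])

lemma distr_coordinate:
  assumes k: "k < n"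
  shows "distr (mra_root n p11 p12 p2 c1 c0) borel (\<lambda>xs. xs k) = root_law n"
proof -
  have n: "n > 0" using k by simp
  have "distr (mra_root n p11 p12 p2 c1 c0) borel (\<lambda>xs. xs k) = distr (mra_root n p11 p12 p2 c1 c0) (root_law n) (\<lambda>xs. xs k)"
    by (rule distr_cong) (simp_all add: n)
  also have "\<dots> = root_law n"
    unfolding mra_root_eq using k by (intro distr_PiM_component prob_root_law) auto
  finally show ?thesis .
qed

lemma measure_coordinate:
  assumes k: "k < n" and P: "{p. P p} \<in> sets borel"
  shows "measure (mra_root n p11 p12 p2 c1 c0) {xs \<in> space (mra_root n p11 p12 p2 c1 c0). P (xs k)}
       = measure (root_law n) {p. P p}"
  unfolding distr_coordinate[OF k, symmetric] using P
  by (subst measure_distr[OF coordinate_measurable[OF k]]) (auto intro!: arg_cong[where f="measure _"])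

text \<open>On the level where the sum equals z, both vectors are functions of the first pair alone
  and of the third leaf alone, so the claim reduces to \<open>root_law_identity\<close>.\<close>

lemma cond_indep_root:
  assumes k: "k < n"
  shows "cond_indep (mra_root n p11 p12 p2 c1 c0)
     (\<lambda>xs. (fst (fst (xs k)), snd (fst (xs k)), fst (fst (xs k)) + snd (fst (xs k))))
     (\<lambda>xs. (snd (xs k), fst (fst (xs k)) + snd (fst (xs k)) + snd (xs k)))
     (\<lambda>xs. fst (fst (xs k)) + snd (fst (xs k)))"
    (is "cond_indep ?M (\<lambda>xs. ?X (xs k)) (\<lambda>xs. ?Y (xs k)) (\<lambda>xs. ?Z (xs k))")
proof (rule cond_indepI_atom[where S = "(\<lambda>(x, y). x + y) ` supp1"])
  have n: "n > 0" using k by simp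
  note c = coordinate_measurable[OF k]
  show "prob_space ?M" by (rule prob_root)
  show "(\<lambda>xs. ?X (xs k)) \<in> borel_measurable ?M"
    by (rule measurable_compose[OF c measurable_leaves_sum])
  show "(\<lambda>xs. ?Y (xs k)) \<in> borel_measurable ?M"
    by (rule measurable_compose[OF c measurable_leaf_total])
  show "(\<lambda>xs. ?Z (xs k)) \<in> borel_measurable ?M"
    by (rule measurable_compose[OF c coordinates(3)])
  show "countable ((\<lambda>(x, y). x + y) ` supp1)" using countable_supp by simp
  have "AE p in distr ?M borel (\<lambda>xs. xs k). fst p \<in> supp1"
    unfolding distr_coordinate[OF k] by (rule AE_root_law[OF n])
  then have "AE xs in ?M. fst (xs k) \<in> supp1" by (rule AE_distrD[OF c])
  then show "AE xs in ?M. ?Z (xs k) \<in> (\<lambda>(x, y). x + y) ` supp1"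
    by eventually_elim (force simp: image_iff split_beta')
  fix A :: "(real \<times> real \<times> real) set" and B :: "(real \<times> real) set" and z assume A: "A \<in> sets borel" and B: "B \<in> sets borel"
  \<comment> \<open>\<open>A'\<close> absorbs the redundant sum coordinate. \<open>B'\<close>
    depends on \<open>z\<close>: on the level the total is z plus the third leaf.\<close>
  define A' where "A' = {q::real\<times>real. (fst q, snd q, fst q + snd q) \<in> A}"
  define B' where "B' = {y::real. (y, z + y) \<in> B}"
  have "(\<lambda>q::real\<times>real. (fst q, snd q, fst q + snd q)) \<in> borel_measurable borel"
    "(\<lambda>y::real. (y, z + y)) \<in> borel_measurable borel"
    by (intro borel_measurable_Pair borel_measurable_add borel_pair measurable_const measurable_ident; simp)+
  from measurable_sets[OF this(1) A] measurable_sets[OF this(2) B]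
  have A': "A' \<in> sets borel" and B': "B' \<in> sets borel"
    by (simp_all add: A'_def B'_def vimage_def)
  have sX: "?X -` A \<in> sets borel" and sY: "?Y -` B \<in> sets borel" and sZ: "?Z -` {z} \<in> sets borel"
    using measurable_sets[OF measurable_leaves_sum A] measurable_sets[OF measurable_leaf_total B]
      measurable_sets[OF coordinates(3), of "{z}"] by simp_all
  have m: "measure ?M {xs \<in> space ?M. P (xs k)} = measure (root_law n) {p. P p}"
    if "{p. P p} = S" "S \<in> sets borel" for P S
    using measure_coordinate[OF k, of P] that by simp
  have e1: "measure ?M {xs \<in> space ?M. ?X (xs k) \<in> A \<and> ?Y (xs k) \<in> B \<and> ?Z (xs k) = z}
      = measure (root_law n) {p. ?X p \<in> A \<and> ?Y p \<in> B \<and> ?Z p = z}"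
    by (rule m[where S = "?X -` A \<inter> (?Y -` B \<inter> ?Z -` {z})"]) (use sX sY sZ in auto)
  have e2: "measure ?M {xs \<in> space ?M. ?Z (xs k) = z} = measure (root_law n) {p. ?Z p = z}"
    by (rule m[where S = "?Z -` {z}"]) (use sZ in auto)
  have e3: "measure ?M {xs \<in> space ?M. ?X (xs k) \<in> A \<and> ?Z (xs k) = z}
      = measure (root_law n) {p. ?X p \<in> A \<and> ?Z p = z}"
    by (rule m[where S = "?X -` A \<inter> ?Z -` {z}"]) (use sX sZ in auto)
  have e4: "measure ?M {xs \<in> space ?M. ?Y (xs k) \<in> B \<and> ?Z (xs k) = z}
      = measure (root_law n) {p. ?Y p \<in> B \<and> ?Z p = z}"
    by (rule m[where S = "?Y -` B \<inter> ?Z -` {z}"]) (use sY sZ in auto)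
  have f1: "{p. ?X p \<in> A \<and> ?Y p \<in> B \<and> ?Z p = z} = {p. fst p \<in> A' \<and> ?Z p = z \<and> snd p \<in> B'}"
    and f2: "{p. ?X p \<in> A \<and> ?Z p = z} = {p. fst p \<in> A' \<and> ?Z p = z}"
    and f3: "{p. ?Y p \<in> B \<and> ?Z p = z} = {p. ?Z p = z \<and> snd p \<in> B'}"
    by (auto simp: A'_def B'_def)
  show "measure ?M {xs \<in> space ?M. ?X (xs k) \<in> A \<and> ?Y (xs k) \<in> B \<and> ?Z (xs k) = z} * measure ?M {xs \<in> space ?M. ?Z (xs k) = z}
      = measure ?M {xs \<in> space ?M. ?X (xs k) \<in> A \<and> ?Z (xs k) = z} * measure ?M {xs \<in> space ?M. ?Y (xs k) \<in> B \<and> ?Z (xs k) = z}"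
    unfolding e1 e2 e3 e4 f1 f2 f3 by (rule root_law_identity[OF n A' B'])
qed

lemma conv_in_distr_root:
  "conv_in_distr (\<lambda>n. distr (mra_root n p11 p12 p2 c1 c0) borel (\<lambda>xs. xs 0)) \<mu>"
  unfolding conv_in_distr_def
proof (intro allI impI)
  fix f :: "(real \<times> real) \<times> real \<Rightarrow> real"
  assume f: "continuous_on UNIV f \<and> bounded (range f)"
  then obtain K where K: "\<And>x. \<bar>f x\<bar> \<le> K"
    unfolding bounded_iff by auto
  have fm: "f \<in> borel_measurable borel"
    using f by (intro borel_measurable_continuous_onI) simp
  have "(\<lambda>n. \<integral>x. f x \<partial>root_law n) \<longlonglongrightarrow> (\<integral>x. f x \<partial>\<mu>)"
    by (rule integral_tendsto_of_atoms[where C=supp and K=K])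
      (simp_all add: prob_root_law prob_\<mu> countable_supp AE_supp root_law_atom_tendsto fm K)
  moreover have "eventually (\<lambda>n. (\<integral>x. f x \<partial>distr (mra_root n p11 p12 p2 c1 c0) borel (\<lambda>xs. xs 0))
      = (\<integral>x. f x \<partial>root_law n)) sequentially"
    using eventually_gt_at_top[of 0] by eventually_elim (simp add: distr_coordinate)
  ultimately show "(\<lambda>n. \<integral>x. f x \<partial>distr (mra_root n p11 p12 p2 c1 c0) borel (\<lambda>xs. xs 0)) \<longlonglongrightarrow> (\<integral>x. f x \<partial>\<mu>)"
    by (simp only: tendsto_cong)
qed

lemma glivenko_cantelli_root:
  "AE \<omega> in (\<Pi>\<^sub>M n \<in> UNIV. mra_root n p11 p12 p2 c1 c0).
     (\<lambda>n. \<Squnion>x. \<bar>emp_cdf3 n (\<omega> n) x - cdf3 \<mu> x\<bar>) \<longlonglongrightarrow> 0"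
proof -
  have le3: "{y. le3 y x} \<in> sets borel" for x
  proof -
    have "{y. le3 y x} = (\<lambda>y. fst (fst y)) -` {..fst (fst x)} \<inter> ((\<lambda>y. snd (fst y)) -` {..snd (fst x)} \<inter> snd -` {..snd x})"
      by (auto simp: le3_def)
    then show ?thesis
      using measurable_sets[OF coordinates(1), of "{..fst (fst x)}"]
        measurable_sets[OF coordinates(2), of "{..snd (fst x)}"]
        measurable_sets[OF borel_triple(2), of "{..snd x}"] by simp
  qed
  have "AE \<omega> in (PiM UNIV (\<lambda>n. PiM {..<n} (\<lambda>_. root_law n))).
           (\<lambda>n. \<Squnion>x. \<bar>freq n {y. le3 y x} (\<omega> n) - measure \<mu> {y. le3 y x}\<bar>) \<longlonglongrightarrow> 0"
    by (rule glivenko_cantelli_atoms[where C=supp])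
      (simp_all add: prob_root_law prob_\<mu> countable_supp AE_supp root_law_atom_tendsto le3)
  then show ?thesis
    unfolding mra_root_eq by (simp add: emp_cdf3_def cdf3_def freq_def)
qed

lemma indep_vars_root:
  "prob_space.indep_vars (mra_root n p11 p12 p2 c1 c0) (\<lambda>_. borel) (\<lambda>k xs. xs k) {..<n}"
  unfolding mra_root_eq by (rule indep_vars_PiM_coordinates) (auto intro: prob_root_law)

end

theorem theorem4p2:
  fixes p11 p12 p2 :: "real pmf"
    and c1 c0 :: "real \<times> real \<Rightarrow> real"
    and \<mu> :: "((real \<times> real) \<times> real) measure"
  assumes cop1: "is_copula_density c1"
    and cop0: "is_copula_density c0"
    and tree: "tree_dependent \<mu> p11 p12 p2 c1 c0"
    and reg1: "density_condition c1 (pmf_cdf p11) (pmf_cdf p12)"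
    and reg0: "density_condition c0
                 (\<lambda>y. measure \<mu> {\<omega> \<in> space \<mu>. fst (fst \<omega>) + snd (fst \<omega>) \<le> y}) (pmf_cdf p2)"
  shows
    "(\<forall>n. prob_space.indep_vars (mra_root n p11 p12 p2 c1 c0) (\<lambda>_. borel) (\<lambda>k xs. xs k) {..<n}
         \<and> (\<forall>k<n. distr (mra_root n p11 p12 p2 c1 c0) borel (\<lambda>xs. xs k)
                   = distr (mra_root n p11 p12 p2 c1 c0) borel (\<lambda>xs. xs 0)))
     \<and> (\<forall>n. \<forall>k<n. cond_indep (mra_root n p11 p12 p2 c1 c0)
              (\<lambda>xs. (fst (fst (xs k)), snd (fst (xs k)), fst (fst (xs k)) + snd (fst (xs k))))
              (\<lambda>xs. (snd (xs k), fst (fst (xs k)) + snd (fst (xs k)) + snd (xs k)))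
              (\<lambda>xs. fst (fst (xs k)) + snd (fst (xs k))))
     \<and> conv_in_distr (\<lambda>n. distr (mra_root n p11 p12 p2 c1 c0) borel (\<lambda>xs. xs 0)) \<mu>
     \<and> (AE \<omega> in (\<Pi>\<^sub>M n \<in> UNIV. mra_root n p11 p12 p2 c1 c0).
          (\<lambda>n. \<Squnion>x. \<bar>emp_cdf3 n (\<omega> n) x - cdf3 \<mu> x\<bar>) \<longlonglongrightarrow> 0)"
proof -
  interpret mra_tree p11 p12 p2 c1 c0 \<mu>
    using cop1 cop0 tree by (rule mra_tree.intro)
  show ?thesis
  proof (intro conjI allI impI)
    fix n k :: nat assume k: "k < n"
    then have "0 < n" by simp
    then show "distr (mra_root n p11 p12 p2 c1 c0) borel (\<lambda>xs. xs k)
        = distr (mra_root n p11 p12 p2 c1 c0) borel (\<lambda>xs. xs 0)"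
      by (simp only: distr_coordinate k)
  qed (rule indep_vars_root cond_indep_root conv_in_distr_root glivenko_cantelli_root; assumption?)+
qed

end
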